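(* $\mathcal U$ is the whole group of units of the algebra $\mathbb I^{*}$.
   Context: Fix real numbers $a<b$. $\boldsymbol{B_1}$ is the algebra of smooth functions $P:[a,b]\to\mathbb C$, and $\boldsymbol{B}_1^{+}=\{P\in\boldsymbol{B_1}: P(x)\ne0 \text{ for all } x\in[a,b]\}$. $\Delta=\{(x,y): a\le y\le x\le b\}$, and $\boldsymbol{B_2}$ is the algebra of smooth functions $f:\Delta\to\mathbb C$ (all partial derivatives of all orders exist and are continuous on $\Delta$). $M[a,b]$ is the space of all smooth $\phi:[a,b]\to\mathbb C$ all of whose derivatives (including order $0$) vanish at $a$. $\widehat I_M$ is the subalgebra of $\mathrm{End}_{\mathbb C}(M[a,b])$ generated by the operators $\phi\mapsto P\phi$ ($P\in\boldsymbol{B_1}$), $\partial_x:\phi\mapsto\phi'$, and $f(x,y)\theta(x-y):\phi\mapsto\int_a^xf(x,z)\phi(z)\,dz$ ($f\in\boldsymbol{B_2}$). Every element of $\widehat I_M$ is uniquely a sum $\big(\sum_{i=1}^nP_i\partial_x^i+P_0\big)+f(x,y)\theta(x-y)$. $\mathbb I^{*}$ is an isomorphic copy of $\widehat I_M$, in which this element is written $\big(\sum_{i=1}^nP_i\partial_x^i+P_0\big)\widehat\beta+f(x,y)\widehat\theta$ and the product (corresponding to composition) is denoted $\bullet$, with identity $\widehat\beta$. The following elements are invertible in $\mathbb I^*$: (type 1) $P_0\widehat\beta$ with $P_0\in\boldsymbol{B}_1^+$; (type 2) $P_0\widehat\beta+f\widehat\theta$ with $P_0\in\boldsymbol{B}_1^+$,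 $f\in\boldsymbol{B_2}$, $f\widehat\theta\neq0$; (type 3) $\big(\sum_{i=1}^nP_i\partial_x^i+P_0\big)\widehat\beta+f\widehat\theta$ with $n\ge1$, $P_i\in\boldsymbol{B_1}$, $P_n\in\boldsymbol{B}_1^+$, $f\in\boldsymbol{B_2}$. $\mathcal U$ is the subgroup of the group of units of $\mathbb I^*$ generated by all elements of types 1, 2 and 3. *)

theory Defs
  imports "HOL-Analysis.Analysis" "HOL-Algebra.Generated_Groups" "HOL-Algebra.QuotRing"
    "HOL-Algebra.Module"
begin

(* Functions on [a,b] are total functions on real. Derivatives are taken within [a,b]
   (one-sided at the end points) and set to 0 outside [a,b]. *)

definition der :: "real \<Rightarrow> real \<Rightarrow> (real \<Rightarrow> complex) \<Rightarrow> (real \<Rightarrow> complex)" where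
  "der a b \<phi> = (\<lambda>x. if x \<in> {a..b} then vector_derivative \<phi> (at x within {a..b}) else 0)"

(* Membership depends only on the values on [a,b]. *)

definition B1 :: "real \<Rightarrow> real \<Rightarrow> (real \<Rightarrow> complex) set" where
  "B1 a b = {P. \<forall>n. ((der a b ^^ n) P) differentiable_on {a..b}}"

definition B1_plus :: "real \<Rightarrow> real \<Rightarrow> (real \<Rightarrow> complex) set" where
  "B1_plus a b = {P \<in> B1 a b. \<forall>x\<in>{a..b}. P x \<noteq> 0}"

definition triangle :: "real \<Rightarrow> real \<Rightarrow> (real \<times> real) set" where
  "triangle a b = {(x, y). a \<le> y \<and> y \<le> x \<and> x \<le> b}"

(* C^k functions on the closed triangle. Partial derivatives are taken within the slices of the
   triangle. At the corners (b,b) and (a,a) the slice {y..b}, respectively {a..x}, is a single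
   point and the derivative condition is vacuous there; the value of that partial derivative is
   then determined by its continuity on the triangle. *)

primrec Ck_triangle :: "real \<Rightarrow> real \<Rightarrow> nat \<Rightarrow> (real \<times> real \<Rightarrow> complex) \<Rightarrow> bool" where
  "Ck_triangle a b 0 f \<longleftrightarrow> continuous_on (triangle a b) f"
| "Ck_triangle a b (Suc k) f \<longleftrightarrow> continuous_on (triangle a b) f \<and>
     (\<exists>fx fy. Ck_triangle a b k fx \<and> Ck_triangle a b k fy \<and>
       (\<forall>x y. (x, y) \<in> triangle a b \<longrightarrow>
         ((\<lambda>t. f (t, y)) has_vector_derivative fx (x, y)) (at x within {y..b}) \<and>
         ((\<lambda>t. f (x, t)) has_vector_derivative fy (x, y)) (at y within {a..x})))"

definition B2 :: "real \<Rightarrow> real \<Rightarrow> (real \<times> real \<Rightarrow> complex) set" where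
  "B2 a b = {f. \<forall>k. Ck_triangle a b k f}"

(* Elements are normalised to 0 outside [a,b], so that equality of elements is equality of
   functions on [a,b]. *)

definition Msp :: "real \<Rightarrow> real \<Rightarrow> (real \<Rightarrow> complex) set" where
  "Msp a b = {\<phi> \<in> B1 a b. (\<forall>x. x \<notin> {a..b} \<longrightarrow> \<phi> x = 0) \<and> (\<forall>n. (der a b ^^ n) \<phi> a = 0)}"

type_synonym oper = "(real \<Rightarrow> complex) \<Rightarrow> (real \<Rightarrow> complex)"

(* The algebra of complex-linear endomorphisms of M[a,b]; operators are extensional on M[a,b]. *)

definition End_M :: "real \<Rightarrow> real \<Rightarrow> (complex, oper) module" where
  "End_M a b =
     \<lparr>carrier = {T \<in> Msp a b \<rightarrow>\<^sub>E Msp a b.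
        (\<forall>\<phi>\<in>Msp a b. \<forall>\<psi>\<in>Msp a b. T (\<lambda>x. \<phi> x + \<psi> x) = (\<lambda>x. T \<phi> x + T \<psi> x)) \<and>
        (\<forall>c. \<forall>\<phi>\<in>Msp a b. T (\<lambda>x. c * \<phi> x) = (\<lambda>x. c * T \<phi> x))},
      mult = (\<lambda>S T. compose (Msp a b) S T),
      one = (\<lambda>\<phi>\<in>Msp a b. \<phi>),
      zero = (\<lambda>\<phi>\<in>Msp a b. \<lambda>x. 0),
      add = (\<lambda>S T. \<lambda>\<phi>\<in>Msp a b. \<lambda>x. S \<phi> x + T \<phi> x),
      smult = (\<lambda>c T. \<lambda>\<phi>\<in>Msp a b. \<lambda>x. c * T \<phi> x)\<rparr>"

definition mult_op :: "real \<Rightarrow> real \<Rightarrow> (real \<Rightarrow> complex) \<Rightarrow> oper" where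
  "mult_op a b P = (\<lambda>\<phi>\<in>Msp a b. \<lambda>x. P x * \<phi> x)"

definition deriv_op :: "real \<Rightarrow> real \<Rightarrow> oper" where
  "deriv_op a b = (\<lambda>\<phi>\<in>Msp a b. der a b \<phi>)"

definition volterra_op :: "real \<Rightarrow> real \<Rightarrow> (real \<times> real \<Rightarrow> complex) \<Rightarrow> oper" where
  "volterra_op a b f =
     (\<lambda>\<phi>\<in>Msp a b. \<lambda>x. if x \<in> {a..b} then integral {a..x} (\<lambda>z. f (x, z) * \<phi> z) else 0)"

(* The differential operator with coefficients P 0, ..., P n. *)

definition diff_op :: "real \<Rightarrow> real \<Rightarrow> nat \<Rightarrow> (nat \<Rightarrow> real \<Rightarrow> complex) \<Rightarrow> oper" where
  "diff_op a b n P = (\<lambda>\<phi>\<in>Msp a b. \<lambda>x. \<Sum>i\<le>n. P i x * (der a b ^^ i) \<phi> x)"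

(* Subalgebra over the complex numbers generated by S; negatives are multiples by -1. *)

inductive_set gen_subalgebra ::
    "(complex, 'r, 'm) module_scheme \<Rightarrow> 'r set \<Rightarrow> 'r set" for A and S where
  one: "\<one>\<^bsub>A\<^esub> \<in> gen_subalgebra A S"
| incl: "s \<in> S \<Longrightarrow> s \<in> gen_subalgebra A S"
| add: "u \<in> gen_subalgebra A S \<Longrightarrow> v \<in> gen_subalgebra A S \<Longrightarrow> u \<oplus>\<^bsub>A\<^esub> v \<in> gen_subalgebra A S"
| mult: "u \<in> gen_subalgebra A S \<Longrightarrow> v \<in> gen_subalgebra A S \<Longrightarrow> u \<otimes>\<^bsub>A\<^esub> v \<in> gen_subalgebra A S"
| smult: "u \<in> gen_subalgebra A S \<Longrightarrow> c \<odot>\<^bsub>A\<^esub> u \<in> gen_subalgebra A S"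

definition I_M :: "real \<Rightarrow> real \<Rightarrow> (complex, oper) module" where
  "I_M a b = (End_M a b)\<lparr>carrier := gen_subalgebra (End_M a b)
     (mult_op a b ` B1 a b \<union> {deriv_op a b} \<union> volterra_op a b ` B2 a b)\<rparr>"

definition algebra_iso ::
    "(complex, 'r, 'm) module_scheme \<Rightarrow> (complex, 's, 'n) module_scheme \<Rightarrow> ('r \<Rightarrow> 's) set" where
  "algebra_iso A B =
     {h \<in> ring_iso A B. \<forall>c. \<forall>u\<in>carrier A. h (c \<odot>\<^bsub>A\<^esub> u) = c \<odot>\<^bsub>B\<^esub> h u}"

(* Below, R is a copy of I_M and h the isomorphism onto it, so that
   h (diff_op a b n P) is the element usually written (P n d^n + ... + P 1 d + P 0) beta and
   h (volterra_op a b f) the element usually written f theta. *)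

definition type1 :: "real \<Rightarrow> real \<Rightarrow> (oper \<Rightarrow> 's) \<Rightarrow> 's set" where
  "type1 a b h = {h (mult_op a b P0) | P0. P0 \<in> B1_plus a b}"

definition type2 :: "real \<Rightarrow> real \<Rightarrow> (complex, 's, 'n) module_scheme \<Rightarrow> (oper \<Rightarrow> 's) \<Rightarrow> 's set" where
  "type2 a b R h = {h (mult_op a b P0) \<oplus>\<^bsub>R\<^esub> h (volterra_op a b f) | P0 f.
     P0 \<in> B1_plus a b \<and> f \<in> B2 a b \<and> h (volterra_op a b f) \<noteq> \<zero>\<^bsub>R\<^esub>}"

definition type3 :: "real \<Rightarrow> real \<Rightarrow> (complex, 's, 'n) module_scheme \<Rightarrow> (oper \<Rightarrow> 's) \<Rightarrow> 's set" where
  "type3 a b R h = {h (diff_op a b n P) \<oplus>\<^bsub>R\<^esub> h (volterra_op a b f) | n P f.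
     n \<ge> 1 \<and> (\<forall>i\<le>n. P i \<in> B1 a b) \<and> P n \<in> B1_plus a b \<and> f \<in> B2 a b}"

definition U_group :: "real \<Rightarrow> real \<Rightarrow> (complex, 's, 'n) module_scheme \<Rightarrow> (oper \<Rightarrow> 's) \<Rightarrow> 's set" where
  "U_group a b R h =
     generate (units_of R) (type1 a b h \<union> type2 a b R h \<union> type3 a b R h)"

end

theory Submission
  imports Defs
begin

text \<open>
Write \<open>\<partial>\<close> for differentiation and \<open>f \<theta>\<close> for the Volterra operator with kernel \<open>f\<close>. The elements of
types 1, 2 and 3 are exactly the operators \<open>P\<^sub>n \<partial>^n + \<dots> + P\<^sub>0 + f \<theta>\<close> whose top coefficient \<open>P\<^sub>n\<close> has no
zeros; they are called elliptic here. The theorem follows from two facts: elliptic operators are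
invertible in the algebra, and of two mutually inverse elements of the algebra at least one is
elliptic. By the second fact every unit is a generator or the inverse of a generator.

Invertibility (\<open>nonvanishing_leads_invertible\<close>). All derivatives of a function in \<open>M\<close> vanish at \<open>a\<close>, so
\<open>\<theta>\<close>, the Volterra operator with kernel 1, is the inverse of \<open>\<partial>\<close>, and multiplication by powers of \<open>\<theta>\<close>
reduces the order to zero. There the operator is \<open>P\<^sub>0 (1 - g \<theta>)\<close>, and \<open>1 - g \<theta>\<close> is inverted by
\<open>1 + r \<theta>\<close>, where the resolvent kernel \<open>r\<close> is the sum of the Neumann series. The two integral equations
for \<open>r\<close> express its partial derivatives through \<open>r\<close> itself, so \<open>r\<close> is smooth on the triangle
(\<open>smooth_resolvent\<close>).

Ellipticity (\<open>inverse_pair_elliptic\<close>). Let \<open>S T = 1\<close>, with orders at most \<open>p\<close>. Then \<open>\<partial>^p S\<close> and \<open>T \<partial>^p\<close>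
have product \<open>\<partial>^(2 p)\<close>, and in the orders from \<open>2 p\<close> on this product is not affected by the Volterra
parts. Let \<open>\<beta>\<^sub>j\<close> and \<open>\<alpha>\<^sub>i\<close> be the coefficients of the two factors. The ring of smooth functions has zero
divisors, so comparing top coefficients is not enough; but it has no nilpotents, and as for
polynomials over such rings (Armendariz) all products \<open>\<beta>\<^sub>j \<alpha>\<^sub>i\<close> with \<open>i + j > 2 p\<close> vanish. It follows that
the products \<open>\<beta>\<^sub>j \<alpha>\<^sub>i\<close> with \<open>i + j = 2 p\<close> are orthogonal idempotents with sum 1. The interval is
connected, so one of them is 1 everywhere and the others are 0. Therefore \<open>T \<partial>^p\<close> has a
top coefficient without zeros, and \<open>T\<close> is elliptic or a pure Volterra operator. The same holds for the
inverse, and two Volterra operators cannot be mutually inverse.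

Comparing coefficients requires that an operator determines its leading coefficient
(\<open>leads_unique\<close>). This is seen on test functions \<open>exp (l x) \<psi>(x)\<close> with \<open>\<psi>\<close> flat at \<open>a\<close>, as \<open>l\<close> tends
to infinity.
\<close>

section \<open>Calculus on the triangle\<close>

lemma continuous_on_triangle_compose:
  assumes "continuous_on (triangle a b) f" "continuous_on S p" "continuous_on S q"
    and "\<And>x. x \<in> S \<Longrightarrow> a \<le> q x \<and> q x \<le> p x \<and> p x \<le> b"
  shows "continuous_on S (\<lambda>x. f (p x, q x))"
  by (rule continuous_on_compose2[OF assms(1) continuous_on_Pair[OF assms(2,3)]])
     (use assms(4) in \<open>auto simp: triangle_def\<close>)

text \<open>A mean value estimate in which the comparison value \<open>v\<close> need not be a value of \<open>g'\<close> on the segment: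
below, \<open>v\<close> is a partial derivative at a point off the slice.\<close>

lemma segment_linearization:
  fixes g :: "real \<Rightarrow> complex"
  assumes "s \<le> t"
    and d: "\<And>x. x \<in> {s..t} \<Longrightarrow> (g has_vector_derivative g' x) (at x within {s..t})"
    and e: "\<And>x. x \<in> {s..t} \<Longrightarrow> norm (g' x - v) \<le> e"
  shows "norm (g t - g s - (t - s) *\<^sub>R v) \<le> e * (t - s)"
proof -
  have e0: "0 \<le> e" using order_trans[OF norm_ge_zero e[of s]] assms(1) by simp
  have "((\<lambda>x. g' x - v) has_integral (g t - g s - (t - s) *\<^sub>R v)) {s..t}"
    using has_integral_diff[OF fundamental_theorem_of_calculus[OF assms(1) d] has_integral_const_real[of v s t]]
      assms(1) by simp
  from has_integral_bound_real[OF e0 finite.emptyI this] e assms(1) show ?thesis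
    by auto
qed

text \<open>The chain rule along the diagonal, for a function known only on one side of it and only to have
continuous partial derivatives along slices. Two points \<open>(s, s)\<close> and \<open>(t, t)\<close> with \<open>s \<le> t\<close> are joined
through the corner \<open>(t, s)\<close>, which lies in the triangle, so each leg stays in a slice.

This is the source of all differentiation rules for integrals over the triangle: an integral with
both the limit and the integrand depending on \<open>x\<close> is the diagonal restriction of a function in which
the two dependences are separated.\<close>

lemma has_vector_derivative_diagonal:
  fixes J Jx Ju :: "real \<times> real \<Rightarrow> complex"
  assumes cx: "continuous_on (triangle a b) Jx" and cu: "continuous_on (triangle a b) Ju"
    and dx: "\<And>x u. (x, u) \<in> triangle a b \<Longrightarrow>
      ((\<lambda>t. J (t, u)) has_vector_derivative Jx (x, u)) (at x within {u..b})"
    and du: "\<And>x u. (x, u) \<in> triangle a b \<Longrightarrow>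
      ((\<lambda>t. J (x, t)) has_vector_derivative Ju (x, u)) (at u within {a..x})"
    and c: "c \<in> {a..b}"
  shows "((\<lambda>t. J (t, t)) has_vector_derivative Jx (c, c) + Ju (c, c)) (at c within {a..b})"
  unfolding has_vector_derivative_def has_derivative_within_alt
proof (intro conjI allI impI bounded_linear_scaleR_left)
  fix e :: real assume e: "e > 0"
  have cc: "(c, c) \<in> triangle a b" using c by (auto simp: triangle_def)
  obtain d1 where d1: "d1 > 0" "\<And>p. p \<in> triangle a b \<Longrightarrow> dist p (c, c) < d1 \<Longrightarrow> dist (Jx p) (Jx (c, c)) < e/2"
    using cx[unfolded continuous_on_iff, rule_format, OF cc, of "e/2"] e by auto
  obtain d2 where d2: "d2 > 0" "\<And>p. p \<in> triangle a b \<Longrightarrow> dist p (c, c) < d2 \<Longrightarrow> dist (Ju p) (Ju (c, c)) < e/2"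
    using cu[unfolded continuous_on_iff, rule_format, OF cc, of "e/2"] e by auto
  define d where "d = min d1 d2 / 2"
  have d: "d > 0" using d1 d2 by (simp add: d_def)
  have near: "dist (x, y) (c, c) < 2 * d" if "\<bar>x - c\<bar> < d" "\<bar>y - c\<bar> < d" for x y
  proof -
    have "dist (x, y) (c, c) \<le> \<bar>x - c\<bar> + \<bar>y - c\<bar>"
      unfolding dist_Pair_Pair dist_real_def using sqrt_sum_squares_le_sum_abs by simp
    then show ?thesis using that by simp
  qed
  have key: "norm (J (t, t) - J (s, s) - (t - s) *\<^sub>R (Jx (c, c) + Ju (c, c))) \<le> e * (t - s)"
    if st: "s \<le> t" "a \<le> s" "t \<le> b" "\<bar>s - c\<bar> < d" "\<bar>t - c\<bar> < d" for s t
  proof -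
    have A: "norm (J (t, t) - J (t, s) - (t - s) *\<^sub>R Ju (c, c)) \<le> e / 2 * (t - s)"
    proof (rule segment_linearization[OF st(1)])
      fix u assume u: "u \<in> {s..t}"
      then have m: "(t, u) \<in> triangle a b" using st by (auto simp: triangle_def)
      show "((\<lambda>u. J (t, u)) has_vector_derivative Ju (t, u)) (at u within {s..t})"
        by (rule has_vector_derivative_within_subset[OF du[OF m]]) (use st in auto)
      have "dist (t, u) (c, c) < d2" using near[of t u] u st by (auto simp: d_def abs_if split: if_splits)
      from d2(2)[OF m this] show "norm (Ju (t, u) - Ju (c, c)) \<le> e / 2" by (simp add: dist_norm)
    qed
    have B: "norm (J (t, s) - J (s, s) - (t - s) *\<^sub>R Jx (c, c)) \<le> e / 2 * (t - s)"
    proof (rule segment_linearization[OF st(1), where g = "\<lambda>u. J (u, s)"])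
      fix u assume u: "u \<in> {s..t}"
      then have m: "(u, s) \<in> triangle a b" using st by (auto simp: triangle_def)
      show "((\<lambda>u. J (u, s)) has_vector_derivative Jx (u, s)) (at u within {s..t})"
        by (rule has_vector_derivative_within_subset[OF dx[OF m]]) (use st in auto)
      have "dist (u, s) (c, c) < d1" using near[of u s] u st by (auto simp: d_def abs_if split: if_splits)
      from d1(2)[OF m this] show "norm (Jx (u, s) - Jx (c, c)) \<le> e / 2" by (simp add: dist_norm)
    qed
    have "J (t, t) - J (s, s) - (t - s) *\<^sub>R (Jx (c, c) + Ju (c, c)) =
      (J (t, t) - J (t, s) - (t - s) *\<^sub>R Ju (c, c)) + (J (t, s) - J (s, s) - (t - s) *\<^sub>R Jx (c, c))"
      by (simp add: algebra_simps)
    also have "norm \<dots> \<le> e / 2 * (t - s) + e / 2 * (t - s)"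
      by (rule order_trans[OF norm_triangle_ineq add_mono[OF A B]])
    finally show ?thesis by simp
  qed
  have "norm (J (y, y) - J (c, c) - (y - c) *\<^sub>R (Jx (c, c) + Ju (c, c))) \<le> e * norm (y - c)"
    if "y \<in> {a..b}" "norm (y - c) < d" for y
  proof (cases "c \<le> y")
    case True
    then show ?thesis using key[of c y] that c d by auto
  next
    case False
    have "J (y, y) - J (c, c) - (y - c) *\<^sub>R (Jx (c, c) + Ju (c, c)) =
      - (J (c, c) - J (y, y) - (c - y) *\<^sub>R (Jx (c, c) + Ju (c, c)))"
      by (simp add: algebra_simps)
    then show ?thesis using False key[of y c] that c d by (simp only: norm_minus_cancel) auto
  qed
  then show "\<exists>d>0. \<forall>y\<in>{a..b}. norm (y - c) < d \<longrightarrow>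
     norm (J (y, y) - J (c, c) - (y - c) *\<^sub>R (Jx (c, c) + Ju (c, c))) \<le> e * norm (y - c)"
    using d by blast
qed

text \<open>Rescaling to a fixed interval turns moving limits of integration into parameters of the integrand.\<close>

lemma integral_unit_interval:
  fixes h :: "real \<Rightarrow> complex"
  assumes "l \<le> u" "continuous_on {l..u} h"
  shows "integral {l..u} h = (u - l) *\<^sub>R integral {0..1} (\<lambda>s. h (l + s * (u - l)))"
proof (cases "l = u")
  case False
  then have lu: "u - l > 0" using assms by simp
  have i: "(h has_integral integral {l..u} h) (cbox l u)"
    using integrable_integral[OF integrable_continuous_real[OF assms(2)]] by simp
  have e: "(u - l) / (u - l) = 1" using lu by simp
  from has_integral_affinity'[OF i lu, of l] lu
  have "((\<lambda>s. h (l + s * (u - l))) has_integral integral {l..u} h /\<^sub>R (u - l)) {0..1}"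
    by (simp add: algebra_simps e divide_inverse[symmetric])
  then show ?thesis using lu by (simp add: integral_unique)
qed simp

lemma continuous_on_integral_moving_limits:
  fixes K :: "'a::topological_space \<Rightarrow> real \<Rightarrow> complex"
  assumes l: "continuous_on S l" and u: "continuous_on S u" and lu: "\<And>p. p \<in> S \<Longrightarrow> l p \<le> u p"
    and K: "continuous_on {(p, z). p \<in> S \<and> l p \<le> z \<and> z \<le> u p} (\<lambda>(p, z). K p z)"
  shows "continuous_on S (\<lambda>p. integral {l p..u p} (K p))"
proof -
  have m: "l p \<le> l p + s * (u p - l p) \<and> l p + s * (u p - l p) \<le> u p" if "p \<in> S" "s \<in> {0..1}" for p s
  proof -
    have "s * (u p - l p) \<le> 1 * (u p - l p)" using that lu[of p] by (intro mult_right_mono) auto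
    then show ?thesis using that lu[of p] by auto
  qed
  have c: "continuous_on {l p..u p} (K p)" if "p \<in> S" for p
  proof -
    have "continuous_on {l p..u p} (\<lambda>z. (\<lambda>(p, z). K p z) (p, z))"
      by (rule continuous_on_compose2[OF K]) (use that in \<open>auto intro!: continuous_intros\<close>)
    then show ?thesis by simp
  qed
  have "continuous_on (S \<times> cbox 0 1) (\<lambda>(p, s). K p (l p + s * (u p - l p)))"
    using continuous_on_compose2[OF K, of "S \<times> cbox 0 1" "\<lambda>(p, s). (p, l p + s * (u p - l p))"] m
    by (force simp: split_beta intro!: continuous_intros continuous_on_compose2[OF l] continuous_on_compose2[OF u])
  from integral_continuous_on_param[OF this]
  have "continuous_on S (\<lambda>p. (u p - l p) *\<^sub>R integral {0..1} (\<lambda>s. K p (l p + s * (u p - l p))))"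
    by (auto intro!: continuous_intros l u)
  then show ?thesis
    by (rule continuous_on_eq) (simp add: integral_unit_interval lu c)
qed

text \<open>Leibniz' rule when the integrand exists only for \<open>z \<le> x\<close>. For \<open>J (x, u) = integral {a..u}\<close> with \<open>u \<le> x\<close>
the variable \<open>x\<close> runs over \<open>{u..b}\<close> and \<open>z\<close> over \<open>{a..u}\<close>, a rectangle inside the triangle, so the
rule for fixed limits gives the \<open>x\<close>-derivative of \<open>J\<close>; the diagonal rule does the rest.\<close>

lemma leibniz_upper_triangle:
  fixes f fx :: "real \<times> real \<Rightarrow> complex" and G :: "real \<Rightarrow> complex"
  assumes cf: "continuous_on (triangle a b) f" and cfx: "continuous_on (triangle a b) fx"
    and cG: "continuous_on {a..b} G"
    and d: "\<And>x z. (x, z) \<in> triangle a b \<Longrightarrow>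
      ((\<lambda>t. f (t, z)) has_vector_derivative fx (x, z)) (at x within {z..b})"
    and x: "x \<in> {a..b}"
  shows "((\<lambda>x. integral {a..x} (\<lambda>z. f (x, z) * G z)) has_vector_derivative
      f (x, x) * G x + integral {a..x} (\<lambda>z. fx (x, z) * G z)) (at x within {a..b})"
proof -
  let ?J = "\<lambda>(x, u). integral {a..u} (\<lambda>z. f (x, z) * G z)"
  let ?Jx = "\<lambda>(x, u). integral {a..u} (\<lambda>z. fx (x, z) * G z)"
  let ?Ju = "\<lambda>(x, u). f (x, u) * G u"
  note ci = continuous_intros continuous_on_triangle_compose[OF cf] continuous_on_triangle_compose[OF cfx]
    continuous_on_compose2[OF cG]
  have "((\<lambda>t. ?J (t, t)) has_vector_derivative ?Jx (x, x) + ?Ju (x, x)) (at x within {a..b})"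
  proof (rule has_vector_derivative_diagonal[OF _ _ _ _ x])
    show "continuous_on (triangle a b) ?Jx" unfolding split_beta
      by (rule continuous_on_integral_moving_limits) (auto simp: triangle_def split_beta intro!: ci)
    show "continuous_on (triangle a b) ?Ju" unfolding split_beta
      by (auto simp: split_beta cf triangle_def intro!: ci cf[unfolded triangle_def])
    fix x u assume xu: "(x, u) \<in> triangle a b"
    show "((\<lambda>t. ?J (t, u)) has_vector_derivative ?Jx (x, u)) (at x within {u..b})"
      unfolding split
    proof (rule leibniz_rule_vector_derivative[of "{u..b}" a u "\<lambda>x z. f (x, z) * G z" "\<lambda>x z. fx (x, z) * G z", unfolded cbox_interval])
      fix t z assume tz: "t \<in> {u..b}" "z \<in> {a..u}"
      have "((\<lambda>t. f (t, z)) has_vector_derivative fx (t, z)) (at t within {u..b})"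
        by (rule has_vector_derivative_within_subset[OF d]) (use tz in \<open>auto simp: triangle_def\<close>)
      then show "((\<lambda>x. f (x, z) * G z) has_vector_derivative fx (t, z) * G z) (at t within {u..b})"
        by (rule has_vector_derivative_mult_left)
    next
      fix t assume "t \<in> {u..b}"
      with xu show "(\<lambda>z. f (t, z) * G z) integrable_on {a..u}"
        by (intro integrable_continuous_real ci) (auto simp: triangle_def)
    qed (use xu in \<open>auto simp: triangle_def split_beta intro!: ci continuous_on_subset[OF cfx]\<close>)
    show "((\<lambda>t. ?J (x, t)) has_vector_derivative ?Ju (x, u)) (at u within {a..x})"
      unfolding split
      by (rule integral_has_vector_derivative) (use xu in \<open>auto simp: triangle_def intro!: ci\<close>)
  qed
  then show ?thesis by (simp add: add.commute)
qed

lemma leibniz_lower_triangle: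
  fixes g gy :: "real \<times> real \<Rightarrow> complex" and F :: "real \<Rightarrow> complex"
  assumes cg: "continuous_on (triangle a b) g" and cgy: "continuous_on (triangle a b) gy"
    and cF: "continuous_on {a..b} F"
    and d: "\<And>z y. (z, y) \<in> triangle a b \<Longrightarrow>
      ((\<lambda>t. g (z, t)) has_vector_derivative gy (z, y)) (at y within {a..z})"
    and y: "y \<in> {a..b}"
  shows "((\<lambda>y. integral {y..b} (\<lambda>z. F z * g (z, y))) has_vector_derivative
      - (F y * g (y, y)) + integral {y..b} (\<lambda>z. F z * gy (z, y))) (at y within {a..b})"
proof -
  let ?J = "\<lambda>(u, y). integral {u..b} (\<lambda>z. F z * g (z, y))"
  let ?Jy = "\<lambda>(u, y). integral {u..b} (\<lambda>z. F z * gy (z, y))"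
  let ?Ju = "\<lambda>(u, y). - (F u * g (u, y))"
  note ci = continuous_intros continuous_on_triangle_compose[OF cg] continuous_on_triangle_compose[OF cgy]
    continuous_on_compose2[OF cF]
  have "((\<lambda>t. ?J (t, t)) has_vector_derivative ?Ju (y, y) + ?Jy (y, y)) (at y within {a..b})"
  proof (rule has_vector_derivative_diagonal[OF _ _ _ _ y])
    show "continuous_on (triangle a b) ?Jy" unfolding split_beta
      by (rule continuous_on_integral_moving_limits) (auto simp: triangle_def split_beta intro!: ci)
    show "continuous_on (triangle a b) ?Ju" unfolding split_beta
      by (auto simp: split_beta cg triangle_def intro!: ci cg[unfolded triangle_def])
    fix u y assume uy: "(u, y) \<in> triangle a b"
    show "((\<lambda>t. ?J (u, t)) has_vector_derivative ?Jy (u, y)) (at y within {a..u})"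
      unfolding split
    proof (rule leibniz_rule_vector_derivative[of "{a..u}" u b "\<lambda>y z. F z * g (z, y)" "\<lambda>y z. F z * gy (z, y)", unfolded cbox_interval])
      fix t z assume tz: "t \<in> {a..u}" "z \<in> {u..b}"
      have "((\<lambda>t. g (z, t)) has_vector_derivative gy (z, t)) (at t within {a..u})"
        by (rule has_vector_derivative_within_subset[OF d]) (use tz in \<open>auto simp: triangle_def\<close>)
      then show "((\<lambda>y. F z * g (z, y)) has_vector_derivative F z * gy (z, t)) (at t within {a..u})"
        by (rule has_vector_derivative_mult_right)
    next
      fix t assume "t \<in> {a..u}"
      with uy show "(\<lambda>z. F z * g (z, t)) integrable_on {u..b}"
        by (intro integrable_continuous_real ci) (auto simp: triangle_def)
    qed (use uy in \<open>auto simp: triangle_def split_beta intro!: ci\<close>)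
    have c: "continuous_on {y..b} (\<lambda>z. F z * g (z, y))"
      using uy by (auto simp: triangle_def intro!: ci)
    show "((\<lambda>t. ?J (t, y)) has_vector_derivative ?Ju (u, y)) (at u within {y..b})"
      unfolding split
      by (rule integral_has_vector_derivative'[OF c]) (use uy in \<open>auto simp: triangle_def\<close>)
  qed
  then show ?thesis by simp
qed

text \<open>Fubini's theorem on the triangle, by differentiating the right-hand side with respect to \<open>b\<close>: its
inner integral vanishes on the diagonal, so Leibniz' rule leaves exactly the inner integral of the
left-hand side.\<close>

lemma integral_triangle_swap:
  fixes k :: "real \<times> real \<Rightarrow> complex"
  assumes ck: "continuous_on (triangle a b) k" and ab: "a \<le> b"
  shows "integral {a..b} (\<lambda>z. integral {a..z} (\<lambda>w. k (z, w))) =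
    integral {a..b} (\<lambda>w. integral {w..b} (\<lambda>z. k (z, w)))"
proof -
  let ?q = "\<lambda>(x, w). integral {w..x} (\<lambda>z. k (z, w))"
  note ci = continuous_intros continuous_on_triangle_compose[OF ck]
  have "((\<lambda>x. integral {a..x} (\<lambda>w. ?q (x, w) * 1)) has_vector_derivative
      ?q (x, x) * 1 + integral {a..x} (\<lambda>w. k (x, w) * 1)) (at x within {a..b})" if "x \<in> {a..b}" for x
  proof (rule leibniz_upper_triangle[OF _ ck _ _ that])
    show "continuous_on (triangle a b) ?q" unfolding split_beta
      by (rule continuous_on_integral_moving_limits) (auto simp: triangle_def split_beta intro!: ci)
    fix x w assume xw: "(x, w) \<in> triangle a b"
    show "((\<lambda>t. ?q (t, w)) has_vector_derivative k (x, w)) (at x within {w..b})"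
      unfolding split
      by (rule integral_has_vector_derivative) (use xw in \<open>auto simp: triangle_def intro!: ci\<close>)
  qed simp
  then have "((\<lambda>x. integral {a..x} (\<lambda>w. k (x, w))) has_integral
      integral {a..b} (\<lambda>w. ?q (b, w)) - integral {a..a} (\<lambda>w. ?q (a, w))) {a..b}"
    by (intro fundamental_theorem_of_calculus[OF ab]) simp
  then show ?thesis by (simp add: integral_unique)
qed

section \<open>The algebra of kernels\<close>

text \<open>The kernel of the composition of the Volterra operators with kernels \<open>f\<close> and \<open>g\<close>.\<close>

definition star :: "(real \<times> real \<Rightarrow> complex) \<Rightarrow> (real \<times> real \<Rightarrow> complex) \<Rightarrow> real \<times> real \<Rightarrow> complex" where
  "star f g = (\<lambda>(x, y). integral {y..x} (\<lambda>z. f (x, z) * g (z, y)))"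

definition diag_x :: "(real \<times> real \<Rightarrow> complex) \<Rightarrow> real \<times> real \<Rightarrow> complex" where
  "diag_x f = (\<lambda>(x, y). f (x, x))"

definition diag_y :: "(real \<times> real \<Rightarrow> complex) \<Rightarrow> real \<times> real \<Rightarrow> complex" where
  "diag_y f = (\<lambda>(x, y). f (y, y))"

text \<open>The derivative clause of \<^const>\<open>Ck_triangle\<close> as a relation, so that derivatives can be named and
combined instead of being hidden under quantifiers.\<close>

definition partials :: "real \<Rightarrow> real \<Rightarrow> (real \<times> real \<Rightarrow> complex) \<Rightarrow> (real \<times> real \<Rightarrow> complex) \<Rightarrow>
    (real \<times> real \<Rightarrow> complex) \<Rightarrow> bool" where
  "partials a b f fx fy \<longleftrightarrow> (\<forall>x y. (x, y) \<in> triangle a b \<longrightarrow>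
     ((\<lambda>t. f (t, y)) has_vector_derivative fx (x, y)) (at x within {y..b}) \<and>
     ((\<lambda>t. f (x, t)) has_vector_derivative fy (x, y)) (at y within {a..x}))"

lemma Ck_Suc_iff:
  "Ck_triangle a b (Suc k) f \<longleftrightarrow> continuous_on (triangle a b) f \<and>
     (\<exists>fx fy. Ck_triangle a b k fx \<and> Ck_triangle a b k fy \<and> partials a b f fx fy)"
  by (simp add: partials_def)

lemma partialsI:
  assumes "\<And>x y. a \<le> y \<Longrightarrow> y \<le> x \<Longrightarrow> x \<le> b \<Longrightarrow> ((\<lambda>t. f (t, y)) has_vector_derivative fx (x, y)) (at x within {y..b})"
    and "\<And>x y. a \<le> y \<Longrightarrow> y \<le> x \<Longrightarrow> x \<le> b \<Longrightarrow> ((\<lambda>t. f (x, t)) has_vector_derivative fy (x, y)) (at y within {a..x})"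
  shows "partials a b f fx fy"
  using assms by (auto simp: partials_def triangle_def)

lemma partialsD:
  assumes "partials a b f fx fy" "a \<le> y" "y \<le> x" "x \<le> b"
  shows "((\<lambda>t. f (t, y)) has_vector_derivative fx (x, y)) (at x within {y..b})"
    and "((\<lambda>t. f (x, t)) has_vector_derivative fy (x, y)) (at y within {a..x})"
  using assms by (auto simp: partials_def triangle_def)

lemma Ck_imp_continuous: "Ck_triangle a b k f \<Longrightarrow> continuous_on (triangle a b) f"
  by (cases k) auto

lemma Ck_Suc_imp: "Ck_triangle a b (Suc k) f \<Longrightarrow> Ck_triangle a b k f"
proof (induction k arbitrary: f)
  case (Suc k)
  from Suc.prems obtain fx fy where "continuous_on (triangle a b) f"
    "Ck_triangle a b (Suc k) fx" "Ck_triangle a b (Suc k) fy" "partials a b f fx fy"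
    using Ck_Suc_iff[of a b "Suc k" f] by blast
  with Suc.IH show ?case using Ck_Suc_iff[of a b k f] by blast
qed simp

lemma Ck_SucI:
  "partials a b f fx fy \<Longrightarrow> continuous_on (triangle a b) f \<Longrightarrow> Ck_triangle a b k fx \<Longrightarrow>
    Ck_triangle a b k fy \<Longrightarrow> Ck_triangle a b (Suc k) f"
  by (auto simp: Ck_Suc_iff simp del: Ck_triangle.simps(2))

lemma Ck_SucE:
  assumes "Ck_triangle a b (Suc k) f"
  obtains fx fy where "Ck_triangle a b k fx" "Ck_triangle a b k fy" "partials a b f fx fy"
    "Ck_triangle a b k f" "continuous_on (triangle a b) f"
  using assms Ck_Suc_imp[OF assms] Ck_Suc_iff[of a b k f] by blast

lemma Ck_cong:
  assumes "Ck_triangle a b k f" "\<And>x y. a \<le> y \<Longrightarrow> y \<le> x \<Longrightarrow> x \<le> b \<Longrightarrow> f (x, y) = g (x, y)"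
  shows "Ck_triangle a b k g"
proof (cases k)
  case 0
  with assms(1) have "continuous_on (triangle a b) f" by simp
  then have "continuous_on (triangle a b) g"
    by (rule continuous_on_eq) (use assms(2) in \<open>auto simp: triangle_def\<close>)
  with 0 show ?thesis by simp
next
  case (Suc j)
  then obtain fx fy where f: "Ck_triangle a b j fx" "Ck_triangle a b j fy" "partials a b f fx fy"
    "continuous_on (triangle a b) f" using assms(1) Ck_SucE by blast
  have "partials a b g fx fy"
    by (intro partialsI has_vector_derivative_transform[OF _ _ partialsD(1)[OF f(3)]]
        has_vector_derivative_transform[OF _ _ partialsD(2)[OF f(3)]])
      (use assms(2) in auto)
  moreover have "continuous_on (triangle a b) g"
    using f(4) by (rule continuous_on_eq) (use assms(2) in \<open>auto simp: triangle_def\<close>)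
  ultimately show ?thesis using f Suc by (auto intro: Ck_SucI simp del: Ck_triangle.simps)
qed

lemma Ck_const: "Ck_triangle a b k (\<lambda>_. c)"
proof (induction k arbitrary: c)
  case (Suc k)
  show ?case
    by (rule Ck_SucI[where fx = "\<lambda>_. 0" and fy = "\<lambda>_. 0"])
      (auto intro!: partialsI continuous_intros Suc)
qed auto

lemma Ck_add:
  "Ck_triangle a b k f \<Longrightarrow> Ck_triangle a b k g \<Longrightarrow> Ck_triangle a b k (\<lambda>p. f p + g p)"
proof (induction k arbitrary: f g)
  case (Suc k)
  from Suc.prems(1) obtain fx fy where f: "Ck_triangle a b k fx" "Ck_triangle a b k fy"
    "partials a b f fx fy" "continuous_on (triangle a b) f" by (elim Ck_SucE)
  from Suc.prems(2) obtain gx gy where g: "Ck_triangle a b k gx" "Ck_triangle a b k gy"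
    "partials a b g gx gy" "continuous_on (triangle a b) g" by (elim Ck_SucE)
  show ?case
    by (rule Ck_SucI[where fx = "\<lambda>p. fx p + gx p" and fy = "\<lambda>p. fy p + gy p"])
      (auto intro!: partialsI continuous_intros Suc.IH has_vector_derivative_add
        partialsD[OF f(3)] partialsD[OF g(3)] f g)
qed (auto intro: continuous_intros)

lemma Ck_mult:
  "Ck_triangle a b k f \<Longrightarrow> Ck_triangle a b k g \<Longrightarrow> Ck_triangle a b k (\<lambda>p. f p * g p)"
proof (induction k arbitrary: f g)
  case (Suc k)
  from Suc.prems(1) obtain fx fy where f: "Ck_triangle a b k fx" "Ck_triangle a b k fy"
    "partials a b f fx fy" "Ck_triangle a b k f" "continuous_on (triangle a b) f" by (elim Ck_SucE)
  from Suc.prems(2) obtain gx gy where g: "Ck_triangle a b k gx" "Ck_triangle a b k gy"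
    "partials a b g gx gy" "Ck_triangle a b k g" "continuous_on (triangle a b) g" by (elim Ck_SucE)
  show ?case
    by (rule Ck_SucI[where fx = "\<lambda>p. f p * gx p + fx p * g p" and fy = "\<lambda>p. f p * gy p + fy p * g p"])
      (auto intro!: partialsI continuous_intros Suc.IH has_vector_derivative_mult
        partialsD[OF f(3)] partialsD[OF g(3)] f g Ck_add)
qed (auto intro: continuous_intros)

lemma continuous_on_diag:
  assumes "continuous_on (triangle a b) f"
  shows "continuous_on (triangle a b) (diag_x f)" "continuous_on (triangle a b) (diag_y f)"
  unfolding diag_x_def diag_y_def split_beta
  by (intro continuous_on_triangle_compose[OF assms] continuous_intros; auto simp: triangle_def)+

lemma Ck_diag_x: "Ck_triangle a b k f \<Longrightarrow> Ck_triangle a b k (diag_x f)"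
proof (induction k arbitrary: f)
  case 0
  then show ?case by (simp add: continuous_on_diag)
next
  case (Suc k)
  then obtain fx fy where f: "Ck_triangle a b k fx" "Ck_triangle a b k fy"
    "partials a b f fx fy" "continuous_on (triangle a b) f" by (elim Ck_SucE)
  note cont = Ck_imp_continuous[OF f(1)] Ck_imp_continuous[OF f(2)]
  have d: "((\<lambda>t. f (t, t)) has_vector_derivative fx (x, x) + fy (x, x)) (at x within {a..b})"
    if "x \<in> {a..b}" for x
    by (rule has_vector_derivative_diagonal[OF cont _ _ that])
      (auto simp: triangle_def intro: partialsD[OF f(3)])
  show ?case
  proof (rule Ck_SucI[where fx = "diag_x (\<lambda>p. fx p + fy p)" and fy = "\<lambda>_. 0"])
    show "partials a b (diag_x f) (diag_x (\<lambda>p. fx p + fy p)) (\<lambda>_. 0)"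
      by (rule partialsI) (auto simp: diag_x_def intro!: has_vector_derivative_within_subset[OF d])
    show "continuous_on (triangle a b) (diag_x f)" using f(4) by (rule continuous_on_diag)
  qed (intro Suc.IH Ck_add f Ck_const)+
qed

lemma Ck_diag_y: "Ck_triangle a b k f \<Longrightarrow> Ck_triangle a b k (diag_y f)"
proof (induction k arbitrary: f)
  case 0
  then show ?case by (simp add: continuous_on_diag)
next
  case (Suc k)
  then obtain fx fy where f: "Ck_triangle a b k fx" "Ck_triangle a b k fy"
    "partials a b f fx fy" "continuous_on (triangle a b) f" by (elim Ck_SucE)
  note cont = Ck_imp_continuous[OF f(1)] Ck_imp_continuous[OF f(2)]
  have d: "((\<lambda>t. f (t, t)) has_vector_derivative fx (x, x) + fy (x, x)) (at x within {a..b})"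
    if "x \<in> {a..b}" for x
    by (rule has_vector_derivative_diagonal[OF cont _ _ that])
      (auto simp: triangle_def intro: partialsD[OF f(3)])
  show ?case
  proof (rule Ck_SucI[where fy = "diag_y (\<lambda>p. fx p + fy p)" and fx = "\<lambda>_. 0"])
    show "partials a b (diag_y f) (\<lambda>_. 0) (diag_y (\<lambda>p. fx p + fy p))"
      by (rule partialsI) (auto simp: diag_y_def intro!: has_vector_derivative_within_subset[OF d])
    show "continuous_on (triangle a b) (diag_y f)" using f(4) by (rule continuous_on_diag)
  qed (intro Suc.IH Ck_add f Ck_const)+
qed

lemma continuous_on_star:
  assumes f: "continuous_on (triangle a b) f" and g: "continuous_on (triangle a b) g"
  shows "continuous_on (triangle a b) (star f g)"
  unfolding star_def split_beta
  by (rule continuous_on_integral_moving_limits)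
    (auto simp: triangle_def[of a b] split_beta
      intro!: continuous_intros continuous_on_triangle_compose[OF f] continuous_on_triangle_compose[OF g])

text \<open>The partial derivatives of a product kernel consist of the kernels themselves, their partial
derivatives, restrictions to the diagonal and products. Hence each class \<open>C^k\<close> is closed under
\<^const>\<open>star\<close>, by induction on \<open>k\<close>.\<close>

lemma partials_star:
  assumes f: "continuous_on (triangle a b) f" and g: "continuous_on (triangle a b) g"
    and pf: "partials a b f fx fy" and pg: "partials a b g gx gy"
    and fx: "continuous_on (triangle a b) fx" and gy: "continuous_on (triangle a b) gy"
  shows "partials a b (star f g) (\<lambda>p. diag_x f p * g p + star fx g p)
    (\<lambda>p. - (f p * diag_y g p) + star f gy p)"
proof (rule partialsI)
  fix x y assume xy: "a \<le> y" "y \<le> x" "x \<le> b"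
  have sub: "triangle y b \<subseteq> triangle a b" "triangle a x \<subseteq> triangle a b"
    using xy by (auto simp: triangle_def)
  have "continuous_on {y..b} (\<lambda>z. g (z, y))" "continuous_on {a..x} (\<lambda>z. f (x, z))"
    using xy by (auto intro!: continuous_on_triangle_compose[OF g] continuous_on_triangle_compose[OF f] continuous_intros)
  note c = this
  have "((\<lambda>x. integral {y..x} (\<lambda>z. f (x, z) * g (z, y))) has_vector_derivative
      f (x, x) * g (x, y) + integral {y..x} (\<lambda>z. fx (x, z) * g (z, y))) (at x within {y..b})"
    by (rule leibniz_upper_triangle[OF continuous_on_subset[OF f sub(1)] continuous_on_subset[OF fx sub(1)] c(1)])
      (use xy in \<open>auto simp: triangle_def intro!: partialsD[OF pf]\<close>)
  then show "((\<lambda>t. star f g (t, y)) has_vector_derivative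
      diag_x f (x, y) * g (x, y) + star fx g (x, y)) (at x within {y..b})"
    by (simp add: star_def diag_x_def)
  have "((\<lambda>y. integral {y..x} (\<lambda>z. f (x, z) * g (z, y))) has_vector_derivative
      - (f (x, y) * g (y, y)) + integral {y..x} (\<lambda>z. f (x, z) * gy (z, y))) (at y within {a..x})"
    by (rule leibniz_lower_triangle[OF continuous_on_subset[OF g sub(2)] continuous_on_subset[OF gy sub(2)] c(2)])
      (use xy in \<open>auto simp: triangle_def intro!: partialsD[OF pg]\<close>)
  then show "((\<lambda>t. star f g (x, t)) has_vector_derivative
      - (f (x, y) * diag_y g (x, y)) + star f gy (x, y)) (at y within {a..x})"
    by (simp add: star_def diag_y_def)
qed

lemma Ck_minus: "Ck_triangle a b k f \<Longrightarrow> Ck_triangle a b k (\<lambda>p. - f p)"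
  using Ck_mult[OF Ck_const[of a b k "-1"]] by simp

lemma Ck_star:
  "Ck_triangle a b k f \<Longrightarrow> Ck_triangle a b k g \<Longrightarrow> Ck_triangle a b k (star f g)"
proof (induction k arbitrary: f g)
  case 0
  then show ?case by (simp add: continuous_on_star)
next
  case (Suc k)
  from Suc.prems(1) obtain fx fy where f: "Ck_triangle a b k fx" "Ck_triangle a b k fy"
    "partials a b f fx fy" "Ck_triangle a b k f" "continuous_on (triangle a b) f" by (elim Ck_SucE)
  from Suc.prems(2) obtain gx gy where g: "Ck_triangle a b k gx" "Ck_triangle a b k gy"
    "partials a b g gx gy" "Ck_triangle a b k g" "continuous_on (triangle a b) g" by (elim Ck_SucE)
  show ?case
    by (rule Ck_SucI[OF partials_star[OF f(5) g(5) f(3) g(3)]])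
      (intro Ck_imp_continuous[OF f(1)] Ck_imp_continuous[OF g(2)] continuous_on_star Ck_add Ck_mult
        Ck_minus Suc.IH Ck_diag_x Ck_diag_y f g)+
qed

text \<open>Associativity is Fubini's theorem on the triangle \<open>y \<le> z \<le> w \<le> x\<close>.\<close>

lemma star_assoc:
  assumes f: "continuous_on (triangle a b) f" and g: "continuous_on (triangle a b) g"
    and h: "continuous_on (triangle a b) h" and xy: "a \<le> y" "y \<le> x" "x \<le> b"
  shows "star (star f g) h (x, y) = star f (star g h) (x, y)"
proof -
  note ci = continuous_intros continuous_on_triangle_compose[OF f] continuous_on_triangle_compose[OF g]
    continuous_on_triangle_compose[OF h]
  let ?k = "\<lambda>(w, z). f (x, w) * g (w, z) * h (z, y)"
  have c: "continuous_on (triangle y x) ?k"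
    unfolding split_beta by (intro ci) (use xy in \<open>auto simp: triangle_def\<close>)
  have "star (star f g) h (x, y) = integral {y..x} (\<lambda>z. integral {z..x} (\<lambda>w. ?k (w, z)))"
    by (simp add: star_def mult.assoc flip: integral_mult_left)
  also have "\<dots> = integral {y..x} (\<lambda>w. integral {y..w} (\<lambda>z. ?k (w, z)))"
    by (rule integral_triangle_swap[OF c xy(2), symmetric])
  also have "\<dots> = star f (star g h) (x, y)"
    by (simp add: star_def mult.assoc flip: integral_mult_right)
  finally show ?thesis .
qed

text \<open>Smoothness provides, for each \<open>k\<close>, some partial derivatives of class \<open>C^k\<close>. They do not depend on
\<open>k\<close>: away from the corners the slices are nondegenerate and determine the derivatives, and at
\<open>(b, b)\<close> and \<open>(a, a)\<close>, where one slice is a single point, continuity does.\<close>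

lemma B2_partials:
  assumes ab: "a < b" and f: "f \<in> B2 a b"
  obtains fx fy where "fx \<in> B2 a b" "fy \<in> B2 a b" "partials a b f fx fy"
proof -
  have ex: "\<exists>fx fy. Ck_triangle a b k fx \<and> Ck_triangle a b k fy \<and> partials a b f fx fy" for k
  proof -
    have "Ck_triangle a b (Suc k) f" using f by (simp add: B2_def del: Ck_triangle.simps)
    then show ?thesis by (simp only: Ck_Suc_iff)
  qed
  then obtain fx fy where c: "continuous_on (triangle a b) fx" "continuous_on (triangle a b) fy"
    and p: "partials a b f fx fy" using Ck_triangle.simps(1) by blast
  have uniq: "gx (x, y) = fx (x, y) \<and> gy (x, y) = fy (x, y)"
    if g: "continuous_on (triangle a b) gx" "continuous_on (triangle a b) gy" "partials a b f gx gy"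
      and xy: "a \<le> y" "y \<le> x" "x \<le> b" for gx gy x y
  proof
    have X: "gx (x, y) = fx (x, y)" if "a \<le> y" "y \<le> x" "x \<le> b" "y < b" for x y
      using vector_derivative_unique_within_closed_interval[of y b x "\<lambda>t. f (t, y)"]
        partialsD(1)[OF p that(1-3)] partialsD(1)[OF g(3) that(1-3)] that by auto
    have Y: "gy (x, y) = fy (x, y)" if "a \<le> y" "y \<le> x" "x \<le> b" "a < x" for x y
      using vector_derivative_unique_within_closed_interval[of a x y "\<lambda>t. f (x, t)"]
        partialsD(2)[OF p that(1-3)] partialsD(2)[OF g(3) that(1-3)] that by auto
    show "gx (x, y) = fx (x, y)"
    proof (cases "y < b")
      case False
      have "continuous_on (closure {a..<b}) (\<lambda>t. gx (b, t) - fx (b, t))"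
        using ab by (intro continuous_intros continuous_on_triangle_compose[OF g(1)]
            continuous_on_triangle_compose[OF c(1)]) auto
      from continuous_constant_on_closure[OF this, of 0 b] X ab
      have "gx (b, b) = fx (b, b)" by auto
      moreover have "x = b" "y = b" using False xy by auto
      ultimately show ?thesis by simp
    qed (use X xy in auto)
    show "gy (x, y) = fy (x, y)"
    proof (cases "a < x")
      case False
      have "continuous_on (closure {a<..b}) (\<lambda>t. gy (t, a) - fy (t, a))"
        using ab by (intro continuous_intros continuous_on_triangle_compose[OF g(2)]
            continuous_on_triangle_compose[OF c(2)]) auto
      from continuous_constant_on_closure[OF this, of 0 a] Y ab
      have "gy (a, a) = fy (a, a)" by auto
      moreover have "x = a" "y = a" using False xy by auto
      ultimately show ?thesis by simp
    qed (use Y xy in auto)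
  qed
  have "Ck_triangle a b k fx \<and> Ck_triangle a b k fy" for k
  proof -
    obtain gx gy where g: "Ck_triangle a b k gx" "Ck_triangle a b k gy" "partials a b f gx gy"
      using ex by blast
    note u = uniq[OF Ck_imp_continuous[OF g(1)] Ck_imp_continuous[OF g(2)] g(3)]
    show ?thesis using Ck_cong[OF g(1), of fx] Ck_cong[OF g(2), of fy] u by blast
  qed
  then have "fx \<in> B2 a b" "fy \<in> B2 a b" by (auto simp: B2_def)
  then show ?thesis using p by (rule that)
qed

lemma continuous_on_B2: "f \<in> B2 a b \<Longrightarrow> continuous_on (triangle a b) f"
  by (auto simp: B2_def intro: Ck_imp_continuous)

lemma B2_const: "(\<lambda>_. c) \<in> B2 a b"
  by (simp add: B2_def Ck_const)

lemma B2_add: "f \<in> B2 a b \<Longrightarrow> g \<in> B2 a b \<Longrightarrow> (\<lambda>p. f p + g p) \<in> B2 a b"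
  by (simp add: B2_def Ck_add)

lemma B2_mult: "f \<in> B2 a b \<Longrightarrow> g \<in> B2 a b \<Longrightarrow> (\<lambda>p. f p * g p) \<in> B2 a b"
  by (simp add: B2_def Ck_mult)

lemma B2_minus: "f \<in> B2 a b \<Longrightarrow> (\<lambda>p. - f p) \<in> B2 a b"
  by (simp add: B2_def Ck_minus)

lemma B2_star: "f \<in> B2 a b \<Longrightarrow> g \<in> B2 a b \<Longrightarrow> star f g \<in> B2 a b"
  by (simp add: B2_def Ck_star)

section \<open>Resolvent kernels\<close>

primrec star_power :: "(real \<times> real \<Rightarrow> complex) \<Rightarrow> nat \<Rightarrow> real \<times> real \<Rightarrow> complex" where
  "star_power g 0 = g"
| "star_power g (Suc n) = star g (star_power g n)"

lemma continuous_on_star_power: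
  "continuous_on (triangle a b) g \<Longrightarrow> continuous_on (triangle a b) (star_power g n)"
  by (induction n) (auto intro: continuous_on_star)

lemma star_cong:
  assumes "\<And>z. y \<le> z \<Longrightarrow> z \<le> x \<Longrightarrow> f (x, z) = f' (x, z)" "\<And>z. y \<le> z \<Longrightarrow> z \<le> x \<Longrightarrow> g (z, y) = g' (z, y)"
  shows "star f g (x, y) = star f' g' (x, y)"
  unfolding star_def split by (rule integral_cong) (use assms in auto)

lemma star_power_commute:
  assumes g: "continuous_on (triangle a b) g"
  shows "a \<le> y \<Longrightarrow> y \<le> x \<Longrightarrow> x \<le> b \<Longrightarrow> star (star_power g n) g (x, y) = star g (star_power g n) (x, y)"
proof (induction n arbitrary: x y)
  case (Suc n)
  have "star (star_power g (Suc n)) g (x, y) = star g (star (star_power g n) g) (x, y)"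
    using star_assoc[OF g continuous_on_star_power[OF g] g Suc.prems] by simp
  also have "\<dots> = star g (star_power g (Suc n)) (x, y)"
    by (rule star_cong) (use Suc in auto)
  finally show ?case .
qed simp

text \<open>The classical Volterra estimate: the factorial makes the Neumann series converge for every kernel,
however large.\<close>

lemma norm_star_power_le:
  assumes g: "continuous_on (triangle a b) g"
    and C: "\<And>x y. a \<le> y \<Longrightarrow> y \<le> x \<Longrightarrow> x \<le> b \<Longrightarrow> norm (g (x, y)) \<le> C"
  shows "a \<le> y \<Longrightarrow> y \<le> x \<Longrightarrow> x \<le> b \<Longrightarrow> norm (star_power g n (x, y)) \<le> C ^ Suc n * (x - y) ^ n / fact n"
proof (induction n arbitrary: x y)
  case 0
  then show ?case using C by simp
next
  case (Suc n)
  have C0: "0 \<le> C" using order_trans[OF norm_ge_zero C[OF Suc.prems]] .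
  have "((\<lambda>z. C ^ Suc (Suc n) * (z - y) ^ n / fact n) has_integral
      C ^ Suc (Suc n) * (x - y) ^ Suc n / fact (Suc n) - C ^ Suc (Suc n) * (y - y) ^ Suc n / fact (Suc n)) {y..x}"
  proof (rule fundamental_theorem_of_calculus[OF Suc.prems(2)])
    fix z
    have "((\<lambda>z. C ^ Suc (Suc n) * (z - y) ^ Suc n / fact (Suc n)) has_real_derivative
      C ^ Suc (Suc n) * (real (Suc n) * (z - y) ^ n) / fact (Suc n)) (at z within {y..x})"
      by (auto intro!: derivative_eq_intros simp del: power_Suc)
    moreover have "C ^ Suc (Suc n) * (real (Suc n) * (z - y) ^ n) / fact (Suc n) = C ^ Suc (Suc n) * (z - y) ^ n / fact n"
      by (simp add: divide_simps del: of_nat_Suc power_Suc)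
    ultimately show "((\<lambda>z. C ^ Suc (Suc n) * (z - y) ^ Suc n / fact (Suc n)) has_vector_derivative
        C ^ Suc (Suc n) * (z - y) ^ n / fact n) (at z within {y..x})"
      by (simp only: has_real_derivative_iff_has_vector_derivative)
  qed
  then have I: "((\<lambda>z. C ^ Suc (Suc n) * (z - y) ^ n / fact n) has_integral
      C ^ Suc (Suc n) * (x - y) ^ Suc n / fact (Suc n)) {y..x}" by simp
  have "norm (integral {y..x} (\<lambda>z. g (x, z) * star_power g n (z, y)))
      \<le> integral {y..x} (\<lambda>z. C ^ Suc (Suc n) * (z - y) ^ n / fact n)"
  proof (rule integral_norm_bound_integral)
    show "(\<lambda>z. g (x, z) * star_power g n (z, y)) integrable_on {y..x}"
      by (intro integrable_continuous_real continuous_intros continuous_on_triangle_compose[OF g]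
          continuous_on_triangle_compose[OF continuous_on_star_power[OF g]]) (use Suc.prems in auto)
    show "(\<lambda>z. C ^ Suc (Suc n) * (z - y) ^ n / fact n) integrable_on {y..x}" using I by blast
    fix z assume z: "z \<in> {y..x}"
    have "norm (g (x, z) * star_power g n (z, y)) \<le> C * (C ^ Suc n * (z - y) ^ n / fact n)"
      unfolding norm_mult
      by (rule mult_mono[OF C Suc.IH]) (use z Suc.prems C0 in auto)
    then show "norm (g (x, z) * star_power g n (z, y)) \<le> C ^ Suc (Suc n) * (z - y) ^ n / fact n"
      by (simp add: mult.assoc)
  qed
  then show ?case using integral_unique[OF I] by (simp add: star_def)
qed

lemma star_sums:
  assumes g: "continuous_on (triangle a b) g" and h: "\<And>n. continuous_on (triangle a b) (h n)"
    and M: "\<And>n x y. a \<le> y \<Longrightarrow> y \<le> x \<Longrightarrow> x \<le> b \<Longrightarrow> norm (h n (x, y)) \<le> M n" and sM: "summable M"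
    and xy: "a \<le> y" "y \<le> x" "x \<le> b"
  shows "(\<lambda>n. star g (h n) (x, y)) sums star g (\<lambda>p. \<Sum>n. h n p) (x, y)"
    and "(\<lambda>n. star (h n) g (x, y)) sums star (\<lambda>p. \<Sum>n. h n p) g (x, y)"
proof -
  have "bounded ((g \<circ> (\<lambda>z. (x, z))) ` {y..x})" "bounded ((g \<circ> (\<lambda>z. (z, y))) ` {y..x})"
    unfolding comp_def
    by (intro compact_imp_bounded compact_continuous_image continuous_on_triangle_compose[OF g] continuous_intros;
        use xy in auto)+
  then have "\<exists>C1. \<forall>z\<in>{y..x}. norm (g (x, z)) \<le> C1" "\<exists>C2. \<forall>z\<in>{y..x}. norm (g (z, y)) \<le> C2"
    by (auto simp: bounded_iff)
  then obtain C1 C2 where C: "\<And>z. z \<in> {y..x} \<Longrightarrow> norm (g (x, z)) \<le> C1" "\<And>z. z \<in> {y..x} \<Longrightarrow> norm (g (z, y)) \<le> C2"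
    by blast
  have s: "summable (\<lambda>n. h n (z, w))" if "a \<le> w" "w \<le> z" "z \<le> b" for z w
    by (rule summable_comparison_test'[OF sM]) (use M that in auto)
  have M0: "0 \<le> M n" for n using order_trans[OF norm_ge_zero M[OF xy]] .
  note ci = continuous_intros continuous_on_triangle_compose[OF g] continuous_on_triangle_compose[OF h]
  have ul: "uniform_limit {y..x} (\<lambda>n z. \<Sum>i<n. g (x, z) * h i (z, y)) (\<lambda>z. \<Sum>i. g (x, z) * h i (z, y)) sequentially"
  proof (rule Weierstrass_m_test)
    show "summable (\<lambda>n. C1 * M n)" by (intro summable_mult sM)
    show "norm (g (x, z) * h n (z, y)) \<le> C1 * M n" if "z \<in> {y..x}" for n z
      unfolding norm_mult by (rule mult_mono[OF C(1) M]) (use that xy M0 order_trans[OF norm_ge_zero C(1)[OF that]] in auto)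
  qed
  have cont: "continuous_on {y..x} (\<lambda>z. \<Sum>i<n. g (x, z) * h i (z, y))" for n
    by (intro ci) (use xy in auto)
  obtain I J where IJ: "\<And>n. ((\<lambda>z. \<Sum>i<n. g (x, z) * h i (z, y)) has_integral I n) {y..x}"
    "((\<lambda>z. \<Sum>i. g (x, z) * h i (z, y)) has_integral J) {y..x}" "I \<longlonglongrightarrow> J"
    using uniform_limit_integral[OF ul cont] by auto
  have "I = (\<lambda>n. \<Sum>i<n. star g (h i) (x, y))"
    unfolding star_def split integral_unique[OF IJ(1), symmetric]
    by (rule ext, rule integral_sum) (use xy in \<open>auto intro!: integrable_continuous_real ci\<close>)
  moreover have "J = star g (\<lambda>p. \<Sum>n. h n p) (x, y)"
    unfolding star_def split integral_unique[OF IJ(2), symmetric]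
    by (rule integral_cong) (use xy s in \<open>auto simp: suminf_mult\<close>)
  ultimately show "(\<lambda>n. star g (h n) (x, y)) sums star g (\<lambda>p. \<Sum>n. h n p) (x, y)"
    using IJ(3) by (simp add: sums_def)
  have ul: "uniform_limit {y..x} (\<lambda>n z. \<Sum>i<n. h i (x, z) * g (z, y)) (\<lambda>z. \<Sum>i. h i (x, z) * g (z, y)) sequentially"
  proof (rule Weierstrass_m_test)
    show "summable (\<lambda>n. M n * C2)" by (intro summable_mult2 sM)
    show "norm (h n (x, z) * g (z, y)) \<le> M n * C2" if "z \<in> {y..x}" for n z
      unfolding norm_mult by (rule mult_mono[OF M C(2)]) (use that xy M0 in auto)
  qed
  have cont: "continuous_on {y..x} (\<lambda>z. \<Sum>i<n. h i (x, z) * g (z, y))" for n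
    by (intro ci) (use xy in auto)
  obtain I J where IJ: "\<And>n. ((\<lambda>z. \<Sum>i<n. h i (x, z) * g (z, y)) has_integral I n) {y..x}"
    "((\<lambda>z. \<Sum>i. h i (x, z) * g (z, y)) has_integral J) {y..x}" "I \<longlonglongrightarrow> J"
    using uniform_limit_integral[OF ul cont] by auto
  have "I = (\<lambda>n. \<Sum>i<n. star (h i) g (x, y))"
    unfolding star_def split integral_unique[OF IJ(1), symmetric]
    by (rule ext, rule integral_sum) (use xy in \<open>auto intro!: integrable_continuous_real ci\<close>)
  moreover have "J = star (\<lambda>p. \<Sum>n. h n p) g (x, y)"
    unfolding star_def split integral_unique[OF IJ(2), symmetric]
    by (rule integral_cong) (use xy s in \<open>auto simp: suminf_mult2\<close>)
  ultimately show "(\<lambda>n. star (h n) g (x, y)) sums star (\<lambda>p. \<Sum>n. h n p) g (x, y)"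
    using IJ(3) by (simp add: sums_def)
qed

lemma compact_triangle: "compact (triangle a b)"
proof -
  have "triangle a b = ({a..b} \<times> {a..b}) \<inter> {p. snd p \<le> fst p}"
    by (auto simp: triangle_def)
  moreover have "closed {p :: real \<times> real. snd p \<le> fst p}"
    by (intro closed_Collect_le continuous_intros)
  ultimately show ?thesis by (simp add: compact_Int_closed compact_Times)
qed

text \<open>The resolvent is the Neumann series \<open>g + g * g + g * g * g + \<dots>\<close>. Since the powers commute with
\<open>g\<close>, the same function solves the equations with \<open>g\<close> on the left and on the right.\<close>

lemma continuous_resolvent:
  assumes g: "continuous_on (triangle a b) g" and ab: "a \<le> b"
  obtains r where "continuous_on (triangle a b) r"
    "\<And>x y. a \<le> y \<Longrightarrow> y \<le> x \<Longrightarrow> x \<le> b \<Longrightarrow> r (x, y) = g (x, y) + star g r (x, y)"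
    "\<And>x y. a \<le> y \<Longrightarrow> y \<le> x \<Longrightarrow> x \<le> b \<Longrightarrow> r (x, y) = g (x, y) + star r g (x, y)"
proof -
  have "bounded (g ` triangle a b)"
    by (intro compact_imp_bounded compact_continuous_image g compact_triangle)
  then obtain C where C: "\<And>x y. a \<le> y \<Longrightarrow> y \<le> x \<Longrightarrow> x \<le> b \<Longrightarrow> norm (g (x, y)) \<le> C"
    by (auto simp: bounded_iff triangle_def)
  have C0: "0 \<le> C" using order_trans[OF norm_ge_zero C[of a a]] ab by simp
  define M where "M n = C * ((C * (b - a)) ^ n / fact n)" for n
  have sM: "summable M"
    unfolding M_def using summable_exp[of "C * (b - a)"] by (intro summable_mult) (simp add: divide_inverse mult.commute)
  have M: "norm (star_power g n (x, y)) \<le> M n" if "a \<le> y" "y \<le> x" "x \<le> b" for n x y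
  proof -
    have "norm (star_power g n (x, y)) \<le> C ^ Suc n * (x - y) ^ n / fact n"
      using norm_star_power_le[OF g C that] .
    also have "\<dots> \<le> C ^ Suc n * (b - a) ^ n / fact n"
      using that C0 by (intro divide_right_mono mult_left_mono power_mono) auto
    finally show ?thesis by (simp add: M_def power_mult_distrib mult.assoc)
  qed
  define r where "r p = (\<Sum>n. star_power g n p)" for p
  have r: "r = (\<lambda>p. \<Sum>n. star_power g n p)" by (rule ext) (simp add: r_def)
  have ss: "(\<lambda>n. star g (star_power g n) (x, y)) sums star g r (x, y)"
      "(\<lambda>n. star (star_power g n) g (x, y)) sums star r g (x, y)"
    if "a \<le> y" "y \<le> x" "x \<le> b" for x y
    unfolding r by (rule star_sums[OF g _ _ sM]; use continuous_on_star_power[OF g] M that in blast)+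
  show thesis
  proof
    have "uniform_limit (triangle a b) (\<lambda>n p. \<Sum>i<n. star_power g i p) r sequentially"
      unfolding r by (rule Weierstrass_m_test[OF _ sM]) (auto simp: triangle_def M)
    then show "continuous_on (triangle a b) r"
      by (rule uniform_limit_theorem[rotated])
        (auto intro!: always_eventually continuous_intros continuous_on_star_power g)
    show *: "r (x, y) = g (x, y) + star g r (x, y)" if xy: "a \<le> y" "y \<le> x" "x \<le> b" for x y
    proof -
      have "(\<lambda>n. star_power g (Suc n) (x, y)) sums star g r (x, y)" using ss(1)[OF xy] by simp
      then have "(\<lambda>n. star_power g n (x, y)) sums (star g r (x, y) + star_power g 0 (x, y))"
        by (rule sums_Suc)
      then show ?thesis by (simp add: r_def sums_iff add.commute)
    qed
    show "r (x, y) = g (x, y) + star r g (x, y)" if xy: "a \<le> y" "y \<le> x" "x \<le> b" for x y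
    proof -
      have "star r g (x, y) = star g r (x, y)"
        using ss(2)[OF xy] ss(1)[OF xy] by (simp add: star_power_commute[OF g xy] sums_iff)
      then show ?thesis using *[OF xy] by simp
    qed
  qed
qed

text \<open>Smoothness by bootstrapping: differentiating \<open>r = g + star g r\<close> in \<open>x\<close> and \<open>r = g + star r g\<close> in
\<open>y\<close> puts the derivatives only on \<open>g\<close>, so the partial derivatives of \<open>r\<close> are as smooth as \<open>r\<close>.
Each of the two equations is used for one of the variables.\<close>

lemma smooth_resolvent:
  assumes g: "g \<in> B2 a b" and ab: "a \<le> b"
  obtains r where "r \<in> B2 a b"
    "\<And>x y. a \<le> y \<Longrightarrow> y \<le> x \<Longrightarrow> x \<le> b \<Longrightarrow> r (x, y) = g (x, y) + star g r (x, y)"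
    "\<And>x y. a \<le> y \<Longrightarrow> y \<le> x \<Longrightarrow> x \<le> b \<Longrightarrow> r (x, y) = g (x, y) + star r g (x, y)"
proof -
  have cg: "continuous_on (triangle a b) g" using g by (rule continuous_on_B2)
  obtain r where cr: "continuous_on (triangle a b) r"
    and r1: "\<And>x y. a \<le> y \<Longrightarrow> y \<le> x \<Longrightarrow> x \<le> b \<Longrightarrow> r (x, y) = g (x, y) + star g r (x, y)"
    and r2: "\<And>x y. a \<le> y \<Longrightarrow> y \<le> x \<Longrightarrow> x \<le> b \<Longrightarrow> r (x, y) = g (x, y) + star r g (x, y)"
    by (rule continuous_resolvent[OF cg ab]) blast
  have "Ck_triangle a b k r" for k
  proof (induction k)
    case (Suc k)
    from g have "Ck_triangle a b (Suc k) g" unfolding B2_def by blast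
    then obtain gx gy where G: "Ck_triangle a b k gx" "Ck_triangle a b k gy" "partials a b g gx gy"
      "Ck_triangle a b k g" by (elim Ck_SucE)
    note cgx = Ck_imp_continuous[OF G(1)] and cgy = Ck_imp_continuous[OF G(2)]
    have px: "((\<lambda>t. star g r (t, y)) has_vector_derivative diag_x g (x, y) * r (x, y) + star gx r (x, y))
        (at x within {y..b})" if xy: "a \<le> y" "y \<le> x" "x \<le> b" for x y
    proof -
      have "((\<lambda>x. integral {y..x} (\<lambda>z. g (x, z) * r (z, y))) has_vector_derivative
          g (x, x) * r (x, y) + integral {y..x} (\<lambda>z. gx (x, z) * r (z, y))) (at x within {y..b})"
        by (rule leibniz_upper_triangle[OF continuous_on_subset[OF cg] continuous_on_subset[OF cgx]])
          (use xy in \<open>auto simp: triangle_def intro!: partialsD[OF G(3)] continuous_on_triangle_compose[OF cr] continuous_intros\<close>)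
      then show ?thesis by (simp add: star_def diag_x_def)
    qed
    have py: "((\<lambda>t. star r g (x, t)) has_vector_derivative - (r (x, y) * diag_y g (x, y)) + star r gy (x, y))
        (at y within {a..x})" if xy: "a \<le> y" "y \<le> x" "x \<le> b" for x y
    proof -
      have "((\<lambda>y. integral {y..x} (\<lambda>z. r (x, z) * g (z, y))) has_vector_derivative
          - (r (x, y) * g (y, y)) + integral {y..x} (\<lambda>z. r (x, z) * gy (z, y))) (at y within {a..x})"
        by (rule leibniz_lower_triangle[OF continuous_on_subset[OF cg] continuous_on_subset[OF cgy]])
          (use xy in \<open>auto simp: triangle_def intro!: partialsD[OF G(3)] continuous_on_triangle_compose[OF cr] continuous_intros\<close>)
      then show ?thesis by (simp add: star_def diag_y_def)
    qed
    have "partials a b r (\<lambda>p. gx p + (diag_x g p * r p + star gx r p))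
      (\<lambda>p. gy p + (- (r p * diag_y g p) + star r gy p))"
    proof (rule partialsI)
      fix x y assume xy: "a \<le> y" "y \<le> x" "x \<le> b"
      show "((\<lambda>t. r (t, y)) has_vector_derivative gx (x, y) + (diag_x g (x, y) * r (x, y) + star gx r (x, y))) (at x within {y..b})"
        by (rule has_vector_derivative_transform[OF _ _ has_vector_derivative_add[OF partialsD(1)[OF G(3) xy] px[OF xy]]])
          (use xy in \<open>auto intro: r1\<close>)
      show "((\<lambda>t. r (x, t)) has_vector_derivative gy (x, y) + (- (r (x, y) * diag_y g (x, y)) + star r gy (x, y))) (at y within {a..x})"
        by (rule has_vector_derivative_transform[OF _ _ has_vector_derivative_add[OF partialsD(2)[OF G(3) xy] py[OF xy]]])
          (use xy in \<open>auto intro: r2\<close>)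
    qed
    then show ?case using cr
      by (rule Ck_SucI) (intro Ck_add Ck_mult Ck_minus Ck_star Ck_diag_x Ck_diag_y G Suc.IH)+
  qed (use cr in simp)
  then have "r \<in> B2 a b" by (simp add: B2_def)
  then show thesis using r1 r2 by (rule that)
qed

section \<open>Smooth functions on the interval\<close>

locale nondegenerate_interval =
  fixes a b :: real
  assumes ab: "a < b"
begin

abbreviation D :: "(real \<Rightarrow> complex) \<Rightarrow> real \<Rightarrow> complex" where "D \<equiv> der a b"
abbreviation M :: "(real \<Rightarrow> complex) set" where "M \<equiv> Msp a b"

lemma D_outside: "x \<notin> {a..b} \<Longrightarrow> D P x = 0"
  by (simp only: der_def if_False)

lemma D_eqI: "x \<in> {a..b} \<Longrightarrow> (P has_vector_derivative P') (at x within {a..b}) \<Longrightarrow> D P x = P'"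
  by (simp add: der_def vector_derivative_within_closed_interval[OF ab])

lemma D_eqI_fun:
  assumes "\<And>x. x \<in> {a..b} \<Longrightarrow> (P has_vector_derivative P' x) (at x within {a..b})"
    and "\<And>x. x \<notin> {a..b} \<Longrightarrow> P' x = 0"
  shows "D P = P'"
proof
  show "D P x = P' x" for x
    using assms by (cases "x \<in> {a..b}") (simp_all add: D_eqI D_outside del: atLeastAtMost_iff)
qed

lemma D_cong: "(\<And>x. x \<in> {a..b} \<Longrightarrow> P x = Q x) \<Longrightarrow> D P = D Q"
  unfolding der_def by (rule ext) (auto intro!: vector_derivative_cong_eq always_eventually)

lemma Dn_cong:
  assumes "\<And>x. x \<in> {a..b} \<Longrightarrow> P x = Q x" "x \<in> {a..b}"
  shows "(D ^^ n) P x = (D ^^ n) Q x"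
proof (cases n)
  case (Suc m)
  have "D P = D Q" using assms(1) by (rule D_cong)
  then show ?thesis by (simp add: Suc funpow_Suc_right del: funpow.simps)
qed (use assms in simp)

lemma B1_has_derivative:
  assumes "P \<in> B1 a b" "x \<in> {a..b}"
  shows "(P has_vector_derivative D P x) (at x within {a..b})"
proof -
  have "(D ^^ 0) P differentiable_on {a..b}" using assms(1) unfolding B1_def by blast
  then show ?thesis using assms(2) by (simp add: der_def vector_derivative_works differentiable_on_def)
qed

lemma B1_D: "P \<in> B1 a b \<Longrightarrow> D P \<in> B1 a b"
  unfolding B1_def by (auto simp: funpow_Suc_right simp del: funpow.simps(2) dest: spec[where x = "Suc _"])

lemma B1_Dn: "P \<in> B1 a b \<Longrightarrow> (D ^^ n) P \<in> B1 a b"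
  by (induction n) (auto intro: B1_D)

text \<open>Smoothness is coinductive: a class of functions in which every member has a derivative in the class
consists of smooth functions.\<close>

lemma B1_coinduct:
  assumes "X P"
    and step: "\<And>P. X P \<Longrightarrow> \<exists>P'. X P' \<and> (\<forall>x\<in>{a..b}. (P has_vector_derivative P' x) (at x within {a..b}))"
  shows "P \<in> B1 a b"
proof -
  have "(D ^^ n) P differentiable_on {a..b}" if "X P" for n P
    using that
  proof (induction n arbitrary: P)
    case 0
    then show ?case using step[of P] by (auto simp: differentiable_on_def intro: differentiableI_vector)
  next
    case (Suc n)
    then obtain P' where P': "X P'" "\<forall>x\<in>{a..b}. (P has_vector_derivative P' x) (at x within {a..b})"
      using step by blast
    have "(D ^^ Suc n) P x = (D ^^ n) P' x" if "x \<in> {a..b}" for x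
      using Dn_cong[of "D P" P' x n] P'(2) that by (auto simp: funpow_Suc_right D_eqI simp del: funpow.simps(2))
    with Suc.IH[OF P'(1)] show ?case
      by (auto simp: differentiable_on_def intro: differentiable_transform_within[where d = 1])
  qed
  with assms(1) show ?thesis by (auto simp: B1_def)
qed

lemma B1_cong:
  assumes "P \<in> B1 a b" "\<And>x. x \<in> {a..b} \<Longrightarrow> P x = Q x"
  shows "Q \<in> B1 a b"
proof (rule B1_coinduct[where X = "\<lambda>Q. \<exists>P\<in>B1 a b. \<forall>x\<in>{a..b}. P x = Q x"])
  fix Q assume "\<exists>P\<in>B1 a b. \<forall>x\<in>{a..b}. P x = Q x"
  then obtain P where P: "P \<in> B1 a b" "\<forall>x\<in>{a..b}. P x = Q x" by blast
  have "(Q has_vector_derivative D P x) (at x within {a..b})" if "x \<in> {a..b}" for x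
    using that P by (intro has_vector_derivative_transform[OF _ _ B1_has_derivative[OF P(1)]]) auto
  with B1_D[OF P(1)] show "\<exists>P'. (\<exists>P\<in>B1 a b. \<forall>x\<in>{a..b}. P x = P' x) \<and>
      (\<forall>x\<in>{a..b}. (Q has_vector_derivative P' x) (at x within {a..b}))" by blast
qed (use assms in blast)

lemma continuous_on_B1: "P \<in> B1 a b \<Longrightarrow> continuous_on {a..b} P"
  using B1_has_derivative by (blast intro: continuous_on_vector_derivative)

section \<open>Functions of one variable as kernels\<close>

text \<open>Functions of one variable embed into the kernels and are recovered as values on the slice \<open>y = a\<close>, so
sums and products of smooth functions are smooth because sums and products of kernels are.\<close>

lemma lift_fst_B2:
  assumes "P \<in> B1 a b" shows "(\<lambda>p. P (fst p)) \<in> B2 a b"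
proof -
  have "Ck_triangle a b k (\<lambda>p. P (fst p))" if "P \<in> B1 a b" for k P
    using that
  proof (induction k arbitrary: P)
    case 0
    then show ?case
      by (auto intro!: continuous_on_compose2[OF continuous_on_B1] continuous_intros simp: triangle_def)
  next
    case (Suc k)
    show ?case
      by (rule Ck_SucI[where fx = "\<lambda>p. D P (fst p)" and fy = "\<lambda>_. 0"])
        (auto intro!: partialsI Suc.IH B1_D Suc.prems Ck_const continuous_on_compose2[OF continuous_on_B1]
          has_vector_derivative_within_subset[OF B1_has_derivative] continuous_intros simp: triangle_def)
  qed
  with assms show ?thesis by (simp add: B2_def)
qed

lemma lift_snd_B2:
  assumes "P \<in> B1 a b" shows "(\<lambda>p. P (snd p)) \<in> B2 a b"
proof -
  have "Ck_triangle a b k (\<lambda>p. P (snd p))" if "P \<in> B1 a b" for k P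
    using that
  proof (induction k arbitrary: P)
    case 0
    then show ?case
      by (auto intro!: continuous_on_compose2[OF continuous_on_B1] continuous_intros simp: triangle_def)
  next
    case (Suc k)
    show ?case
      by (rule Ck_SucI[where fy = "\<lambda>p. D P (snd p)" and fx = "\<lambda>_. 0"])
        (auto intro!: partialsI Suc.IH B1_D Suc.prems Ck_const continuous_on_compose2[OF continuous_on_B1]
          has_vector_derivative_within_subset[OF B1_has_derivative] continuous_intros simp: triangle_def)
  qed
  with assms show ?thesis by (simp add: B2_def)
qed

lemma slice_B1:
  assumes "f \<in> B2 a b" shows "(\<lambda>x. f (x, a)) \<in> B1 a b"
proof (rule B1_coinduct[where X = "\<lambda>P. \<exists>f\<in>B2 a b. P = (\<lambda>x. f (x, a))"])
  fix P assume "\<exists>f\<in>B2 a b. P = (\<lambda>x. f (x, a))"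
  then obtain f where f: "f \<in> B2 a b" "P = (\<lambda>x. f (x, a))" by blast
  obtain fx fy where p: "fx \<in> B2 a b" "partials a b f fx fy" using B2_partials[OF ab f(1)] by metis
  then show "\<exists>P'. (\<exists>f\<in>B2 a b. P' = (\<lambda>x. f (x, a))) \<and>
      (\<forall>x\<in>{a..b}. (P has_vector_derivative P' x) (at x within {a..b}))"
    by (intro exI[of _ "\<lambda>x. fx (x, a)"]) (auto simp: f(2) intro!: partialsD(1)[OF p(2)])
qed (use assms in blast)

lemma diagonal_has_derivative:
  assumes "f \<in> B2 a b" "fx \<in> B2 a b" "fy \<in> B2 a b" "partials a b f fx fy" "x \<in> {a..b}"
  shows "((\<lambda>x. f (x, x)) has_vector_derivative fx (x, x) + fy (x, x)) (at x within {a..b})"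
  by (rule has_vector_derivative_diagonal[OF continuous_on_B2[OF assms(2)] continuous_on_B2[OF assms(3)] _ _ assms(5)])
    (auto simp: triangle_def intro: partialsD[OF assms(4)])

lemma diagonal_B1:
  assumes "f \<in> B2 a b" shows "(\<lambda>x. f (x, x)) \<in> B1 a b"
proof (rule B1_coinduct[where X = "\<lambda>P. \<exists>f\<in>B2 a b. P = (\<lambda>x. f (x, x))"])
  fix P assume "\<exists>f\<in>B2 a b. P = (\<lambda>x. f (x, x))"
  then obtain f where f: "f \<in> B2 a b" "P = (\<lambda>x. f (x, x))" by blast
  obtain fx fy where p: "fx \<in> B2 a b" "fy \<in> B2 a b" "partials a b f fx fy" using B2_partials[OF ab f(1)] .
  show "\<exists>P'. (\<exists>f\<in>B2 a b. P' = (\<lambda>x. f (x, x))) \<and>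
      (\<forall>x\<in>{a..b}. (P has_vector_derivative P' x) (at x within {a..b}))"
    by (intro exI[of _ "\<lambda>x. fx (x, x) + fy (x, x)"] conjI bexI[of _ "\<lambda>p. fx p + fy p"] B2_add p)
      (auto simp: f(2) intro!: diagonal_has_derivative[OF f(1) p])
qed (use assms in blast)

lemma B1_const: "(\<lambda>_. c) \<in> B1 a b"
  using slice_B1[OF B2_const] .

lemma B1_add: "P \<in> B1 a b \<Longrightarrow> Q \<in> B1 a b \<Longrightarrow> (\<lambda>x. P x + Q x) \<in> B1 a b"
  using slice_B1[OF B2_add[OF lift_fst_B2 lift_fst_B2]] by simp

lemma B1_mult: "P \<in> B1 a b \<Longrightarrow> Q \<in> B1 a b \<Longrightarrow> (\<lambda>x. P x * Q x) \<in> B1 a b"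
  using slice_B1[OF B2_mult[OF lift_fst_B2 lift_fst_B2]] by simp

lemma D_const: "D (\<lambda>_. c) = (\<lambda>_. 0)"
  by (rule D_eqI_fun) auto

lemma D_add: "P \<in> B1 a b \<Longrightarrow> Q \<in> B1 a b \<Longrightarrow> D (\<lambda>x. P x + Q x) = (\<lambda>x. D P x + D Q x)"
  by (rule D_eqI_fun)
    (auto intro!: has_vector_derivative_add B1_has_derivative simp: D_outside simp del: atLeastAtMost_iff)

lemma D_mult: "P \<in> B1 a b \<Longrightarrow> Q \<in> B1 a b \<Longrightarrow> D (\<lambda>x. P x * Q x) = (\<lambda>x. P x * D Q x + D P x * Q x)"
  by (rule D_eqI_fun)
    (auto intro!: has_vector_derivative_mult B1_has_derivative simp: D_outside simp del: atLeastAtMost_iff)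

lemma Dn_add:
  "P \<in> B1 a b \<Longrightarrow> Q \<in> B1 a b \<Longrightarrow> (D ^^ n) (\<lambda>x. P x + Q x) = (\<lambda>x. (D ^^ n) P x + (D ^^ n) Q x)"
  by (induction n) (auto simp: D_add B1_Dn)

lemma inverse_power_has_derivative:
  assumes P: "P \<in> B1 a b" and nz: "\<And>x. x \<in> {a..b} \<Longrightarrow> P x \<noteq> 0" and x: "x \<in> {a..b}"
  shows "((\<lambda>x. inverse (P x) ^ k) has_vector_derivative
    - (of_nat k * D P x) * inverse (P x) ^ Suc k) (at x within {a..b})"
proof -
  have "((\<lambda>w. inverse w ^ k) has_field_derivative - (of_nat k * inverse (P x) ^ Suc k)) (at (P x) within P ` {a..b})"
  proof (cases k)
    case (Suc j)
    have "(inverse has_field_derivative - (inverse (P x) ^ Suc (Suc 0))) (at (P x) within P ` {a..b})"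
      by (rule DERIV_inverse[OF nz[OF x]])
    from DERIV_power[OF this, of "Suc j"] show ?thesis
      by (simp add: Suc mult_ac)
  qed simp
  from field_vector_diff_chain_within[OF B1_has_derivative[OF P x] this] show ?thesis
    by (simp add: o_def algebra_simps)
qed

text \<open>The functions \<open>Q / P^k\<close> with \<open>Q\<close> smooth form a class closed under differentiation.\<close>

lemma B1_inverse:
  assumes P: "P \<in> B1_plus a b" shows "(\<lambda>x. inverse (P x)) \<in> B1 a b"
proof (rule B1_coinduct[where X = "\<lambda>R. \<exists>Q\<in>B1 a b. \<exists>k. R = (\<lambda>x. Q x * inverse (P x) ^ k)"])
  fix R assume "\<exists>Q\<in>B1 a b. \<exists>k. R = (\<lambda>x. Q x * inverse (P x) ^ k)"
  then obtain Q k where Q: "Q \<in> B1 a b" "R = (\<lambda>x. Q x * inverse (P x) ^ k)" by blast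
  have P1: "P \<in> B1 a b" and nz: "\<And>x. x \<in> {a..b} \<Longrightarrow> P x \<noteq> 0" using P by (auto simp: B1_plus_def)
  let ?Q' = "\<lambda>x. D Q x * P x + - of_nat k * (Q x * D P x)"
  have "(R has_vector_derivative ?Q' x * inverse (P x) ^ Suc k) (at x within {a..b})" if "x \<in> {a..b}" for x
    unfolding Q(2)
    using has_vector_derivative_mult[OF B1_has_derivative[OF Q(1) that] inverse_power_has_derivative[OF P1 nz that, of k]] nz[OF that]
    by (simp add: field_simps)
  moreover have "?Q' \<in> B1 a b" by (intro B1_add B1_mult B1_D Q P1 B1_const)
  ultimately show "\<exists>P'. (\<exists>Q\<in>B1 a b. \<exists>k. P' = (\<lambda>x. Q x * inverse (P x) ^ k)) \<and>
      (\<forall>x\<in>{a..b}. (R has_vector_derivative P' x) (at x within {a..b}))" by blast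
qed (intro bexI[OF _ B1_const[of 1]] exI[of _ 1], simp)

section \<open>The space M and Volterra operators\<close>

lemma M_B1: "\<phi> \<in> M \<Longrightarrow> \<phi> \<in> B1 a b"
  and M_outside: "\<phi> \<in> M \<Longrightarrow> x \<notin> {a..b} \<Longrightarrow> \<phi> x = 0"
  and M_Dn_a: "\<phi> \<in> M \<Longrightarrow> (D ^^ n) \<phi> a = 0"
  by (auto simp: Msp_def)

lemma M_at_a: "\<phi> \<in> M \<Longrightarrow> \<phi> a = 0"
  using M_Dn_a[of \<phi> 0] by simp

lemma M_I: "\<phi> \<in> B1 a b \<Longrightarrow> (\<And>x. x \<notin> {a..b} \<Longrightarrow> \<phi> x = 0) \<Longrightarrow> (\<And>n. (D ^^ n) \<phi> a = 0) \<Longrightarrow> \<phi> \<in> M"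
  by (auto simp: Msp_def)

lemma M_D: "\<phi> \<in> M \<Longrightarrow> D \<phi> \<in> M"
  by (rule M_I) (auto intro: B1_D M_B1 simp: D_outside M_Dn_a[of _ "Suc _", simplified funpow_Suc_right o_def])

lemma M_Dn: "\<phi> \<in> M \<Longrightarrow> (D ^^ n) \<phi> \<in> M"
  by (induction n) (auto intro: M_D)

lemma M_add: "\<phi> \<in> M \<Longrightarrow> \<psi> \<in> M \<Longrightarrow> (\<lambda>x. \<phi> x + \<psi> x) \<in> M"
  by (rule M_I) (auto intro: B1_add simp: M_B1 M_outside Dn_add M_Dn_a)

lemma M_mult: assumes P: "P \<in> B1 a b" and \<phi>: "\<phi> \<in> M" shows "(\<lambda>x. P x * \<phi> x) \<in> M"
proof (rule M_I)
  show "(D ^^ n) (\<lambda>x. P x * \<phi> x) a = 0" for n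
    using P \<phi>
  proof (induction n arbitrary: P \<phi>)
    case (Suc n)
    have "(D ^^ Suc n) (\<lambda>x. P x * \<phi> x) = (D ^^ n) (\<lambda>x. P x * D \<phi> x + D P x * \<phi> x)"
      by (simp add: funpow_Suc_right D_mult Suc.prems M_B1 del: funpow.simps)
    also have "\<dots> = (\<lambda>x. (D ^^ n) (\<lambda>x. P x * D \<phi> x) x + (D ^^ n) (\<lambda>x. D P x * \<phi> x) x)"
      by (intro Dn_add B1_mult B1_D M_B1 Suc.prems)
    finally show ?case using Suc.IH[of P "D \<phi>"] Suc.IH[of "D P" \<phi>] Suc.prems
      by (simp add: M_D B1_D)
  qed (simp add: M_at_a)
qed (auto intro: B1_mult P M_B1 \<phi> simp: M_outside \<phi>)

lemma M_zero: "(\<lambda>_. 0) \<in> M"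
proof (rule M_I)
  show "(D ^^ n) (\<lambda>_. 0) a = 0" for n
  proof -
    have "(D ^^ n) (\<lambda>_. 0) = (\<lambda>_. 0)" by (induction n) (auto simp: D_const)
    then show ?thesis by simp
  qed
qed (auto intro: B1_const)

lemma M_sum: "(\<And>i. i \<in> S \<Longrightarrow> \<phi> i \<in> M) \<Longrightarrow> (\<lambda>x. \<Sum>i\<in>S. \<phi> i x) \<in> M"
  by (induction S rule: infinite_finite_induct) (auto intro: M_zero M_add)

text \<open>The action of \<open>f \<theta>\<close>, as a plain function instead of an operator that is undefined outside \<open>M\<close>.\<close>

definition V :: "(real \<times> real \<Rightarrow> complex) \<Rightarrow> (real \<Rightarrow> complex) \<Rightarrow> real \<Rightarrow> complex" where
  "V f \<phi> = (\<lambda>x. if x \<in> {a..b} then integral {a..x} (\<lambda>z. f (x, z) * \<phi> z) else 0)"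

lemma V_eq_star: "x \<in> {a..b} \<Longrightarrow> V f \<phi> x = star f (\<lambda>p. \<phi> (fst p)) (x, a)"
  by (simp add: V_def star_def)

lemma V_outside: "x \<notin> {a..b} \<Longrightarrow> V f \<phi> x = 0"
  by (simp only: V_def if_False)

lemma V_integrand_continuous:
  "f \<in> B2 a b \<Longrightarrow> \<phi> \<in> B1 a b \<Longrightarrow> x \<in> {a..b} \<Longrightarrow> continuous_on {a..x} (\<lambda>z. f (x, z) * \<phi> z)"
  by (intro continuous_on_mult continuous_on_triangle_compose[OF continuous_on_B2]
      continuous_on_subset[OF continuous_on_B1] continuous_intros) auto

lemma V_B1: assumes "f \<in> B2 a b" "\<phi> \<in> B1 a b" shows "V f \<phi> \<in> B1 a b"
  using slice_B1[OF B2_star[OF assms(1) lift_fst_B2[OF assms(2)]]]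
  by (rule B1_cong) (simp add: V_eq_star)

lemma D_V:
  assumes f: "f \<in> B2 a b" and fx: "fx \<in> B2 a b" and p: "partials a b f fx fy" and \<phi>: "\<phi> \<in> M"
  shows "D (V f \<phi>) = (\<lambda>x. f (x, x) * \<phi> x + V fx \<phi> x)"
proof
  fix x show "D (V f \<phi>) x = f (x, x) * \<phi> x + V fx \<phi> x"
  proof (cases "x \<in> {a..b}")
    case True
    have "((\<lambda>x. integral {a..x} (\<lambda>z. f (x, z) * \<phi> z)) has_vector_derivative
        f (x, x) * \<phi> x + integral {a..x} (\<lambda>z. fx (x, z) * \<phi> z)) (at x within {a..b})"
      by (rule leibniz_upper_triangle[OF continuous_on_B2[OF f] continuous_on_B2[OF fx] continuous_on_B1[OF M_B1[OF \<phi>]] _ True])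
        (auto simp: triangle_def intro: partialsD[OF p])
    then have I: "((\<lambda>x. integral {a..x} (\<lambda>z. f (x, z) * \<phi> z)) has_vector_derivative
        f (x, x) * \<phi> x + V fx \<phi> x) (at x within {a..b})"
      using True by (simp add: V_def)
    have "(V f \<phi> has_vector_derivative f (x, x) * \<phi> x + V fx \<phi> x) (at x within {a..b})"
      by (rule has_vector_derivative_transform[OF True _ I]) (simp add: V_def)
    then show ?thesis by (rule D_eqI[OF True])
  qed (simp add: V_outside D_outside M_outside[OF \<phi>] del: atLeastAtMost_iff)
qed

text \<open>Each derivative of \<open>V f \<phi>\<close> is a multiple of \<open>\<phi>\<close> plus a Volterra integral, so all of them vanish at \<open>a\<close>.\<close>

lemma V_M: assumes f: "f \<in> B2 a b" and \<phi>: "\<phi> \<in> M" shows "V f \<phi> \<in> M"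
proof (rule M_I)
  show "(D ^^ n) (V f \<phi>) a = 0" for n
    using f
  proof (induction n arbitrary: f)
    case 0
    then show ?case using ab by (simp add: V_def)
  next
    case (Suc n)
    obtain fx fy where p: "fx \<in> B2 a b" "partials a b f fx fy" using B2_partials[OF ab Suc.prems] by metis
    have m: "(\<lambda>x. f (x, x) * \<phi> x) \<in> M" by (intro M_mult diagonal_B1 \<phi> Suc.prems)
    have "(D ^^ Suc n) (V f \<phi>) = (D ^^ n) (\<lambda>x. f (x, x) * \<phi> x + V fx \<phi> x)"
      using D_V[OF Suc.prems p \<phi>] by (simp add: funpow_Suc_right del: funpow.simps)
    also have "\<dots> = (\<lambda>x. (D ^^ n) (\<lambda>x. f (x, x) * \<phi> x) x + (D ^^ n) (V fx \<phi>) x)"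
      by (intro Dn_add V_B1 p M_B1 \<phi> m)
    finally show ?case using Suc.IH[OF p(1)] M_Dn_a[OF m] by simp
  qed
qed (use assms in \<open>simp_all add: V_B1 M_B1 V_outside del: atLeastAtMost_iff\<close>)

lemma V_cong_kernel:
  "(\<And>x y. a \<le> y \<Longrightarrow> y \<le> x \<Longrightarrow> x \<le> b \<Longrightarrow> f (x, y) = g (x, y)) \<Longrightarrow> V f \<phi> = V g \<phi>"
  by (intro ext) (auto simp: V_def intro!: integral_cong)

lemma V_add_kernel: "f \<in> B2 a b \<Longrightarrow> g \<in> B2 a b \<Longrightarrow> \<phi> \<in> M \<Longrightarrow> V (\<lambda>p. f p + g p) \<phi> = (\<lambda>x. V f \<phi> x + V g \<phi> x)"
  by (intro ext) (auto simp: V_def distrib_right intro!: integral_add integrable_continuous_real V_integrand_continuous M_B1)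

lemma V_mult_kernel: "V (\<lambda>p. P (fst p) * f p) \<phi> = (\<lambda>x. P x * V f \<phi> x)"
  by (intro ext) (auto simp: V_def mult.assoc)

lemma V_add: "f \<in> B2 a b \<Longrightarrow> \<phi> \<in> M \<Longrightarrow> \<psi> \<in> M \<Longrightarrow> V f (\<lambda>x. \<phi> x + \<psi> x) = (\<lambda>x. V f \<phi> x + V f \<psi> x)"
  by (intro ext) (auto simp: V_def distrib_left intro!: integral_add integrable_continuous_real V_integrand_continuous M_B1)

lemma V_zero: "V f (\<lambda>_. 0) = (\<lambda>_. 0)"
  by (auto simp: V_def)

lemma V_sum:
  "f \<in> B2 a b \<Longrightarrow> (\<And>i. i \<in> S \<Longrightarrow> \<phi> i \<in> M) \<Longrightarrow> V f (\<lambda>x. \<Sum>i\<in>S. \<phi> i x) = (\<lambda>x. \<Sum>i\<in>S. V f (\<phi> i) x)"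
  by (induction S rule: infinite_finite_induct) (auto simp: V_zero V_add M_sum)

lemma V_mult: "V f (\<lambda>x. P x * \<phi> x) = V (\<lambda>p. f p * P (snd p)) \<phi>"
  by (intro ext) (auto simp: V_def mult.assoc)

lemma V_V: assumes "f \<in> B2 a b" "g \<in> B2 a b" "\<phi> \<in> M" shows "V f (V g \<phi>) = V (star f g) \<phi>"
proof
  fix x show "V f (V g \<phi>) x = V (star f g) \<phi> x"
  proof (cases "x \<in> {a..b}")
    case True
    have "V (star f g) \<phi> x = star f (star g (\<lambda>p. \<phi> (fst p))) (x, a)"
      unfolding V_eq_star[OF True] using True assms
      by (intro star_assoc[of a b] continuous_on_B2 lift_fst_B2 M_B1) auto
    also have "\<dots> = V f (V g \<phi>) x"
      unfolding V_eq_star[OF True] by (rule star_cong) (use True in \<open>auto simp: V_eq_star\<close>)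
    finally show ?thesis by simp
  qed (simp add: V_outside del: atLeastAtMost_iff)
qed

text \<open>Integration by parts; the boundary term at \<open>a\<close> vanishes because \<open>\<phi>\<close> does.\<close>

lemma V_D:
  assumes f: "f \<in> B2 a b" and fy: "fy \<in> B2 a b" and p: "partials a b f fx fy" and \<phi>: "\<phi> \<in> M"
  shows "V f (D \<phi>) = (\<lambda>x. f (x, x) * \<phi> x + - V fy \<phi> x)"
proof
  fix x show "V f (D \<phi>) x = f (x, x) * \<phi> x + - V fy \<phi> x"
  proof (cases "x \<in> {a..b}")
    case True
    note B = M_B1[OF \<phi>]
    have "((\<lambda>z. f (x, z) * D \<phi> z + fy (x, z) * \<phi> z) has_integral f (x, x) * \<phi> x - f (x, a) * \<phi> a) {a..x}"
    proof (rule fundamental_theorem_of_calculus)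
      fix z assume z: "z \<in> {a..x}"
      show "((\<lambda>z. f (x, z) * \<phi> z) has_vector_derivative f (x, z) * D \<phi> z + fy (x, z) * \<phi> z) (at z within {a..x})"
        by (intro has_vector_derivative_mult partialsD(2)[OF p] has_vector_derivative_within_subset[OF B1_has_derivative[OF B]])
          (use True z in auto)
    qed (use True in simp)
    moreover have "integral {a..x} (\<lambda>z. f (x, z) * D \<phi> z + fy (x, z) * \<phi> z) =
        integral {a..x} (\<lambda>z. f (x, z) * D \<phi> z) + integral {a..x} (\<lambda>z. fy (x, z) * \<phi> z)"
      by (intro integral_add integrable_continuous_real V_integrand_continuous f fy B B1_D True)
    ultimately show ?thesis using True M_at_a[OF \<phi>] by (simp add: V_def integral_unique algebra_simps)
  qed (simp add: V_outside M_outside[OF \<phi>] del: atLeastAtMost_iff)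
qed

text \<open>On \<open>M\<close> differentiation is invertible, with inverse the Volterra operator of kernel \<open>1\<close>.\<close>

lemma D_V_one: "\<phi> \<in> M \<Longrightarrow> D (V (\<lambda>_. 1) \<phi>) = \<phi>"
  and V_one_D: "\<phi> \<in> M \<Longrightarrow> V (\<lambda>_. 1) (D \<phi>) = \<phi>"
proof -
  have p: "partials a b (\<lambda>_. 1) (\<lambda>_. 0) (\<lambda>_. 0)" by (rule partialsI) auto
  have V0: "V (\<lambda>_. 0) \<phi> = (\<lambda>_. 0)" for \<phi> by (auto simp: V_def)
  show "\<phi> \<in> M \<Longrightarrow> D (V (\<lambda>_. 1) \<phi>) = \<phi>" "\<phi> \<in> M \<Longrightarrow> V (\<lambda>_. 1) (D \<phi>) = \<phi>"
    by (simp_all add: D_V[OF B2_const B2_const p] V_D[OF B2_const B2_const p] V0)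
qed

end

section \<open>Orders and leading coefficients of integro-differential operators\<close>

context nondegenerate_interval begin

lemma D_sum:
  "(\<And>i. i \<in> S \<Longrightarrow> \<phi> i \<in> M) \<Longrightarrow> D (\<lambda>x. \<Sum>i\<in>S. \<phi> i x) = (\<lambda>x. \<Sum>i\<in>S. D (\<phi> i) x)"
  by (induction S rule: infinite_finite_induct) (auto simp: D_const D_add M_sum M_B1)

definition IDO :: "nat \<Rightarrow> (nat \<Rightarrow> real \<Rightarrow> complex) \<Rightarrow> (real \<times> real \<Rightarrow> complex) \<Rightarrow> oper" where
  "IDO n P f \<phi> = (\<lambda>x. (\<Sum>i\<le>n. P i x * (D ^^ i) \<phi> x) + V f \<phi> x)"

text \<open>Here \<open>n\<close> only bounds the order and \<open>c\<close> may vanish anywhere. So an operator of smaller order has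
leading coefficient \<open>0\<close>, as do Volterra operators, and leading coefficients become additive and
can be computed while discarding everything of lower order.\<close>

definition leads :: "nat \<Rightarrow> (real \<Rightarrow> complex) \<Rightarrow> oper \<Rightarrow> bool" where
  "leads n c T \<longleftrightarrow> (\<exists>P f. (\<forall>i. P i \<in> B1 a b) \<and> f \<in> B2 a b \<and> (\<forall>x\<in>{a..b}. P n x = c x) \<and>
     (\<forall>\<phi>\<in>M. T \<phi> = IDO n P f \<phi>))"

lemma IDO_M: "(\<And>i. i \<le> n \<Longrightarrow> P i \<in> B1 a b) \<Longrightarrow> f \<in> B2 a b \<Longrightarrow> \<phi> \<in> M \<Longrightarrow> IDO n P f \<phi> \<in> M"
  unfolding IDO_def by (intro M_add M_sum M_mult M_Dn V_M) auto

lemma leadsI: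
  "(\<And>i. P i \<in> B1 a b) \<Longrightarrow> f \<in> B2 a b \<Longrightarrow> (\<And>x. x \<in> {a..b} \<Longrightarrow> P n x = c x) \<Longrightarrow>
    (\<And>\<phi>. \<phi> \<in> M \<Longrightarrow> T \<phi> = IDO n P f \<phi>) \<Longrightarrow> leads n c T"
  unfolding leads_def by blast

lemma leadsE:
  assumes "leads n c T"
  obtains P f where "\<And>i. P i \<in> B1 a b" "f \<in> B2 a b" "\<And>x. x \<in> {a..b} \<Longrightarrow> P n x = c x"
    "\<And>\<phi>. \<phi> \<in> M \<Longrightarrow> T \<phi> = IDO n P f \<phi>"
  using assms unfolding leads_def by metis

lemma leads_M: "leads n c T \<Longrightarrow> \<phi> \<in> M \<Longrightarrow> T \<phi> \<in> M"
  by (erule leadsE) (simp add: IDO_M)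

lemma leads_cong:
  "leads n c T \<Longrightarrow> (\<And>x. x \<in> {a..b} \<Longrightarrow> c x = d x) \<Longrightarrow> (\<And>\<phi>. \<phi> \<in> M \<Longrightarrow> S \<phi> = T \<phi>) \<Longrightarrow> leads n d S"
  unfolding leads_def by metis

lemma leads_add:
  assumes "leads n c T" "leads n d S"
  shows "leads n (\<lambda>x. c x + d x) (\<lambda>\<phi> x. T \<phi> x + S \<phi> x)"
proof -
  obtain P f where 1: "\<And>i. P i \<in> B1 a b" "f \<in> B2 a b" "\<And>x. x \<in> {a..b} \<Longrightarrow> P n x = c x"
    "\<And>\<phi>. \<phi> \<in> M \<Longrightarrow> T \<phi> = IDO n P f \<phi>" using assms(1) by (elim leadsE) blast
  obtain Q g where 2: "\<And>i. Q i \<in> B1 a b" "g \<in> B2 a b" "\<And>x. x \<in> {a..b} \<Longrightarrow> Q n x = d x"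
    "\<And>\<phi>. \<phi> \<in> M \<Longrightarrow> S \<phi> = IDO n Q g \<phi>" using assms(2) by (elim leadsE) blast
  show ?thesis
    by (rule leadsI[where P = "\<lambda>i x. P i x + Q i x" and f = "\<lambda>p. f p + g p"])
      (simp_all add: 1 2 B1_add B2_add IDO_def V_add_kernel fun_eq_iff distrib_right sum.distrib)
qed

lemma leads_mult:
  assumes "P \<in> B1 a b" "leads n c T"
  shows "leads n (\<lambda>x. P x * c x) (\<lambda>\<phi> x. P x * T \<phi> x)"
proof -
  obtain Q f where 1: "\<And>i. Q i \<in> B1 a b" "f \<in> B2 a b" "\<And>x. x \<in> {a..b} \<Longrightarrow> Q n x = c x"
    "\<And>\<phi>. \<phi> \<in> M \<Longrightarrow> T \<phi> = IDO n Q f \<phi>" using assms(2) by (elim leadsE) blast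
  show ?thesis
    by (rule leadsI[where P = "\<lambda>i x. P x * Q i x" and f = "\<lambda>p. P (fst p) * f p"])
      (simp_all add: assms(1) 1 B1_mult B2_mult lift_fst_B2 IDO_def V_mult_kernel fun_eq_iff
        distrib_left sum_distrib_left mult.assoc)
qed

lemma V_zero_kernel: "V (\<lambda>_. 0) \<phi> = (\<lambda>_. 0)"
  by (auto simp: V_def)

lemma leads_zero: "leads n (\<lambda>_. 0) (\<lambda>\<phi> x. 0)"
  by (rule leadsI[where P = "\<lambda>_ _. 0" and f = "\<lambda>_. 0"])
    (simp_all add: B1_const B2_const IDO_def V_zero_kernel)

lemma leads_sum:
  "(\<And>i. i \<in> S \<Longrightarrow> leads n (c i) (T i)) \<Longrightarrow> leads n (\<lambda>x. \<Sum>i\<in>S. c i x) (\<lambda>\<phi> x. \<Sum>i\<in>S. T i \<phi> x)"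
  by (induction S rule: infinite_finite_induct) (simp_all add: leads_zero leads_add)

lemma leads_lower:
  assumes "leads n c T" "n < m" shows "leads m (\<lambda>_. 0) T"
proof -
  obtain P f where 1: "\<And>i. P i \<in> B1 a b" "f \<in> B2 a b" "\<And>x. x \<in> {a..b} \<Longrightarrow> P n x = c x"
    "\<And>\<phi>. \<phi> \<in> M \<Longrightarrow> T \<phi> = IDO n P f \<phi>" using assms(1) by (elim leadsE) blast
  have "(\<Sum>i\<le>m. (if i \<le> n then P i x else 0) * (D ^^ i) \<phi> x) = (\<Sum>i\<le>n. P i x * (D ^^ i) \<phi> x)" for x \<phi>
    by (rule sum.mono_neutral_cong_right) (use assms(2) in auto)
  moreover have "(\<lambda>x. if i \<le> n then P i x else 0) \<in> B1 a b" for i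
    by (cases "i \<le> n") (simp_all add: 1 B1_const)
  ultimately show ?thesis using assms(2)
    by (intro leadsI[where P = "\<lambda>i x. if i \<le> n then P i x else 0" and f = f])
      (simp_all add: 1 IDO_def)
qed

lemma leads_zero_mono: "leads n (\<lambda>_. 0) T \<Longrightarrow> n \<le> m \<Longrightarrow> leads m (\<lambda>_. 0) T"
  using leads_lower by (cases "n = m") auto

lemma leads_V: "f \<in> B2 a b \<Longrightarrow> leads n (\<lambda>_. 0) (V f)"
  by (rule leadsI[where P = "\<lambda>_ _. 0" and f = f]) (simp_all add: B1_const IDO_def)

lemma leads_Dn: "leads n (\<lambda>_. 1) (D ^^ n)"
proof (rule leadsI[where P = "\<lambda>i x. if i = n then 1 else 0" and f = "\<lambda>_. 0"])
  have "(\<Sum>i\<le>n. (if i = n then 1 else 0) * (D ^^ i) \<phi> x) = (D ^^ n) \<phi> x" for \<phi> x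
    by (simp add: if_distrib[of "\<lambda>c. c * _"] cong: if_cong)
  then show "(D ^^ n) \<phi> = IDO n (\<lambda>i x. if i = n then 1 else 0) (\<lambda>_. 0) \<phi>" for \<phi>
    by (simp add: IDO_def V_zero_kernel)
qed (simp_all add: B1_const B2_const)

lemma leads_mult_Dn: "P \<in> B1 a b \<Longrightarrow> leads n P (\<lambda>\<phi> x. P x * (D ^^ n) \<phi> x)"
  using leads_mult[OF _ leads_Dn] by simp

lemma leads_mult_Dn_le: "P \<in> B1 a b \<Longrightarrow> i \<le> n \<Longrightarrow> leads n (\<lambda>x. if i = n then P x else 0) (\<lambda>\<phi> x. P x * (D ^^ i) \<phi> x)"
  using leads_mult_Dn[of P n] leads_lower[OF leads_mult_Dn[of P i], of n] by (cases "i = n") auto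

lemma leads_D_left:
  assumes "leads n c T" shows "leads (Suc n) c (\<lambda>\<phi>. D (T \<phi>))"
proof -
  obtain P f where 1: "\<And>i. P i \<in> B1 a b" "f \<in> B2 a b" "\<And>x. x \<in> {a..b} \<Longrightarrow> P n x = c x"
    "\<And>\<phi>. \<phi> \<in> M \<Longrightarrow> T \<phi> = IDO n P f \<phi>" using assms(1) by (elim leadsE) blast
  obtain fx fy where p: "fx \<in> B2 a b" "partials a b f fx fy" using B2_partials[OF ab 1(2)] by metis
  let ?T = "\<lambda>i \<phi> x. P i x * (D ^^ Suc i) \<phi> x + D (P i) x * (D ^^ i) \<phi> x"
  let ?R = "\<lambda>\<phi> x. f (x, x) * (D ^^ 0) \<phi> x + V fx \<phi> x"
  have "leads (Suc n) (\<lambda>x. (\<Sum>i\<le>n. (if Suc i = Suc n then P i x else 0) + (if i = Suc n then D (P i) x else 0)) +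
      ((if 0 = Suc n then f (x, x) else 0) + 0)) (\<lambda>\<phi> x. (\<Sum>i\<le>n. ?T i \<phi> x) + ?R \<phi> x)"
    by (intro leads_add leads_sum leads_mult_Dn_le leads_V p B1_D 1 diagonal_B1) auto
  then show ?thesis
  proof (rule leads_cong)
    fix x assume x: "x \<in> {a..b}"
    have "(\<Sum>i\<le>n. (if Suc i = Suc n then P i x else 0) + (if i = Suc n then D (P i) x else 0)) =
        (\<Sum>i\<le>n. if i = n then P i x else 0)"
      by (rule sum.cong) auto
    then show "(\<Sum>i\<le>n. (if Suc i = Suc n then P i x else 0) + (if i = Suc n then D (P i) x else 0)) +
      ((if 0 = Suc n then f (x, x) else 0) + 0) = c x" using 1(3)[OF x] by simp
  next
    fix \<phi> assume \<phi>: "\<phi> \<in> M"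
    have "D (T \<phi>) = (\<lambda>x. D (\<lambda>x. \<Sum>i\<le>n. P i x * (D ^^ i) \<phi> x) x + D (V f \<phi>) x)"
      unfolding 1(4)[OF \<phi>] IDO_def by (intro D_add M_B1 M_sum M_mult M_Dn V_M 1 \<phi>)
    also have "D (\<lambda>x. \<Sum>i\<le>n. P i x * (D ^^ i) \<phi> x) = (\<lambda>x. \<Sum>i\<le>n. D (\<lambda>x. P i x * (D ^^ i) \<phi> x) x)"
      by (intro D_sum M_mult M_Dn 1 \<phi>)
    finally show "D (T \<phi>) = (\<lambda>x. (\<Sum>i\<le>n. ?T i \<phi> x) + ?R \<phi> x)"
      by (simp add: D_mult 1 M_B1 M_Dn \<phi> D_V[OF 1(2) p \<phi>])
  qed
qed

lemma leads_Dn_left: "leads n c T \<Longrightarrow> leads (k + n) c (\<lambda>\<phi>. (D ^^ k) (T \<phi>))"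
  by (induction k) (auto dest: leads_D_left)

text \<open>Integrating by parts repeatedly turns \<open>f \<theta>\<close> composed with \<open>\<partial>^i\<close> into a differential operator of order
below \<open>i\<close> plus a Volterra operator.\<close>

lemma leads_V_Dn: "f \<in> B2 a b \<Longrightarrow> leads i (\<lambda>_. 0) (\<lambda>\<phi>. V f ((D ^^ i) \<phi>))"
proof (induction i arbitrary: f)
  case 0
  then show ?case by (simp add: leads_V)
next
  case (Suc i)
  obtain fx fy where p: "fy \<in> B2 a b" "partials a b f fx fy" using B2_partials[OF ab Suc.prems] by metis
  have "leads (Suc i) (\<lambda>x. 0 + -1 * 0) (\<lambda>\<phi> x. f (x, x) * (D ^^ i) \<phi> x + -1 * V fy ((D ^^ i) \<phi>) x)"
    by (rule leads_add[OF leads_lower[OF leads_mult_Dn[OF diagonal_B1[OF Suc.prems]]]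
          leads_mult[OF B1_const leads_zero_mono[OF Suc.IH[OF p(1)]]]]) auto
  then show ?case
    by (rule leads_cong) (simp_all add: V_D[OF Suc.prems p] M_Dn)
qed

text \<open>A Volterra factor on the left lowers the differential order, whatever the other factor is.\<close>

lemma leads_V_left:
  assumes "leads n c T" "g \<in> B2 a b" shows "leads n (\<lambda>_. 0) (\<lambda>\<phi>. V g (T \<phi>))"
proof -
  obtain P f where 1: "\<And>i. P i \<in> B1 a b" "f \<in> B2 a b" "\<And>x. x \<in> {a..b} \<Longrightarrow> P n x = c x"
    "\<And>\<phi>. \<phi> \<in> M \<Longrightarrow> T \<phi> = IDO n P f \<phi>" using assms(1) by (elim leadsE) blast
  have "leads n (\<lambda>x. (\<Sum>i\<le>n. 0) + 0)
    (\<lambda>\<phi> x. (\<Sum>i\<le>n. V (\<lambda>p. g p * P i (snd p)) ((D ^^ i) \<phi>) x) + V (star g f) \<phi> x)"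
    by (intro leads_add leads_sum leads_V B2_star assms 1 leads_zero_mono[OF leads_V_Dn] B2_mult lift_snd_B2) auto
  then show ?thesis
  proof (rule leads_cong)
    fix \<phi> assume \<phi>: "\<phi> \<in> M"
    have "V g (T \<phi>) = (\<lambda>x. V g (\<lambda>x. \<Sum>i\<le>n. P i x * (D ^^ i) \<phi> x) x + V g (V f \<phi>) x)"
      unfolding 1(4)[OF \<phi>] IDO_def by (intro V_add assms M_sum M_mult M_Dn V_M 1 \<phi>)
    also have "V g (\<lambda>x. \<Sum>i\<le>n. P i x * (D ^^ i) \<phi> x) = (\<lambda>x. \<Sum>i\<le>n. V g (\<lambda>x. P i x * (D ^^ i) \<phi> x) x)"
      by (intro V_sum assms M_mult M_Dn 1 \<phi>)
    finally show "V g (T \<phi>) =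
        (\<lambda>x. (\<Sum>i\<le>n. V (\<lambda>p. g p * P i (snd p)) ((D ^^ i) \<phi>) x) + V (star g f) \<phi> x)"
      by (simp add: V_mult V_V assms 1 \<phi>)
  qed simp
qed

text \<open>Since \<open>\<theta>\<close> inverts \<open>\<partial>\<close>, a factor \<open>\<theta>\<close> on the right shifts all coefficients down by one; the former
zeroth coefficient becomes part of the kernel.\<close>

lemma leads_V_one_right:
  assumes "leads (Suc n) c T" shows "leads n c (\<lambda>\<phi>. T (V (\<lambda>_. 1) \<phi>))"
proof -
  obtain P f where 1: "\<And>i. P i \<in> B1 a b" "f \<in> B2 a b" "\<And>x. x \<in> {a..b} \<Longrightarrow> P (Suc n) x = c x"
    "\<And>\<phi>. \<phi> \<in> M \<Longrightarrow> T \<phi> = IDO (Suc n) P f \<phi>" using assms(1) by (elim leadsE) blast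
  show ?thesis
  proof (rule leadsI[where P = "\<lambda>i. P (Suc i)" and f = "\<lambda>p. P 0 (fst p) * 1 + star f (\<lambda>_. 1) p"])
    show "(\<lambda>p. P 0 (fst p) * 1 + star f (\<lambda>_. 1) p) \<in> B2 a b"
      by (intro B2_add B2_mult lift_fst_B2 B2_star 1 B2_const)
    fix \<phi> assume \<phi>: "\<phi> \<in> M"
    let ?u = "V (\<lambda>_. 1) \<phi>"
    have u: "?u \<in> M" by (intro V_M B2_const \<phi>)
    have "V (\<lambda>p. P 0 (fst p) * 1 + star f (\<lambda>_. 1) p) \<phi> = (\<lambda>x. V (\<lambda>p. P 0 (fst p) * 1) \<phi> x + V (star f (\<lambda>_. 1)) \<phi> x)"
      by (intro V_add_kernel B2_mult lift_fst_B2 B2_star 1 B2_const \<phi>)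
    also have "V (\<lambda>p. P 0 (fst p) * 1) \<phi> = (\<lambda>x. P 0 x * ?u x)"
      using V_mult_kernel[of "P 0" "\<lambda>_. 1"] by simp
    finally have "V (\<lambda>p. P 0 (fst p) * 1 + star f (\<lambda>_. 1) p) \<phi> = (\<lambda>x. P 0 x * ?u x + V f ?u x)"
      by (simp add: V_V 1 B2_const \<phi>)
    moreover have "(\<Sum>i\<le>Suc n. P i x * (D ^^ i) ?u x) = P 0 x * ?u x + (\<Sum>i\<le>n. P (Suc i) x * (D ^^ i) \<phi> x)" for x
      by (simp only: sum.atMost_Suc_shift) (simp add: funpow_Suc_right D_V_one \<phi> del: funpow.simps(2))
    ultimately show "T ?u = IDO n (\<lambda>i. P (Suc i)) (\<lambda>p. P 0 (fst p) * 1 + star f (\<lambda>_. 1) p) \<phi>"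
      unfolding 1(4)[OF u] IDO_def by (simp add: fun_eq_iff)
  qed (use 1 in auto)
qed

end

section \<open>Test functions and uniqueness of the leading coefficient\<close>

lemma tendsto_poly_times_exp_minus:
  "((\<lambda>u::real. u ^ k * poly q u * exp (- u)) \<longlongrightarrow> 0) at_top"
proof (induction q arbitrary: k)
  case (pCons c q)
  have "((\<lambda>u::real. c * (u ^ k / exp u) + u ^ Suc k * poly q u * exp (- u)) \<longlongrightarrow> c * 0 + 0) at_top"
    by (intro tendsto_add tendsto_mult tendsto_const tendsto_power_div_exp_0 pCons.IH)
  then show ?case by (simp add: algebra_simps exp_minus divide_inverse)
qed simp

text \<open>The functions \<open>q (1/t) exp (-1/t)\<close> with \<open>t = x - a\<close> and \<open>q\<close> a polynomial are closed under
differentiation and vanish at \<open>a\<close>, so all of them are flat there.\<close>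

definition flat :: "real \<Rightarrow> real poly \<Rightarrow> real \<Rightarrow> real" where
  "flat a q x = (if a < x then poly q (1 / (x - a)) * exp (- (1 / (x - a))) else 0)"

definition flat_deriv :: "real poly \<Rightarrow> real poly" where
  "flat_deriv q = [:0, 0, 1:] * (q - pderiv q)"

lemma flat_has_derivative:
  assumes "a < b" "x \<in> {a..b}"
  shows "(flat a q has_real_derivative flat a (flat_deriv q) x) (at x within {a..b})"
proof (cases "a < x")
  case True
  have d0: "((\<lambda>x. poly q (1 / (x - a)) * exp (- (1 / (x - a)))) has_real_derivative flat a (flat_deriv q) x) (at x)"
  proof -
    have d: "((\<lambda>x. 1 / (x - a)) has_real_derivative - (1 / (x - a) * (1 / (x - a)))) (at x)"
      using True by (auto intro!: derivative_eq_intros)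
    show ?thesis
      by (rule DERIV_cong[OF DERIV_mult[OF DERIV_chain2[OF poly_DERIV d] DERIV_chain2[OF DERIV_exp DERIV_minus[OF d]]]])
        (simp add: flat_def flat_deriv_def True algebra_simps)
  qed
  have ev: "\<forall>\<^sub>F y in nhds x. poly q (1 / (y - a)) * exp (- (1 / (y - a))) = flat a q y"
    using eventually_nhds_in_open[of "{a<..}" x] True by (auto elim!: eventually_mono simp: flat_def)
  have "(flat a q has_real_derivative flat a (flat_deriv q) x) (at x)"
    by (rule DERIV_cong_ev[OF refl ev refl, THEN iffD1, OF d0])
  then show ?thesis by (rule has_field_derivative_at_within)
next
  case False
  then have x: "x = a" using assms by simp
  have "filterlim (\<lambda>y. 1 / (y - a)) at_top (at_right a)"
    using filterlim_compose[OF filterlim_inverse_at_top_right, of "\<lambda>y. y - a" "at_right a"]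
    by (simp add: filterlim_at_right_to_0[of _ _ a] divide_inverse filterlim_inverse_at_top_right)
  from filterlim_compose[OF tendsto_poly_times_exp_minus[of 1 q] this]
  have lim: "((\<lambda>y. 1 / (y - a) * poly q (1 / (y - a)) * exp (- (1 / (y - a)))) \<longlongrightarrow> 0) (at_right a)"
    by simp
  have ev: "\<forall>\<^sub>F y in at_right a. 1 / (y - a) * poly q (1 / (y - a)) * exp (- (1 / (y - a))) =
      (flat a q y - flat a q a) / (y - a)"
    using eventually_at_right_less[of a] by (auto elim!: eventually_mono simp: flat_def)
  have "((\<lambda>y. (flat a q y - flat a q a) / (y - a)) \<longlongrightarrow> 0) (at_right a)"
    by (rule tendsto_cong[THEN iffD1, OF ev lim])
  then have "((\<lambda>y. (flat a q y - flat a q a) / (y - a)) \<longlongrightarrow> 0) (at a within {a..b})"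
    by (simp add: at_within_Icc_at_right assms)
  then show ?thesis by (simp add: x has_field_derivative_iff flat_def)
qed

context nondegenerate_interval begin

lemma M_nonvanishing: obtains \<psi> where "\<psi> \<in> M" "\<And>x. a < x \<Longrightarrow> x \<le> b \<Longrightarrow> \<psi> x \<noteq> 0"
proof
  let ?\<psi> = "\<lambda>x. if x \<in> {a..b} then complex_of_real (flat a 1 x) else 0"
  let ?X = "\<lambda>P. \<exists>q. \<forall>x\<in>{a..b}. P x = complex_of_real (flat a q x)"
  have step: "(P has_vector_derivative complex_of_real (flat a (flat_deriv q) x)) (at x within {a..b})"
    if "\<forall>x\<in>{a..b}. P x = complex_of_real (flat a q x)" "x \<in> {a..b}" for P q x
    by (rule has_vector_derivative_transform[OF that(2) _ has_vector_derivative_of_real])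
      (use that flat_has_derivative[OF ab that(2)] in \<open>auto simp: has_real_derivative_iff_has_vector_derivative\<close>)
  show "?\<psi> \<in> M"
  proof (rule M_I)
    show "?\<psi> \<in> B1 a b"
    proof (rule B1_coinduct[where X = ?X])
      fix P assume "?X P"
      then obtain q where "\<forall>x\<in>{a..b}. P x = complex_of_real (flat a q x)" by blast
      then show "\<exists>P'. ?X P' \<and> (\<forall>x\<in>{a..b}. (P has_vector_derivative P' x) (at x within {a..b}))"
        by (intro exI[of _ "\<lambda>x. complex_of_real (flat a (flat_deriv q) x)"]) (auto intro!: step)
    qed auto
    have "?X ((D ^^ n) ?\<psi>)" for n
    proof (induction n)
      case (Suc n)
      then obtain q where "\<forall>x\<in>{a..b}. (D ^^ n) ?\<psi> x = complex_of_real (flat a q x)" by blast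
      then have "\<forall>x\<in>{a..b}. D ((D ^^ n) ?\<psi>) x = complex_of_real (flat a (flat_deriv q) x)"
        by (auto intro!: D_eqI step)
      then show ?case by auto
    qed auto
    then show "(D ^^ n) ?\<psi> a = 0" for n using ab by (force simp: flat_def)
  qed auto
  show "?\<psi> x \<noteq> 0" if "a < x" "x \<le> b" for x using that by (simp add: flat_def)
qed

text \<open>Exponentials \<open>exp (l x)\<close> with a large frequency \<open>l\<close> separate the orders of an operator: \<open>\<partial>^i\<close> multiplies
them by \<open>l^i\<close>, and integration from \<open>a\<close> contributes a factor of size \<open>1/l\<close>. A flat factor \<open>\<psi>\<close> brings them into \<open>M\<close>.\<close>

definition expo :: "real \<Rightarrow> real \<Rightarrow> complex" where
  "expo l x = complex_of_real (exp (l * x))"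

lemma expo_has_derivative:
  "(expo l has_vector_derivative complex_of_real l * expo l x) (at x within S)"
proof -
  have "((\<lambda>x. exp (l * x)) has_real_derivative l * exp (l * x)) (at x within S)"
    by (auto intro!: derivative_eq_intros)
  then have "((\<lambda>x. complex_of_real (exp (l * x))) has_vector_derivative complex_of_real (l * exp (l * x))) (at x within S)"
    by (intro has_vector_derivative_of_real) (simp add: has_real_derivative_iff_has_vector_derivative)
  then show ?thesis by (simp add: expo_def[abs_def])
qed

lemma expo_B1: "expo l \<in> B1 a b"
proof (rule B1_coinduct[where X = "\<lambda>P. \<exists>c. P = (\<lambda>x. c * expo l x)"])
  fix P assume "\<exists>c. P = (\<lambda>x. c * expo l x)"
  then obtain c where c: "P = (\<lambda>x. c * expo l x)" by blast
  have "(P has_vector_derivative (c * complex_of_real l) * expo l x) (at x within {a..b})" for x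
    unfolding c mult.assoc by (intro has_vector_derivative_mult_right expo_has_derivative)
  then show "\<exists>P'. (\<exists>c. P' = (\<lambda>x. c * expo l x)) \<and>
      (\<forall>x\<in>{a..b}. (P has_vector_derivative P' x) (at x within {a..b}))" by blast
qed (auto intro: exI[of _ 1])

lemma D_expo_mult:
  assumes "\<psi> \<in> M"
  shows "D (\<lambda>x. expo l x * \<psi> x) = (\<lambda>x. expo l x * D \<psi> x + complex_of_real l * (expo l x * \<psi> x))"
  by (rule D_eqI_fun)
    (auto simp: D_outside M_outside[OF assms] mult.assoc[symmetric] simp del: atLeastAtMost_iff
      intro!: has_vector_derivative_mult expo_has_derivative B1_has_derivative M_B1 assms)

text \<open>By \<open>D (expo l \<cdot> \<psi>) = expo l \<cdot> D \<psi> + l \<cdot> expo l \<cdot> \<psi>\<close>, each derivative that falls on \<open>\<psi>\<close> loses a power of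
\<open>l\<close> compared with one that falls on the exponential.\<close>

lemma Dn_expo_asymptotics:
  assumes "\<psi> \<in> M"
  shows "((\<lambda>l. (D ^^ i) (\<lambda>x. expo l x * \<psi> x) x / (expo l x * complex_of_real l ^ i)) \<longlongrightarrow> \<psi> x) at_top"
  using assms
proof (induction i arbitrary: \<psi>)
  case 0
  have "(\<lambda>l. (D ^^ 0) (\<lambda>x. expo l x * \<psi> x) x / (expo l x * complex_of_real l ^ 0)) = (\<lambda>_. \<psi> x)"
    by (simp add: expo_def)
  then show ?case by simp
next
  case (Suc i)
  let ?q = "\<lambda>\<psi> l. (D ^^ i) (\<lambda>x. expo l x * \<psi> x) x / (expo l x * complex_of_real l ^ i)"
  have inv: "((\<lambda>l. complex_of_real (inverse l)) \<longlongrightarrow> complex_of_real 0) at_top"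
    by (intro tendsto_of_real tendsto_inverse_0_at_top filterlim_ident)
  have lim: "((\<lambda>l. complex_of_real (inverse l) * ?q (D \<psi>) l + ?q \<psi> l) \<longlongrightarrow> complex_of_real 0 * D \<psi> x + \<psi> x) at_top"
    by (intro tendsto_add tendsto_mult inv Suc.IH M_D Suc.prems)
  have ev: "\<forall>\<^sub>F l in at_top. complex_of_real (inverse l) * ?q (D \<psi>) l + ?q \<psi> l =
      (D ^^ Suc i) (\<lambda>x. expo l x * \<psi> x) x / (expo l x * complex_of_real l ^ Suc i)"
    using eventually_gt_at_top[of "0::real"]
  proof (rule eventually_mono)
    fix l :: real assume l: "l > 0"
    let ?c = "\<lambda>_::real. complex_of_real l"
    have e: "(\<lambda>x. expo l x * D \<psi> x) \<in> B1 a b" "(\<lambda>x. expo l x * \<psi> x) \<in> B1 a b"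
      by (intro B1_mult expo_B1 B1_D M_B1 Suc.prems)+
    have Dc: "(D ^^ n) (\<lambda>x. complex_of_real l * P x) = (\<lambda>x. complex_of_real l * (D ^^ n) P x)" if "P \<in> B1 a b" for n P
      using that by (induction n) (simp_all add: D_mult[OF B1_const] B1_Dn D_const)
    have "(D ^^ Suc i) (\<lambda>x. expo l x * \<psi> x) x =
        (D ^^ i) (\<lambda>x. expo l x * D \<psi> x) x + complex_of_real l * (D ^^ i) (\<lambda>x. expo l x * \<psi> x) x"
      by (simp add: funpow_Suc_right D_expo_mult Suc.prems Dn_add e B1_mult B1_const Dc del: funpow.simps(2))
    moreover have "expo l x \<noteq> 0" by (simp add: expo_def)
    ultimately show "complex_of_real (inverse l) * ?q (D \<psi>) l + ?q \<psi> l =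
      (D ^^ Suc i) (\<lambda>x. expo l x * \<psi> x) x / (expo l x * complex_of_real l ^ Suc i)"
      using l by (simp add: field_simps)
  qed
  show ?case
    by (rule tendsto_eq_rhs[OF tendsto_cong[THEN iffD1, OF ev lim]]) simp
qed

lemma V_expo_tendsto_0:
  assumes f: "f \<in> B2 a b" and \<psi>: "\<psi> \<in> M" and x: "x \<in> {a..b}"
  shows "((\<lambda>l. V f (\<lambda>x. expo l x * \<psi> x) x / expo l x) \<longlongrightarrow> 0) at_top"
proof -
  have c: "continuous_on {a..x} (\<lambda>z. f (x, z) * \<psi> z)"
    by (rule V_integrand_continuous[OF f M_B1[OF \<psi>] x])
  then have "bounded ((\<lambda>z. f (x, z) * \<psi> z) ` {a..x})"
    by (intro compact_imp_bounded compact_continuous_image) auto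
  then have "\<exists>C. \<forall>z\<in>{a..x}. norm (f (x, z) * \<psi> z) \<le> C"
    by (auto simp: bounded_iff)
  then obtain C where C: "\<And>z. z \<in> {a..x} \<Longrightarrow> norm (f (x, z) * \<psi> z) \<le> C"
    by blast
  have bound: "norm (V f (\<lambda>x. expo l x * \<psi> x) x / expo l x) \<le> C * inverse l" if l: "l > 0" for l
  proof -
    have "((\<lambda>z. C * exp (l * z)) has_integral C * exp (l * x) / l - C * exp (l * a) / l) {a..x}"
      by (rule fundamental_theorem_of_calculus)
        (use x l in \<open>auto intro!: derivative_eq_intros simp flip: has_real_derivative_iff_has_vector_derivative\<close>)
    note I = this
    have "norm (integral {a..x} (\<lambda>z. f (x, z) * (expo l z * \<psi> z))) \<le> integral {a..x} (\<lambda>z. C * exp (l * z))"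
    proof (rule integral_norm_bound_integral)
      show "(\<lambda>z. f (x, z) * (expo l z * \<psi> z)) integrable_on {a..x}"
        by (intro integrable_continuous_real V_integrand_continuous f B1_mult expo_B1 M_B1 \<psi> x)
      show "(\<lambda>z. C * exp (l * z)) integrable_on {a..x}" using I by blast
      fix z assume z: "z \<in> {a..x}"
      have "norm (f (x, z) * (expo l z * \<psi> z)) = norm (f (x, z) * \<psi> z) * exp (l * z)"
        by (simp add: norm_mult expo_def)
      also have "\<dots> \<le> C * exp (l * z)" by (intro mult_right_mono C z) simp
      finally show "norm (f (x, z) * (expo l z * \<psi> z)) \<le> C * exp (l * z)" .
    qed
    also have "\<dots> = C * exp (l * x) / l - C * exp (l * a) / l" using I by (rule integral_unique)
    also have "\<dots> \<le> C * exp (l * x) / l"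
      using l x order_trans[OF norm_ge_zero C[of x]] by simp
    finally show ?thesis using x l by (simp add: V_def norm_divide expo_def field_simps)
  qed
  have "((\<lambda>l. C * inverse l) \<longlongrightarrow> C * 0) at_top"
    by (intro tendsto_mult tendsto_const tendsto_inverse_0_at_top filterlim_ident)
  then have "((\<lambda>l. C * inverse l) \<longlongrightarrow> 0) at_top" by simp
  with eventually_mono[OF eventually_gt_at_top[of "0::real"] bound] show ?thesis
    by (rule Lim_null_comparison)
qed

text \<open>Applied to \<open>expo l \<cdot> \<psi>\<close> at \<open>x\<close> and divided by \<open>l^n expo l x\<close>, the operator converges to \<open>P n x \<cdot> \<psi> x\<close>
as \<open>l\<close> grows. This settles \<open>x > a\<close>, where \<open>\<psi>\<close> can be chosen nonzero; continuity settles \<open>x = a\<close>.\<close>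

lemma IDO_zero_leading_coeff:
  assumes P: "\<And>i. P i \<in> B1 a b" and f: "f \<in> B2 a b"
    and z: "\<And>\<phi>. \<phi> \<in> M \<Longrightarrow> IDO n P f \<phi> = (\<lambda>_. 0)" and x: "x \<in> {a..b}"
  shows "P n x = 0"
proof -
  obtain \<psi> where \<psi>: "\<psi> \<in> M" "\<And>x. a < x \<Longrightarrow> x \<le> b \<Longrightarrow> \<psi> x \<noteq> 0" by (rule M_nonvanishing) blast
  have inner: "P n x = 0" if x: "a < x" "x \<le> b" for x
  proof -
    have inv: "((\<lambda>l. complex_of_real (inverse l) ^ k) \<longlongrightarrow> (if k = 0 then 1 else 0)) at_top" for k
    proof -
      have "((\<lambda>l. complex_of_real (inverse l) ^ k) \<longlongrightarrow> complex_of_real 0 ^ k) at_top"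
        by (intro tendsto_power tendsto_of_real tendsto_inverse_0_at_top filterlim_ident)
      then show ?thesis by (simp add: power_0_left)
    qed
    let ?d = "\<lambda>i l. (D ^^ i) (\<lambda>x. expo l x * \<psi> x) x"
    let ?v = "\<lambda>l. V f (\<lambda>x. expo l x * \<psi> x) x"
    have "((\<lambda>l. (\<Sum>i\<le>n. P i x * (complex_of_real (inverse l) ^ (n - i) * (?d i l / (expo l x * complex_of_real l ^ i)))) +
        ?v l / expo l x * complex_of_real (inverse l) ^ n) \<longlongrightarrow>
        (\<Sum>i\<le>n. P i x * ((if n - i = 0 then 1 else 0) * \<psi> x)) + 0 * (if n = 0 then 1 else 0)) at_top"
      by (intro tendsto_add tendsto_sum tendsto_mult tendsto_const inv Dn_expo_asymptotics V_expo_tendsto_0 f \<psi>(1))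
        (use x in auto)
    moreover have "(\<Sum>i\<le>n. P i x * ((if n - i = 0 then 1 else 0) * \<psi> x)) = (\<Sum>i\<le>n. if i = n then P n x * \<psi> x else 0)"
      by (rule sum.cong) auto
    ultimately have lim: "((\<lambda>l. (\<Sum>i\<le>n. P i x * (complex_of_real (inverse l) ^ (n - i) * (?d i l / (expo l x * complex_of_real l ^ i)))) +
        ?v l / expo l x * complex_of_real (inverse l) ^ n) \<longlongrightarrow> P n x * \<psi> x) at_top"
      by simp
    have "\<forall>\<^sub>F l in at_top. (\<Sum>i\<le>n. P i x * (complex_of_real (inverse l) ^ (n - i) * (?d i l / (expo l x * complex_of_real l ^ i)))) +
        ?v l / expo l x * complex_of_real (inverse l) ^ n = 0"
      using eventually_gt_at_top[of "0::real"]
    proof (rule eventually_mono)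
      fix l :: real assume l: "l > 0"
      have "(\<Sum>i\<le>n. P i x * (complex_of_real (inverse l) ^ (n - i) * (?d i l / (expo l x * complex_of_real l ^ i)))) =
          (\<Sum>i\<le>n. P i x * ?d i l) * (complex_of_real (inverse l) ^ n / expo l x)"
        unfolding sum_distrib_right
      proof (rule sum.cong)
        fix i assume "i \<in> {..n}"
        then have "complex_of_real (inverse l) ^ n = complex_of_real (inverse l) ^ (n - i) * complex_of_real (inverse l) ^ i"
          by (simp flip: power_add)
        then show "P i x * (complex_of_real (inverse l) ^ (n - i) * (?d i l / (expo l x * complex_of_real l ^ i))) =
            P i x * ?d i l * (complex_of_real (inverse l) ^ n / expo l x)"
          using l by (simp add: divide_inverse power_inverse)
      qed simp
      then have "(\<Sum>i\<le>n. P i x * (complex_of_real (inverse l) ^ (n - i) * (?d i l / (expo l x * complex_of_real l ^ i)))) +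
          ?v l / expo l x * complex_of_real (inverse l) ^ n =
          IDO n P f (\<lambda>x. expo l x * \<psi> x) x * (complex_of_real (inverse l) ^ n / expo l x)"
        by (simp add: IDO_def distrib_right add_divide_distrib)
      also have "IDO n P f (\<lambda>x. expo l x * \<psi> x) x = 0"
        by (simp add: z M_mult expo_B1 \<psi>(1))
      finally show "(\<Sum>i\<le>n. P i x * (complex_of_real (inverse l) ^ (n - i) * (?d i l / (expo l x * complex_of_real l ^ i)))) +
          ?v l / expo l x * complex_of_real (inverse l) ^ n = 0" by simp
    qed
    from tendsto_cong[THEN iffD1, OF this lim] have "((\<lambda>_. 0) \<longlongrightarrow> P n x * \<psi> x) (at_top :: real filter)" .
    then have "P n x * \<psi> x = 0" using tendsto_unique[OF trivial_limit_at_top_linorder _ tendsto_const] by metis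
    with \<psi>(2)[OF x] show ?thesis by simp
  qed
  have "continuous_on (closure {a<..b}) (P n)"
    using continuous_on_B1[OF P] ab by simp
  from continuous_constant_on_closure[OF this, of 0 x] inner x ab show ?thesis by auto
qed

lemma leads_unique:
  assumes "leads n c T" "leads n d T" "x \<in> {a..b}" shows "c x = d x"
proof -
  have "leads n (\<lambda>x. c x + -1 * d x) (\<lambda>\<phi> x. T \<phi> x + -1 * T \<phi> x)"
    by (intro leads_add leads_mult assms B1_const)
  then obtain P f where P: "\<And>i. P i \<in> B1 a b" "f \<in> B2 a b" "\<And>x. x \<in> {a..b} \<Longrightarrow> P n x = c x + -1 * d x"
    "\<And>\<phi>. \<phi> \<in> M \<Longrightarrow> (\<lambda>x. T \<phi> x + -1 * T \<phi> x) = IDO n P f \<phi>" by (elim leadsE) blast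
  then have "P n x = 0" using assms(3) by (intro IDO_zero_leading_coeff[of P f n]) simp_all
  with P(3)[OF assms(3)] show ?thesis by simp
qed

end

section \<open>Leading coefficients of mutually inverse operators\<close>

text \<open>The key step for products of polynomials over a ring without nilpotents, at one point: if all
products of total degree above \<open>r\<close> vanish, then a nonzero product of total degree \<open>r\<close> is the only
one. Any other pair has one index larger, and exchanging partners gives a product of degree above
\<open>r\<close> with a nonzero factor, so the other factor is zero.\<close>

lemma armendariz_single_term:
  fixes u v :: "nat \<Rightarrow> complex"
  assumes H: "\<And>i j. i \<le> N \<Longrightarrow> j \<le> N \<Longrightarrow> r < i + j \<Longrightarrow> u j * v i = 0"
    and ij: "i0 \<le> N" "j0 \<le> N" "i0 + j0 = r" and nz: "u j0 * v i0 \<noteq> 0"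
  shows "(\<Sum>j\<le>N. \<Sum>i\<le>N. if i + j = r then u j * v i else 0) = u j0 * v i0"
proof -
  have "(\<Sum>j\<le>N. \<Sum>i\<le>N. if i + j = r then u j * v i else 0) =
      (\<Sum>j\<le>N. \<Sum>i\<le>N. if j = j0 then (if i = i0 then u j0 * v i0 else 0) else 0)"
  proof (intro sum.cong refl)
    fix i j assume "j \<in> {..N}" "i \<in> {..N}"
    then have le: "i \<le> N" "j \<le> N" by auto
    show "(if i + j = r then u j * v i else 0) = (if j = j0 then (if i = i0 then u j0 * v i0 else 0) else 0)"
    proof (cases "i + j = r")
      case True
      consider "i = i0" "j = j0" | "i0 < i" | "j0 < j" using True ij by linarith
      then show ?thesis
      proof cases
        case 2
        then have "u j0 * v i = 0" using H[of i j0] le ij by simp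
        then show ?thesis using nz 2 by simp
      next
        case 3
        then have "u j * v i0 = 0" using H[of i0 j] le ij by simp
        then show ?thesis using nz 3 by simp
      qed (use ij in simp)
    qed (use ij in auto)
  qed
  also have "\<dots> = (\<Sum>j\<le>N. if j = j0 then u j0 * v i0 else 0)"
    by (rule sum.cong) (use ij in auto)
  also have "\<dots> = u j0 * v i0" using ij by simp
  finally show ?thesis .
qed

context nondegenerate_interval begin

text \<open>At a point where \<open>P\<close> vanishes, differentiating \<open>Q P = 0\<close> leaves \<open>Q P' = 0\<close>; elsewhere \<open>Q\<close> is zero.\<close>

lemma annihilates_derivative:
  assumes "P \<in> B1 a b" "Q \<in> B1 a b" "\<And>x. x \<in> {a..b} \<Longrightarrow> Q x * P x = 0" "x \<in> {a..b}"
  shows "Q x * D P x = 0"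
proof -
  have "D (\<lambda>x. Q x * P x) = D (\<lambda>_. 0)" by (rule D_cong) (rule assms(3))
  then have "Q x * D P x + D Q x * P x = 0"
    using fun_cong[OF D_mult[OF assms(2,1)], of x] by (simp add: D_const)
  moreover have "Q x = 0 \<or> P x = 0" using assms(3)[OF assms(4)] by simp
  ultimately show ?thesis by auto
qed

text \<open>By Leibniz' rule \<open>\<partial>^j\<close> composed with \<open>P\<close> has coefficients that are derivatives of \<open>P\<close>, all annihilated
by \<open>Q\<close>. So a vanishing product of leading coefficients makes the whole product of the two monomial
operators vanish, not only its top term.\<close>

lemma annihilates_Dn_mult:
  assumes "P \<in> B1 a b" "Q \<in> B1 a b" "\<And>x. x \<in> {a..b} \<Longrightarrow> Q x * P x = 0" "\<phi> \<in> M"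
  shows "(\<lambda>x. Q x * (D ^^ j) (\<lambda>x. P x * \<phi> x) x) = (\<lambda>x. 0)"
proof
  fix x
  show "Q x * (D ^^ j) (\<lambda>x. P x * \<phi> x) x = 0"
  proof (cases "x \<in> {a..b}")
    case True
    show ?thesis
      using assms(1,3,4)
    proof (induction j arbitrary: P \<phi>)
      case 0
      then show ?case using True by (auto simp del: atLeastAtMost_iff)
    next
      case (Suc j)
      have "(D ^^ Suc j) (\<lambda>x. P x * \<phi> x) = (D ^^ j) (\<lambda>x. P x * D \<phi> x + D P x * \<phi> x)"
        by (simp add: funpow_Suc_right D_mult Suc.prems M_B1 del: funpow.simps)
      also have "\<dots> = (\<lambda>x. (D ^^ j) (\<lambda>x. P x * D \<phi> x) x + (D ^^ j) (\<lambda>x. D P x * \<phi> x) x)"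
        by (intro Dn_add B1_mult B1_D M_B1 Suc.prems)
      finally have E: "(D ^^ Suc j) (\<lambda>x. P x * \<phi> x) =
          (\<lambda>x. (D ^^ j) (\<lambda>x. P x * D \<phi> x) x + (D ^^ j) (\<lambda>x. D P x * \<phi> x) x)" .
      have z1: "Q x * (D ^^ j) (\<lambda>x. P x * D \<phi> x) x = 0"
        by (intro Suc.IH Suc.prems M_D)
      have z2: "Q x * (D ^^ j) (\<lambda>x. D P x * \<phi> x) x = 0"
        by (intro Suc.IH B1_D Suc.prems annihilates_derivative[OF _ assms(2)])
      show ?case unfolding E distrib_left z1 z2 by simp
    qed
  next
    case False
    have "(D ^^ j) (\<lambda>x. P x * \<phi> x) \<in> M" by (intro M_Dn M_mult assms)
    then show ?thesis using M_outside[OF _ False] by simp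
  qed
qed

lemma Dn_sum:
  "(\<And>i. i \<in> S \<Longrightarrow> \<phi> i \<in> M) \<Longrightarrow> (D ^^ n) (\<lambda>x. \<Sum>i\<in>S. \<phi> i x) = (\<lambda>x. \<Sum>i\<in>S. (D ^^ n) (\<phi> i) x)"
  by (induction n) (simp_all add: D_sum M_Dn)

text \<open>In the product of two operators of order at most \<open>N\<close>, all contributions of the Volterra parts have
leading coefficient \<open>0\<close> in order \<open>N\<close>, so the coefficients of order \<open>r \<ge> N\<close> come from the differential
parts. Since the product is \<open>\<partial>^N\<close>, they are \<open>0\<close> for \<open>r > N\<close> and \<open>1\<close> for \<open>r = N\<close>. Smooth functions may
be zero divisors, but they are not nilpotent, and descending induction on \<open>r\<close> shows that
\<open>\<beta>\<^sub>j \<alpha>\<^sub>i = 0\<close> whenever \<open>i + j > N\<close>. Then the functions \<open>\<beta>\<^sub>N\<^sub>-\<^sub>i \<alpha>\<^sub>i\<close> take only the values \<open>0\<close> and \<open>1\<close>, and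
at each point exactly one of them is \<open>1\<close>. By connectedness of the interval it is the same one, of
index \<open>m\<close> say, everywhere, and then \<open>\<beta>\<^sub>N\<^sub>-\<^sub>m\<close> has no zeros, which forces \<open>\<alpha>\<^sub>i = 0\<close> for \<open>i > m\<close>.\<close>

lemma leading_coefficient_of_factor:
  assumes \<alpha>: "\<And>i. \<alpha> i \<in> B1 a b" and \<beta>: "\<And>i. \<beta> i \<in> B1 a b" and f: "f \<in> B2 a b" and g: "g \<in> B2 a b"
    and comp: "\<And>\<phi>. \<phi> \<in> M \<Longrightarrow> IDO N \<beta> g (IDO N \<alpha> f \<phi>) = (D ^^ N) \<phi>"
  obtains m where "m \<le> N" "\<And>x. x \<in> {a..b} \<Longrightarrow> \<alpha> m x \<noteq> 0"
    "\<And>i x. m < i \<Longrightarrow> i \<le> N \<Longrightarrow> x \<in> {a..b} \<Longrightarrow> \<alpha> i x = 0"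
proof -
  let ?s = "\<lambda>r x. \<Sum>j\<le>N. \<Sum>i\<le>N. if i + j = r then \<beta> j x * \<alpha> i x else 0"
  have coeff: "?s r x = (if r = N then 1 else 0)"
    if r: "N \<le> r" and H: "\<And>i j x. i \<le> N \<Longrightarrow> j \<le> N \<Longrightarrow> r < i + j \<Longrightarrow> x \<in> {a..b} \<Longrightarrow> \<beta> j x * \<alpha> i x = 0"
      and x: "x \<in> {a..b}" for r x
  proof -
    let ?t = "\<lambda>j i \<phi> x. \<beta> j x * (D ^^ j) (\<lambda>x. \<alpha> i x * (D ^^ i) \<phi> x) x"
    let ?u = "\<lambda>j \<phi> x. \<beta> j x * (D ^^ j) (V f \<phi>) x"
    have t: "leads r (\<lambda>x. if i + j = r then \<beta> j x * \<alpha> i x else 0) (?t j i)" if "i \<le> N" "j \<le> N" for i j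
    proof -
      have l: "leads (j + i) (\<lambda>x. \<beta> j x * \<alpha> i x) (?t j i)"
        by (intro leads_mult leads_Dn_left leads_mult_Dn \<alpha> \<beta>)
      consider "i + j < r" | "i + j = r" | "r < i + j" by linarith
      then show ?thesis
      proof cases
        case 1
        then show ?thesis using leads_lower[OF l, of r] by simp
      next
        case 2
        then show ?thesis using l by (simp add: add.commute)
      next
        case 3
        then have "?t j i \<phi> = (\<lambda>x. 0)" if "\<phi> \<in> M" for \<phi>
          using that H \<open>i \<le> N\<close> \<open>j \<le> N\<close> by (intro annihilates_Dn_mult \<alpha> \<beta> M_Dn) auto
        then show ?thesis using 3 by (intro leads_cong[OF leads_zero[of r]]) auto
      qed
    qed
    have u: "leads r (\<lambda>_. 0) (?u j)" if "j \<le> N" for j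
    proof -
      have "leads (j + 0) (\<lambda>x. \<beta> j x * 0) (?u j)"
        by (intro leads_mult leads_Dn_left leads_V f \<beta>)
      then show ?thesis using leads_zero_mono[of j "?u j" r] that r by simp
    qed
    have v: "leads r (\<lambda>_. 0) (\<lambda>\<phi>. V g (IDO N \<alpha> f \<phi>))"
      by (rule leads_zero_mono[OF leads_V_left[OF leadsI[of \<alpha> f N "\<alpha> N"] g] r]) (simp_all add: \<alpha> f)
    have "leads r (\<lambda>x. (?s r x + (\<Sum>j\<le>N. 0)) + 0)
        (\<lambda>\<phi> x. ((\<Sum>j\<le>N. \<Sum>i\<le>N. ?t j i \<phi> x) + (\<Sum>j\<le>N. ?u j \<phi> x)) + V g (IDO N \<alpha> f \<phi>) x)"
      by (intro leads_add leads_sum t u v) auto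
    then have 1: "leads r (?s r) (D ^^ N)"
    proof (rule leads_cong)
      fix \<phi> assume \<phi>: "\<phi> \<in> M"
      have "(D ^^ j) (IDO N \<alpha> f \<phi>) = (\<lambda>x. (\<Sum>i\<le>N. (D ^^ j) (\<lambda>x. \<alpha> i x * (D ^^ i) \<phi> x) x) + (D ^^ j) (V f \<phi>) x)" for j
      proof -
        have "(D ^^ j) (IDO N \<alpha> f \<phi>) = (\<lambda>x. (D ^^ j) (\<lambda>x. \<Sum>i\<le>N. \<alpha> i x * (D ^^ i) \<phi> x) x + (D ^^ j) (V f \<phi>) x)"
          unfolding IDO_def by (intro Dn_add M_B1 M_sum M_mult M_Dn V_M \<alpha> f \<phi>)
        then show ?thesis by (simp add: Dn_sum M_mult M_Dn \<alpha> \<phi>)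
      qed
      then show "(D ^^ N) \<phi> = (\<lambda>x. ((\<Sum>j\<le>N. \<Sum>i\<le>N. ?t j i \<phi> x) + (\<Sum>j\<le>N. ?u j \<phi> x)) + V g (IDO N \<alpha> f \<phi>) x)"
        unfolding comp[OF \<phi>, symmetric] IDO_def[of N \<beta>]
        by (simp add: distrib_left sum_distrib_left sum.distrib)
    qed simp
    show ?thesis
    proof (cases "r = N")
      case True
      then show ?thesis using leads_unique[OF 1 _ x, of "\<lambda>_. 1"] leads_Dn[of N] by simp
    next
      case False
      then show ?thesis using leads_unique[OF 1 leads_lower[OF leads_Dn[of N]] x] r by simp
    qed
  qed
  have Hr: "\<forall>i j x. i \<le> N \<longrightarrow> j \<le> N \<longrightarrow> r < i + j \<longrightarrow> x \<in> {a..b} \<longrightarrow> \<beta> j x * \<alpha> i x = 0" if "N \<le> r" "r \<le> N + N" for r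
    using that(2,1)
  proof (induction r rule: inc_induct)
    case base
    then show ?case by auto
  next
    case (step r)
    show ?case
    proof (intro allI impI)
      fix i j x assume ij: "i \<le> N" "j \<le> N" "r < i + j" and x: "x \<in> {a..b}"
      show "\<beta> j x * \<alpha> i x = 0"
      proof (cases "Suc r = i + j")
        case True
        show ?thesis
        proof (rule ccontr)
          assume nz: "\<beta> j x * \<alpha> i x \<noteq> 0"
          have "?s (Suc r) x = \<beta> j x * \<alpha> i x"
            using step.IH step.prems ij x nz True by (intro armendariz_single_term) auto
          moreover have "?s (Suc r) x = 0"
            using coeff[of "Suc r" x] step.IH step.prems x by auto
          ultimately show False using nz by simp
        qed
      next
        case False
        then show ?thesis using step.IH step.prems ij x by auto
      qed
    qed
  qed
  have H: "\<beta> j x * \<alpha> i x = 0" if "i \<le> N" "j \<le> N" "N < i + j" "x \<in> {a..b}" for i j x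
    by (rule Hr[of N, rule_format]) (use that in auto)
  let ?e = "\<lambda>i x. \<beta> (N - i) x * \<alpha> i x"
  have s1: "?s N x = 1" if "x \<in> {a..b}" for x using coeff[of N x] H that by simp
  have e01: "?e i x = 0 \<or> ?e i x = 1" if "i \<le> N" "x \<in> {a..b}" for i x
    using armendariz_single_term[of N N "\<lambda>j. \<beta> j x" "\<lambda>i. \<alpha> i x" i "N - i"] H s1 that by auto
  have "\<exists>m\<le>N. ?e m a \<noteq> 0"
  proof (rule ccontr)
    assume "\<not> (\<exists>m\<le>N. ?e m a \<noteq> 0)"
    then have "?s N a = 0" by (intro sum.neutral ballI) auto
    then show False using s1[of a] ab by simp
  qed
  then obtain m where m: "m \<le> N" "?e m a \<noteq> 0" by blast
  have "?e m constant_on {a..b}"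
  proof (rule continuous_finite_range_constant)
    show "continuous_on {a..b} (?e m)" by (intro continuous_intros continuous_on_B1 \<alpha> \<beta>)
    have "?e m ` {a..b} \<subseteq> {0, 1}" using e01[OF m(1)] by blast
    then show "finite (?e m ` {a..b})" by (rule finite_subset) simp
  qed simp
  then obtain v where v: "\<And>x. x \<in> {a..b} \<Longrightarrow> ?e m x = v" unfolding constant_on_def by blast
  have e: "?e m x \<noteq> 0" if "x \<in> {a..b}" for x
    using m(2) v[OF that] v[of a] ab by simp
  show thesis
  proof (rule that[OF m(1)])
    show "\<alpha> m x \<noteq> 0" if "x \<in> {a..b}" for x using e[OF that] by auto
    show "\<alpha> i x = 0" if "m < i" "i \<le> N" "x \<in> {a..b}" for i x
      using H[of i "N - m" x] e[OF that(3)] that m(1) by auto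
  qed
qed

text \<open>Types 1, 2 and 3 at once.\<close>

definition elliptic :: "oper \<Rightarrow> bool" where
  "elliptic T \<longleftrightarrow> (\<exists>n P f. (\<forall>i. P i \<in> B1 a b) \<and> P n \<in> B1_plus a b \<and> f \<in> B2 a b \<and>
     (\<forall>\<phi>\<in>M. T \<phi> = IDO n P f \<phi>))"

text \<open>Multiplying by \<open>\<partial>^p\<close> on the outer sides of \<open>S T = 1\<close> makes room for the Volterra parts: the factors
\<open>\<partial>^p S\<close> and \<open>T \<partial>^p\<close> have order at most \<open>2 p\<close> and product \<open>\<partial>^(2 p)\<close>. The coefficients of \<open>T \<partial>^p\<close> from
order \<open>p\<close> on are those of \<open>T\<close>, so its exact order \<open>m\<close> tells whether \<open>T\<close> is elliptic, of order \<open>m - p\<close>,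
or has no differential part at all.\<close>

lemma left_invertible_imp_elliptic_or_Volterra:
  assumes P: "\<And>i. P i \<in> B1 a b" and f: "f \<in> B2 a b"
    and S: "leads p d S" and ST: "\<And>\<phi>. \<phi> \<in> M \<Longrightarrow> S (IDO p P f \<phi>) = \<phi>"
  shows "elliptic (IDO p P f) \<or> (\<forall>\<phi>\<in>M. IDO p P f \<phi> = V f \<phi>)"
proof -
  obtain R f' where R: "\<And>i. R i \<in> B1 a b" "f' \<in> B2 a b" "\<And>x. x \<in> {a..b} \<Longrightarrow> R p x = 0"
    "\<And>\<phi>. \<phi> \<in> M \<Longrightarrow> V f ((D ^^ p) \<phi>) = IDO p R f' \<phi>"
    using leads_V_Dn[OF f, of p] by (elim leadsE) blast
  obtain \<beta> g where \<beta>: "\<And>i. \<beta> i \<in> B1 a b" "g \<in> B2 a b"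
    "\<And>\<phi>. \<phi> \<in> M \<Longrightarrow> (D ^^ p) (S \<phi>) = IDO (p + p) \<beta> g \<phi>"
    using leads_Dn_left[OF S, of p] by (elim leadsE) blast
  \<comment> \<open>The coefficients of \<open>T \<partial>^p\<close>: below order \<open>p\<close> they come from \<open>f \<theta> \<partial>^p\<close>, from there on from \<open>T\<close>.\<close>
  define \<alpha> where "\<alpha> i = (if i < p then R i else P (i - p))" for i
  have \<alpha>: "\<alpha> i \<in> B1 a b" for i by (simp add: \<alpha>_def P R)
  have A: "IDO (p + p) \<alpha> f' \<phi> = IDO p P f ((D ^^ p) \<phi>)" if \<phi>: "\<phi> \<in> M" for \<phi>
  proof
    fix x
    have Rp: "R p x * (D ^^ p) \<phi> x = 0"
      using R(3)[of x] M_outside[OF M_Dn[OF \<phi>], of x p] by (cases "x \<in> {a..b}") auto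
    have "(\<Sum>i\<le>p + p. \<alpha> i x * (D ^^ i) \<phi> x) = (\<Sum>i<p. \<alpha> i x * (D ^^ i) \<phi> x) + (\<Sum>i\<in>{p..p + p}. \<alpha> i x * (D ^^ i) \<phi> x)"
      by (subst sum.union_disjoint[symmetric]) (auto intro!: sum.cong)
    also have "(\<Sum>i\<in>{p..p + p}. \<alpha> i x * (D ^^ i) \<phi> x) = (\<Sum>i\<le>p. P i x * (D ^^ i) ((D ^^ p) \<phi>) x)"
      by (rule sum.reindex_bij_witness[of _ "\<lambda>i. i + p" "\<lambda>i. i - p"]) (auto simp: \<alpha>_def simp flip: funpow_add[unfolded o_def, THEN fun_cong])
    also have "(\<Sum>i<p. \<alpha> i x * (D ^^ i) \<phi> x) = (\<Sum>i\<le>p. R i x * (D ^^ i) \<phi> x)"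
      using Rp by (simp add: \<alpha>_def flip: lessThan_Suc_atMost)
    finally show "IDO (p + p) \<alpha> f' \<phi> x = IDO p P f ((D ^^ p) \<phi>) x"
      using fun_cong[OF R(4)[OF \<phi>], of x] by (simp add: IDO_def)
  qed
  have "IDO (p + p) \<beta> g (IDO (p + p) \<alpha> f' \<phi>) = (D ^^ (p + p)) \<phi>" if \<phi>: "\<phi> \<in> M" for \<phi>
  proof -
    have "IDO (p + p) \<beta> g (IDO (p + p) \<alpha> f' \<phi>) = (D ^^ p) (S (IDO p P f ((D ^^ p) \<phi>)))"
      unfolding A[OF \<phi>] by (rule \<beta>(3)[symmetric]) (intro IDO_M P f M_Dn \<phi>)
    also have "\<dots> = (D ^^ (p + p)) \<phi>" by (simp add: ST M_Dn \<phi> funpow_add)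
    finally show ?thesis .
  qed
  from leading_coefficient_of_factor[OF \<alpha> \<beta>(1) R(2) \<beta>(2) this]
  obtain m where m: "m \<le> p + p" "\<And>x. x \<in> {a..b} \<Longrightarrow> \<alpha> m x \<noteq> 0"
    "\<And>i x. m < i \<Longrightarrow> i \<le> p + p \<Longrightarrow> x \<in> {a..b} \<Longrightarrow> \<alpha> i x = 0" by metis
  have Pz: "P i x * (D ^^ i) \<phi> x = 0" if "m < i + p" "i \<le> p" "\<phi> \<in> M" for i x \<phi>
    using m(3)[of "i + p" x] that M_outside[OF M_Dn[OF that(3)], of x i]
    by (cases "x \<in> {a..b}") (auto simp: \<alpha>_def)
  show ?thesis
  proof (cases "m < p")
    case True
    have "IDO p P f \<phi> = V f \<phi>" if "\<phi> \<in> M" for \<phi>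
    proof -
      have "(\<Sum>i\<le>p. P i x * (D ^^ i) \<phi> x) = 0" for x
        by (intro sum.neutral ballI Pz that) (use True in auto)
      then show ?thesis by (simp add: IDO_def)
    qed
    then show ?thesis by blast
  next
    case False
    have "IDO p P f \<phi> = IDO (m - p) P f \<phi>" if "\<phi> \<in> M" for \<phi>
    proof -
      have "(\<Sum>i\<le>p. P i x * (D ^^ i) \<phi> x) = (\<Sum>i\<le>m - p. P i x * (D ^^ i) \<phi> x)" for x
      proof (rule sum.mono_neutral_right)
        show "\<forall>i\<in>{..p} - {..m - p}. P i x * (D ^^ i) \<phi> x = 0"
          by (intro ballI Pz that) (use False in auto)
      qed (use m(1) in auto)
      then show ?thesis by (simp add: IDO_def)
    qed
    moreover have "P (m - p) \<in> B1_plus a b" using P m(2) False by (simp add: B1_plus_def \<alpha>_def)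
    ultimately show ?thesis unfolding elliptic_def using P f by blast
  qed
qed

text \<open>Two Volterra operators cannot be mutually inverse, because their composition is a Volterra operator
and the identity is not one. So the preceding alternative resolves to ellipticity for at least one
of the two; for the pair \<open>\<partial>\<close>, \<open>\<theta>\<close> it does so only for the first.\<close>

lemma inverse_pair_elliptic:
  assumes "leads n c T" "leads m d S"
    and ST: "\<And>\<phi>. \<phi> \<in> M \<Longrightarrow> S (T \<phi>) = \<phi>" and TS: "\<And>\<phi>. \<phi> \<in> M \<Longrightarrow> T (S \<phi>) = \<phi>"
  shows "elliptic T \<or> elliptic S"
proof -
  define p where "p = Suc (max n m)"
  have T: "leads p (\<lambda>_. 0) T" and S: "leads p (\<lambda>_. 0) S"
    using leads_lower[OF assms(1)] leads_lower[OF assms(2)] by (simp_all add: p_def)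
  obtain P f where P: "\<And>i. P i \<in> B1 a b" "f \<in> B2 a b" "\<And>\<phi>. \<phi> \<in> M \<Longrightarrow> T \<phi> = IDO p P f \<phi>"
    using T by (elim leadsE) blast
  obtain Q g where Q: "\<And>i. Q i \<in> B1 a b" "g \<in> B2 a b" "\<And>\<phi>. \<phi> \<in> M \<Longrightarrow> S \<phi> = IDO p Q g \<phi>"
    using S by (elim leadsE) blast
  have el: "elliptic (IDO p P f) \<Longrightarrow> elliptic T" "elliptic (IDO p Q g) \<Longrightarrow> elliptic S"
    unfolding elliptic_def using P(3) Q(3) by metis+
  have "\<not> ((\<forall>\<phi>\<in>M. IDO p P f \<phi> = V f \<phi>) \<and> (\<forall>\<phi>\<in>M. IDO p Q g \<phi> = V g \<phi>))"
  proof
    assume "(\<forall>\<phi>\<in>M. IDO p P f \<phi> = V f \<phi>) \<and> (\<forall>\<phi>\<in>M. IDO p Q g \<phi> = V g \<phi>)"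
    then have "V (star f g) \<phi> = \<phi>" if "\<phi> \<in> M" for \<phi>
      using TS[OF that] that P(3) Q(3) V_V[OF P(2) Q(2)] V_M[OF Q(2)] by simp
    then have "leads 0 (\<lambda>_. 0) (D ^^ 0)"
      by (intro leads_cong[OF leads_V[OF B2_star[OF P(2) Q(2)], of 0]]) auto
    from leads_unique[OF this leads_Dn, of a] show False using ab by simp
  qed
  moreover have "elliptic (IDO p P f) \<or> (\<forall>\<phi>\<in>M. IDO p P f \<phi> = V f \<phi>)"
    by (rule left_invertible_imp_elliptic_or_Volterra[OF P(1,2) S]) (simp add: ST flip: P(3))
  moreover have "elliptic (IDO p Q g) \<or> (\<forall>\<phi>\<in>M. IDO p Q g \<phi> = V g \<phi>)"
    by (rule left_invertible_imp_elliptic_or_Volterra[OF Q(1,2) T]) (simp add: TS flip: Q(3))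
  ultimately show ?thesis using el by blast
qed

section \<open>Inverses of operators with nonvanishing leading coefficient\<close>

text \<open>Writing \<open>c + f \<theta> = c (1 - g \<theta>)\<close> with \<open>g = - f / c\<close>, the inverse is \<open>(1 + r \<theta>) (1 / c)\<close> for the resolvent
\<open>r\<close> of \<open>g\<close>; composing \<open>r \<theta>\<close> with \<open>1 / c\<close> multiplies the kernel by \<open>1 / c\<close> in the inner variable.\<close>

lemma order_zero_invertible:
  assumes c: "c \<in> B1_plus a b" and f: "f \<in> B2 a b"
  obtains q r where "q \<in> B1 a b" "r \<in> B2 a b"
    "\<And>\<phi>. \<phi> \<in> M \<Longrightarrow> (\<lambda>x. c x * (\<lambda>x. q x * \<phi> x + V r \<phi> x) x + V f (\<lambda>x. q x * \<phi> x + V r \<phi> x) x) = \<phi>"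
    "\<And>\<phi>. \<phi> \<in> M \<Longrightarrow> (\<lambda>x. q x * (\<lambda>x. c x * \<phi> x + V f \<phi> x) x + V r (\<lambda>x. c x * \<phi> x + V f \<phi> x) x) = \<phi>"
proof -
  define q where "q x = inverse (c x)" for x
  have q: "q \<in> B1 a b" using B1_inverse[OF c] by (simp add: q_def[abs_def])
  have cB: "c \<in> B1 a b" using c by (simp add: B1_plus_def)
  have qc: "q x * c x = 1" if "x \<in> {a..b}" for x using c that by (simp add: B1_plus_def q_def)
  have qc\<phi>: "q x * (c x * \<phi> x) = \<phi> x" if "\<phi> \<in> M" for \<phi> x
    using qc[of x] M_outside[OF that, of x] by (cases "x \<in> {a..b}") (auto simp: mult.assoc[symmetric])
  define g where "g p = - q (fst p) * f p" for p
  have g: "g \<in> B2 a b" unfolding g_def[abs_def] using B2_mult[OF B2_minus[OF lift_fst_B2[OF q]] f] by simp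
  have Vf: "V f \<phi> x = - (c x * V g \<phi> x)" if "\<phi> \<in> M" for \<phi> x
  proof -
    have "V g \<phi> x = - (q x * V f \<phi> x)" using V_mult_kernel[of "\<lambda>x. - q x" f \<phi>] by (simp add: g_def[abs_def])
    then show ?thesis using qc\<phi>[OF V_M[OF f that], of x] by (simp add: mult.left_commute)
  qed
  obtain r where r: "r \<in> B2 a b"
    "\<And>x y. a \<le> y \<Longrightarrow> y \<le> x \<Longrightarrow> x \<le> b \<Longrightarrow> r (x, y) = g (x, y) + star g r (x, y)"
    "\<And>x y. a \<le> y \<Longrightarrow> y \<le> x \<Longrightarrow> x \<le> b \<Longrightarrow> r (x, y) = g (x, y) + star r g (x, y)"
    by (rule smooth_resolvent[OF g less_imp_le[OF ab]]) blast
  have Vr1: "V r \<phi> = (\<lambda>x. V g \<phi> x + V g (V r \<phi>) x)" if "\<phi> \<in> M" for \<phi>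
    using V_cong_kernel[of r "\<lambda>p. g p + star g r p" \<phi>] r(2)
      V_add_kernel[OF g B2_star[OF g r(1)] that] V_V[OF g r(1) that] by simp
  have Vr2: "V r \<phi> = (\<lambda>x. V g \<phi> x + V r (V g \<phi>) x)" if "\<phi> \<in> M" for \<phi>
    using V_cong_kernel[of r "\<lambda>p. g p + star r g p" \<phi>] r(3)
      V_add_kernel[OF g B2_star[OF r(1) g] that] V_V[OF r(1) g that] by simp
  show thesis
  proof (rule that[OF q, of "\<lambda>p. r p * q (snd p)"])
    show "(\<lambda>p. r p * q (snd p)) \<in> B2 a b" by (intro B2_mult r lift_snd_B2 q)
    fix \<phi> assume \<phi>: "\<phi> \<in> M"
    let ?V = "V (\<lambda>p. r p * q (snd p))"
    have V: "?V \<psi> = V r (\<lambda>x. q x * \<psi> x)" for \<psi> by (rule V_mult[symmetric])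
    let ?\<psi> = "\<lambda>x. q x * \<phi> x"
    have \<psi>: "?\<psi> \<in> M" by (intro M_mult q \<phi>)
    have w: "(\<lambda>x. ?\<psi> x + V r ?\<psi> x) \<in> M" by (intro M_add \<psi> V_M r)
    show "(\<lambda>x. c x * (\<lambda>x. q x * \<phi> x + ?V \<phi> x) x + V f (\<lambda>x. q x * \<phi> x + ?V \<phi> x) x) = \<phi>"
    proof
      fix x
      have "c x * (?\<psi> x + V r ?\<psi> x) + V f (\<lambda>x. ?\<psi> x + V r ?\<psi> x) x =
          c x * (?\<psi> x + V r ?\<psi> x - V g (\<lambda>x. ?\<psi> x + V r ?\<psi> x) x)"
        unfolding Vf[OF w] by (simp add: right_diff_distrib)
      also have "V g (\<lambda>x. ?\<psi> x + V r ?\<psi> x) x = V g ?\<psi> x + V g (V r ?\<psi>) x"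
        using V_add[OF g \<psi> V_M[OF r(1) \<psi>]] by simp
      also have "\<dots> = V r ?\<psi> x" using fun_cong[OF Vr1[OF \<psi>], of x] by simp
      also have "c x * (?\<psi> x + V r ?\<psi> x - V r ?\<psi> x) = \<phi> x" using qc\<phi>[OF \<phi>, of x] by (simp add: mult.left_commute)
      finally show "c x * (\<lambda>x. q x * \<phi> x + ?V \<phi> x) x + V f (\<lambda>x. q x * \<phi> x + ?V \<phi> x) x = \<phi> x"
        by (simp add: V)
    qed
    show "(\<lambda>x. q x * (\<lambda>x. c x * \<phi> x + V f \<phi> x) x + ?V (\<lambda>x. c x * \<phi> x + V f \<phi> x) x) = \<phi>"
    proof
      fix x
      have u: "(\<lambda>x. q x * (c x * \<phi> x + V f \<phi> x)) = (\<lambda>x. \<phi> x + -1 * V g \<phi> x)"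
      proof
        show "q x * (c x * \<phi> x + V f \<phi> x) = \<phi> x + -1 * V g \<phi> x" for x
          unfolding Vf[OF \<phi>] distrib_left mult_minus_right qc\<phi>[OF \<phi>] qc\<phi>[OF V_M[OF g \<phi>]] by simp
      qed
      have mg: "(\<lambda>x. -1 * V g \<phi> x) \<in> M" by (intro M_mult B1_const V_M g \<phi>)
      have "V r (\<lambda>x. \<phi> x + -1 * V g \<phi> x) x = V r \<phi> x + V r (\<lambda>x. -1 * V g \<phi> x) x"
        using V_add[OF r(1) \<phi> mg] by simp
      also have "V r (\<lambda>x. -1 * V g \<phi> x) x = - V r (V g \<phi>) x"
        by (simp add: V_def)
      finally have "V r (\<lambda>x. \<phi> x + -1 * V g \<phi> x) x = V g \<phi> x"
        using fun_cong[OF Vr2[OF \<phi>], of x] by simp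
      then show "q x * (\<lambda>x. c x * \<phi> x + V f \<phi> x) x + ?V (\<lambda>x. c x * \<phi> x + V f \<phi> x) x = \<phi> x"
        unfolding V u using fun_cong[OF u, of x] by simp
    qed
  qed
qed

text \<open>Factors \<open>\<theta>\<close> on the right lower the order to zero without changing the leading coefficient; since
\<open>\<theta>\<close> is invertible on \<open>M\<close>, an inverse of \<open>T \<theta>\<close> gives one of \<open>T\<close>.\<close>

lemma nonvanishing_leads_invertible:
  assumes "leads n c T" "c \<in> B1_plus a b"
  shows "\<exists>m d S. leads m d S \<and> (\<forall>\<phi>\<in>M. S (T \<phi>) = \<phi> \<and> T (S \<phi>) = \<phi>)"
  using assms(1)
proof (induction n arbitrary: T)
  case 0
  obtain P f where P: "\<And>i. P i \<in> B1 a b" "f \<in> B2 a b" "\<And>x. x \<in> {a..b} \<Longrightarrow> P 0 x = c x"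
    "\<And>\<phi>. \<phi> \<in> M \<Longrightarrow> T \<phi> = IDO 0 P f \<phi>" using "0.prems" by (elim leadsE) blast
  have "P 0 \<in> B1_plus a b" using P(1,3) assms(2) by (simp add: B1_plus_def)
  then obtain q r where q: "q \<in> B1 a b" and r: "r \<in> B2 a b" and
    i1: "\<And>\<phi>. \<phi> \<in> M \<Longrightarrow> (\<lambda>x. P 0 x * (\<lambda>x. q x * \<phi> x + V r \<phi> x) x + V f (\<lambda>x. q x * \<phi> x + V r \<phi> x) x) = \<phi>" and
    i2: "\<And>\<phi>. \<phi> \<in> M \<Longrightarrow> (\<lambda>x. q x * (\<lambda>x. P 0 x * \<phi> x + V f \<phi> x) x + V r (\<lambda>x. P 0 x * \<phi> x + V f \<phi> x) x) = \<phi>"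
    by (rule order_zero_invertible[OF _ P(2)]) blast
  let ?S = "\<lambda>\<phi> x. q x * \<phi> x + V r \<phi> x"
  have "leads 0 q ?S"
    by (rule leadsI[of "\<lambda>_. q" r]) (simp_all add: q r IDO_def)
  moreover have "?S (T \<phi>) = \<phi> \<and> T (?S \<phi>) = \<phi>" if "\<phi> \<in> M" for \<phi>
    using i1[OF that] i2[OF that] leads_M[OF \<open>leads 0 q ?S\<close> that] P(4)[OF that] P(4)[of "?S \<phi>"]
    by (simp add: IDO_def)
  ultimately show ?case by blast
next
  case (Suc n)
  from Suc.IH[OF leads_V_one_right[OF Suc.prems]] obtain m d S where S: "leads m d S"
    "\<And>\<phi>. \<phi> \<in> M \<Longrightarrow> S (T (V (\<lambda>_. 1) \<phi>)) = \<phi>" "\<And>\<phi>. \<phi> \<in> M \<Longrightarrow> T (V (\<lambda>_. 1) (S \<phi>)) = \<phi>" by blast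
  have "leads m (\<lambda>_. 0) (\<lambda>\<phi>. V (\<lambda>_. 1) (S \<phi>))" by (rule leads_V_left[OF S(1) B2_const])
  moreover have "V (\<lambda>_. 1) (S (T \<phi>)) = \<phi>" if "\<phi> \<in> M" for \<phi>
    using S(2)[OF M_D[OF that]] by (simp add: V_one_D that)
  ultimately show ?case using S(3) by blast
qed

end

section \<open>The algebra generated by the operators and its units\<close>

context nondegenerate_interval begin

abbreviation generators :: "oper set" where
  "generators \<equiv> mult_op a b ` B1 a b \<union> {deriv_op a b} \<union> volterra_op a b ` B2 a b"

abbreviation alg :: "oper set" where
  "alg \<equiv> gen_subalgebra (End_M a b) generators"

lemma volterra_op_eq: "\<phi> \<in> M \<Longrightarrow> volterra_op a b f \<phi> = V f \<phi>"
  by (simp add: volterra_op_def V_def)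

lemma extensional_End_M:
  "\<one>\<^bsub>End_M a b\<^esub> \<in> extensional M" "u \<oplus>\<^bsub>End_M a b\<^esub> v \<in> extensional M"
  "u \<otimes>\<^bsub>End_M a b\<^esub> v \<in> extensional M" "k \<odot>\<^bsub>End_M a b\<^esub> u \<in> extensional M"
  by (simp_all add: End_M_def extensional_def compose_def)

text \<open>The property that left multiplication by \<open>u\<close> preserves integro-differential operators is inherited
by products for trivial reasons, so it needs a proof only for generators \<open>u\<close>. Applied to the
identity it gives the normal form of the elements of the algebra.\<close>

lemma alg_preserves_leads:
  assumes "u \<in> alg"
  shows "u \<in> extensional M" "\<exists>n c. leads n c v \<Longrightarrow> \<exists>n c. leads n c (\<lambda>\<phi>. u (v \<phi>))"
proof -
  have "u \<in> extensional M \<and> (\<forall>v. (\<exists>n c. leads n c v) \<longrightarrow> (\<exists>n c. leads n c (\<lambda>\<phi>. u (v \<phi>))))"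
    using assms
  proof induction
    case one
    have "leads n c (\<lambda>\<phi>. \<one>\<^bsub>End_M a b\<^esub> (v \<phi>))" if "leads n c v" for n c v
      by (rule leads_cong[OF that]) (simp_all add: End_M_def leads_M[OF that])
    then show ?case by (intro conjI extensional_End_M(1)) blast
  next
    case (incl s)
    then consider P where "P \<in> B1 a b" "s = mult_op a b P" | "s = deriv_op a b"
      | f where "f \<in> B2 a b" "s = volterra_op a b f" by blast
    then show ?case
    proof cases
      case 1
      have "leads n (\<lambda>x. P x * c x) (\<lambda>\<phi>. s (v \<phi>))" if "leads n c v" for n c v
        by (rule leads_cong[OF leads_mult[OF 1(1) that]]) (simp_all add: 1 mult_op_def leads_M[OF that])
      moreover have "s \<in> extensional M" by (simp add: 1 mult_op_def extensional_def)
      ultimately show ?thesis by blast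
    next
      case 2
      have "leads (Suc n) c (\<lambda>\<phi>. s (v \<phi>))" if "leads n c v" for n c v
        by (rule leads_cong[OF leads_D_left[OF that]]) (simp_all add: 2 deriv_op_def leads_M[OF that])
      moreover have "s \<in> extensional M" by (simp add: 2 deriv_op_def extensional_def)
      ultimately show ?thesis by blast
    next
      case 3
      have "leads n (\<lambda>_. 0) (\<lambda>\<phi>. s (v \<phi>))" if "leads n c v" for n c v
        by (rule leads_cong[OF leads_V_left[OF that 3(1)]]) (simp_all add: 3 volterra_op_eq leads_M[OF that])
      moreover have "s \<in> extensional M" by (simp add: 3 volterra_op_def extensional_def)
      ultimately show ?thesis by blast
    qed
  next
    case (add u w)
    have "\<exists>n c. leads n c (\<lambda>\<phi>. (u \<oplus>\<^bsub>End_M a b\<^esub> w) (v \<phi>))" if v: "leads k e v" for k e v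
    proof -
      obtain n c m d where l: "leads n c (\<lambda>\<phi>. u (v \<phi>))" "leads m d (\<lambda>\<phi>. w (v \<phi>))"
        using add.IH v by blast
      have "leads (Suc (max n m)) (\<lambda>x. 0 + 0) (\<lambda>\<phi> x. u (v \<phi>) x + w (v \<phi>) x)"
        by (rule leads_add[OF leads_lower[OF l(1)] leads_lower[OF l(2)]]) auto
      then have "leads (Suc (max n m)) (\<lambda>x. 0 + 0) (\<lambda>\<phi>. (u \<oplus>\<^bsub>End_M a b\<^esub> w) (v \<phi>))"
        by (rule leads_cong) (simp_all add: End_M_def leads_M[OF v])
      then show ?thesis by blast
    qed
    then show ?case by (intro conjI extensional_End_M(2)) blast
  next
    case (mult u w)
    have "\<exists>n c. leads n c (\<lambda>\<phi>. (u \<otimes>\<^bsub>End_M a b\<^esub> w) (v \<phi>))" if v: "leads k e v" for k e v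
    proof -
      obtain n c where l: "leads n c (\<lambda>\<phi>. u (w (v \<phi>)))"
        using mult.IH v by blast
      have "leads n c (\<lambda>\<phi>. (u \<otimes>\<^bsub>End_M a b\<^esub> w) (v \<phi>))"
        by (rule leads_cong[OF l]) (simp_all add: End_M_def compose_def leads_M[OF v])
      then show ?thesis by blast
    qed
    then show ?case by (intro conjI extensional_End_M(3)) blast
  next
    case (smult u k)
    have "\<exists>n c. leads n c (\<lambda>\<phi>. (k \<odot>\<^bsub>End_M a b\<^esub> u) (v \<phi>))" if v: "leads m e v" for m e v
    proof -
      obtain n c where l: "leads n c (\<lambda>\<phi>. u (v \<phi>))"
        using smult.IH v by blast
      have "leads n (\<lambda>x. k * c x) (\<lambda>\<phi>. (k \<odot>\<^bsub>End_M a b\<^esub> u) (v \<phi>))"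
        by (rule leads_cong[OF leads_mult[OF B1_const l]]) (simp_all add: End_M_def leads_M[OF v])
      then show ?thesis by blast
    qed
    then show ?case by (intro conjI extensional_End_M(4)) blast
  qed
  then show "u \<in> extensional M" "\<exists>n c. leads n c v \<Longrightarrow> \<exists>n c. leads n c (\<lambda>\<phi>. u (v \<phi>))" by blast+
qed

lemma alg_leads: assumes "u \<in> alg" shows "\<exists>n c. leads n c u"
proof -
  have "\<exists>n c. leads n c (\<lambda>\<phi>. \<phi>)" using leads_Dn[of 0] by (auto simp: id_def)
  from alg_preserves_leads(2)[OF assms this] show ?thesis by simp
qed

lemma diff_op_alg: "(\<And>i. i \<le> n \<Longrightarrow> P i \<in> B1 a b) \<Longrightarrow> diff_op a b n P \<in> alg"
proof (induction n)
  case 0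
  have "diff_op a b 0 P = mult_op a b (P 0)" by (simp add: diff_op_def mult_op_def)
  then show ?case using 0 by (auto intro: gen_subalgebra.incl)
next
  case (Suc n)
  have pow: "restrict (D ^^ k) M \<in> alg" for k
  proof (induction k)
    case 0
    have "restrict (D ^^ 0) M = \<one>\<^bsub>End_M a b\<^esub>" by (auto simp: End_M_def restrict_def)
    then show ?case using gen_subalgebra.one by metis
  next
    case (Suc k)
    have dv: "deriv_op a b \<in> alg" by (rule gen_subalgebra.incl) simp
    have E: "restrict (D ^^ Suc k) M = deriv_op a b \<otimes>\<^bsub>End_M a b\<^esub> restrict (D ^^ k) M"
      by (auto simp: End_M_def compose_def deriv_op_def M_Dn restrict_def)
    show ?case unfolding E by (rule gen_subalgebra.mult[OF dv Suc])
  qed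
  have "diff_op a b (Suc n) P = diff_op a b n P \<oplus>\<^bsub>End_M a b\<^esub>
      (mult_op a b (P (Suc n)) \<otimes>\<^bsub>End_M a b\<^esub> restrict (D ^^ Suc n) M)"
    by (auto simp: End_M_def compose_def diff_op_def mult_op_def M_Dn M_D restrict_def)
  moreover have "\<dots> \<in> alg"
    by (intro gen_subalgebra.add gen_subalgebra.mult pow Suc.IH gen_subalgebra.incl) (use Suc.prems in auto)
  ultimately show ?case by simp
qed

lemma volterra_op_alg: "f \<in> B2 a b \<Longrightarrow> volterra_op a b f \<in> alg"
  by (auto intro: gen_subalgebra.incl)

lemma mult_op_alg: "P \<in> B1 a b \<Longrightarrow> mult_op a b P \<in> alg"
  by (auto intro: gen_subalgebra.incl)

lemma IDO_eq_ops:
  "\<phi> \<in> M \<Longrightarrow> (diff_op a b n P \<oplus>\<^bsub>End_M a b\<^esub> volterra_op a b f) \<phi> = IDO n P f \<phi>"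
  by (simp add: End_M_def diff_op_def volterra_op_eq IDO_def)

text \<open>Conversely, every operator in normal form belongs to the algebra; this puts the inverses found above
into it.\<close>

lemma leads_imp_alg:
  assumes "leads n c T" shows "restrict T M \<in> alg"
proof -
  obtain P f where P: "\<And>i. P i \<in> B1 a b" "f \<in> B2 a b" "\<And>\<phi>. \<phi> \<in> M \<Longrightarrow> T \<phi> = IDO n P f \<phi>"
    using assms by (elim leadsE) blast
  have "restrict T M = diff_op a b n P \<oplus>\<^bsub>End_M a b\<^esub> volterra_op a b f"
    by (rule extensionalityI[OF restrict_extensional extensional_End_M(2)]) (simp add: P(3) IDO_eq_ops)
  then show ?thesis using gen_subalgebra.add[OF diff_op_alg volterra_op_alg] P by simp
qed

end

text \<open>From here on \<open>R\<close> is the abstract algebra, known only through the isomorphism \<open>h\<close>.\<close>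

locale isomorphic_copy = nondegenerate_interval +
  fixes R :: "(complex, 's) module" and h :: "oper \<Rightarrow> 's"
  assumes ring_R: "ring R" and iso: "h \<in> algebra_iso (I_M a b) R"
begin

sublocale ring R by (rule ring_R)

lemma h_bij: "bij_betw h alg (carrier R)"
  and h_mult: "u \<in> alg \<Longrightarrow> v \<in> alg \<Longrightarrow> h (u \<otimes>\<^bsub>End_M a b\<^esub> v) = h u \<otimes>\<^bsub>R\<^esub> h v"
  and h_add: "u \<in> alg \<Longrightarrow> v \<in> alg \<Longrightarrow> h (u \<oplus>\<^bsub>End_M a b\<^esub> v) = h u \<oplus>\<^bsub>R\<^esub> h v"
  and h_one: "h \<one>\<^bsub>End_M a b\<^esub> = \<one>\<^bsub>R\<^esub>"
  using iso unfolding algebra_iso_def ring_iso_def ring_hom_def I_M_def by auto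

lemma h_carrier: "u \<in> alg \<Longrightarrow> h u \<in> carrier R"
  using h_bij by (auto simp: bij_betw_def)

lemma h_UnitsI:
  assumes u: "u \<in> alg" and S: "leads m d S" and inv: "\<And>\<phi>. \<phi> \<in> M \<Longrightarrow> S (u \<phi>) = \<phi> \<and> u (S \<phi>) = \<phi>"
  shows "h u \<in> Units R"
proof -
  let ?s = "restrict S M"
  have s: "?s \<in> alg" using S by (rule leads_imp_alg)
  obtain n c where l: "leads n c u" using alg_leads[OF u] by blast
  have "u \<otimes>\<^bsub>End_M a b\<^esub> ?s = \<one>\<^bsub>End_M a b\<^esub>" "?s \<otimes>\<^bsub>End_M a b\<^esub> u = \<one>\<^bsub>End_M a b\<^esub>"
    by (auto simp: End_M_def compose_def inv leads_M[OF l] restrict_def)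
  then have "h u \<otimes>\<^bsub>R\<^esub> h ?s = \<one>\<^bsub>R\<^esub>" "h ?s \<otimes>\<^bsub>R\<^esub> h u = \<one>\<^bsub>R\<^esub>"
    using h_mult[OF u s] h_mult[OF s u] h_one by simp_all
  then show ?thesis using h_carrier[OF u] h_carrier[OF s] unfolding Units_def by blast
qed

lemma UnitsE:
  assumes "y \<in> Units R"
  obtains u v where "u \<in> alg" "v \<in> alg" "y = h u" "h u \<otimes>\<^bsub>R\<^esub> h v = \<one>\<^bsub>R\<^esub>" "h v \<otimes>\<^bsub>R\<^esub> h u = \<one>\<^bsub>R\<^esub>"
    "\<And>\<phi>. \<phi> \<in> M \<Longrightarrow> u (v \<phi>) = \<phi>" "\<And>\<phi>. \<phi> \<in> M \<Longrightarrow> v (u \<phi>) = \<phi>"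
proof -
  from assms obtain z where z: "y \<in> carrier R" "z \<in> carrier R" "z \<otimes>\<^bsub>R\<^esub> y = \<one>\<^bsub>R\<^esub>" "y \<otimes>\<^bsub>R\<^esub> z = \<one>\<^bsub>R\<^esub>"
    unfolding Units_def by blast
  obtain u v where uv: "u \<in> alg" "v \<in> alg" "y = h u" "z = h v"
    using bij_betw_imp_surj_on[OF h_bij] z(1,2) by blast
  have inj: "inj_on h alg" using h_bij by (simp add: bij_betw_def)
  have "u \<otimes>\<^bsub>End_M a b\<^esub> v = \<one>\<^bsub>End_M a b\<^esub>"
    by (rule inj_onD[OF inj _ gen_subalgebra.mult[OF uv(1,2)] gen_subalgebra.one])
      (simp only: h_mult[OF uv(1,2)] h_one uv(3,4)[symmetric] z)
  moreover have "v \<otimes>\<^bsub>End_M a b\<^esub> u = \<one>\<^bsub>End_M a b\<^esub>"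
    by (rule inj_onD[OF inj _ gen_subalgebra.mult[OF uv(2,1)] gen_subalgebra.one])
      (simp only: h_mult[OF uv(2,1)] h_one uv(3,4)[symmetric] z)
  ultimately have E: "compose M u v = (\<lambda>\<phi>\<in>M. \<phi>)" "compose M v u = (\<lambda>\<phi>\<in>M. \<phi>)"
    by (simp_all add: End_M_def)
  have "u (v \<phi>) = \<phi>" "v (u \<phi>) = \<phi>" if "\<phi> \<in> M" for \<phi>
    using fun_cong[OF E(1), of \<phi>] fun_cong[OF E(2), of \<phi>] that by (simp_all add: compose_def)
  moreover have "h u \<otimes>\<^bsub>R\<^esub> h v = \<one>\<^bsub>R\<^esub>" "h v \<otimes>\<^bsub>R\<^esub> h u = \<one>\<^bsub>R\<^esub>"
    using z uv by simp_all
  ultimately show thesis using that[OF uv(1-3)] by blast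
qed

abbreviation types :: "'s set" where
  "types \<equiv> type1 a b h \<union> type2 a b R h \<union> type3 a b R h"

text \<open>In order zero the case distinction is needed because type 2 requires a nonzero Volterra part; without
one the element is of type 1.\<close>

lemma elliptic_in_types:
  assumes u: "u \<in> alg" and el: "elliptic u" shows "h u \<in> types"
proof -
  obtain n P f where P: "\<And>i. P i \<in> B1 a b" "P n \<in> B1_plus a b" "f \<in> B2 a b" "\<And>\<phi>. \<phi> \<in> M \<Longrightarrow> u \<phi> = IDO n P f \<phi>"
    using el unfolding elliptic_def by blast
  have d: "diff_op a b n P \<in> alg" by (intro diff_op_alg P)
  have v: "volterra_op a b f \<in> alg" by (intro volterra_op_alg P)
  have "u = diff_op a b n P \<oplus>\<^bsub>End_M a b\<^esub> volterra_op a b f"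
    by (rule extensionalityI[OF alg_preserves_leads(1)[OF u] extensional_End_M(2)]) (simp add: P(4) IDO_eq_ops)
  then have hu: "h u = h (diff_op a b n P) \<oplus>\<^bsub>R\<^esub> h (volterra_op a b f)" using h_add[OF d v] by simp
  show ?thesis
  proof (cases n)
    case 0
    have e: "diff_op a b n P = mult_op a b (P 0)" by (simp add: 0 diff_op_def mult_op_def)
    show ?thesis
    proof (cases "h (volterra_op a b f) = \<zero>\<^bsub>R\<^esub>")
      case True
      then have "h u = h (mult_op a b (P 0))" using hu e h_carrier[OF d] by simp
      then show ?thesis using P(2) 0 unfolding type1_def by blast
    next
      case False
      then show ?thesis using P(2,3) 0 hu unfolding type2_def e by blast
    qed
  next
    case (Suc k)
    then show ?thesis using P(1-3) hu unfolding type3_def by fastforce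
  qed
qed

lemma IDO_ops_Units:
  assumes P: "\<And>i. i \<le> n \<Longrightarrow> P i \<in> B1 a b" "P n \<in> B1_plus a b" "f \<in> B2 a b"
  shows "h (diff_op a b n P) \<oplus>\<^bsub>R\<^esub> h (volterra_op a b f) \<in> Units R"
proof -
  let ?u = "diff_op a b n P \<oplus>\<^bsub>End_M a b\<^esub> volterra_op a b f"
  have d: "diff_op a b n P \<in> alg" by (intro diff_op_alg P)
  have v: "volterra_op a b f \<in> alg" by (intro volterra_op_alg P)
  let ?P = "\<lambda>i. if i \<le> n then P i else (\<lambda>_. 0)"
  have "leads n (P n) ?u"
    by (rule leadsI[of ?P f]) (simp_all add: P B1_const IDO_eq_ops, simp add: IDO_def)
  from nonvanishing_leads_invertible[OF this P(2)] obtain m e S where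
    "leads m e S" "\<forall>\<phi>\<in>M. S (?u \<phi>) = \<phi> \<and> ?u (S \<phi>) = \<phi>" by blast
  then have "h ?u \<in> Units R" by (intro h_UnitsI[OF gen_subalgebra.add[OF d v]]) auto
  then show ?thesis using h_add[OF d v] by simp
qed

lemma types_Units: "types \<subseteq> Units R"
proof -
  have m: "diff_op a b 0 (\<lambda>_. P) = mult_op a b P" for P by (simp add: diff_op_def mult_op_def)
  have z: "h (volterra_op a b (\<lambda>_. 0)) = \<zero>\<^bsub>R\<^esub>"
  proof -
    let ?o = "volterra_op a b (\<lambda>_. 0)"
    have o: "?o \<in> alg" by (intro volterra_op_alg B2_const)
    have "?o \<oplus>\<^bsub>End_M a b\<^esub> ?o = ?o"
      by (rule extensionalityI[OF extensional_End_M(2)])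
        (simp add: volterra_op_def extensional_def, simp add: End_M_def volterra_op_eq V_zero_kernel)
    then have "h ?o \<oplus>\<^bsub>R\<^esub> h ?o = h ?o" using h_add[OF o o] by simp
    then show ?thesis using h_carrier[OF o] by (metis add.l_cancel_one)
  qed
  have 2: "h (mult_op a b P) \<oplus>\<^bsub>R\<^esub> h (volterra_op a b f) \<in> Units R" if "P \<in> B1_plus a b" "f \<in> B2 a b" for P f
    using IDO_ops_Units[of 0 "\<lambda>_. P" f] that by (simp add: m B1_plus_def)
  have 1: "h (mult_op a b P) \<in> Units R" if "P \<in> B1_plus a b" for P
  proof -
    have "h (mult_op a b P) \<in> carrier R" by (intro h_carrier mult_op_alg) (use that in \<open>simp add: B1_plus_def\<close>)
    then show ?thesis using 2[OF that B2_const[of 0]] z by simp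
  qed
  show ?thesis
    using 1 2 IDO_ops_Units unfolding type1_def type2_def type3_def by blast
qed

text \<open>A unit whose own operator is not elliptic, such as \<open>\<theta>\<close>, has an elliptic inverse, so it enters the
generated group as the inverse of a generator.\<close>

lemma U_group_eq_Units: "U_group a b R h = Units R"
proof -
  interpret G: group "units_of R" by (rule units_group)
  have sub: "types \<subseteq> carrier (units_of R)" using types_Units by (simp add: units_of_carrier)
  show ?thesis
  proof
    show "U_group a b R h \<subseteq> Units R"
      unfolding U_group_def using G.generate_incl[OF sub] by (simp add: units_of_carrier)
    show "Units R \<subseteq> U_group a b R h"
    proof
      fix y assume y: "y \<in> Units R"
      obtain u v where uv: "u \<in> alg" "v \<in> alg" "y = h u" "h u \<otimes>\<^bsub>R\<^esub> h v = \<one>\<^bsub>R\<^esub>" "h v \<otimes>\<^bsub>R\<^esub> h u = \<one>\<^bsub>R\<^esub>"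
        "\<And>\<phi>. \<phi> \<in> M \<Longrightarrow> u (v \<phi>) = \<phi>" "\<And>\<phi>. \<phi> \<in> M \<Longrightarrow> v (u \<phi>) = \<phi>" by (rule UnitsE[OF y]) blast
      obtain n c m d where "leads n c u" "leads m d v" using alg_leads[OF uv(1)] alg_leads[OF uv(2)] by blast
      from inverse_pair_elliptic[OF this uv(7,6)] consider "elliptic u" | "elliptic v" by blast
      then show "y \<in> U_group a b R h"
      proof cases
        case 1
        then show ?thesis using elliptic_in_types[OF uv(1)] uv(3) unfolding U_group_def
          by (auto intro: generate.incl)
      next
        case 2
        then have v: "h v \<in> types" by (rule elliptic_in_types[OF uv(2)])
        then have "inv\<^bsub>units_of R\<^esub> (h v) \<in> U_group a b R h" unfolding U_group_def by (rule generate.inv)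
        moreover have "inv\<^bsub>units_of R\<^esub> (h v) = h u"
          by (rule G.inv_equality) (use uv(3,4) y v types_Units in \<open>auto simp: units_of_carrier units_of_mult units_of_one\<close>)
        ultimately show ?thesis using uv(3) by simp
      qed
    qed
  qed
qed

end

theorem theorem3:
  fixes a b :: real
    and I_star :: "(complex, 's) module"
    and h :: "oper \<Rightarrow> 's"
  assumes "a < b"
    and "ring I_star"
    and "h \<in> algebra_iso (I_M a b) I_star"
  shows "U_group a b I_star h = carrier (units_of I_star)"
proof -
  interpret isomorphic_copy a b I_star h
    using assms by (simp add: isomorphic_copy_def isomorphic_copy_axioms_def nondegenerate_interval_def)
  show ?thesis by (simp add: U_group_eq_Units units_of_carrier)
qed

end
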